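(* Let $q$ be a prime power, let $n$ be an odd positive integer and let $\alpha=0.08$. Let $Z_t^{\mathrm{odd}}$ and $Y_t=Y_t^{(n)}$ be the processes defined in the context, and assume that $Y^{(n)}_0=Z^{\mathrm{odd}}_0=a$, where $a\in\mathbb{Z}+\frac12$ is a deterministic constant satisfying $|a|\le 2\alpha n$. Then there is a coupling of the processes $(Z^{\mathrm{odd}}_t)$ and $(Y_t)$ such that with probability at least $1-O(q^{-2\alpha n})$ all of the following hold: (a) for all integers $0\le i\le q^{2\alpha n}$, we have $\widehat{Y}_i=\widehat{Z}^{\mathrm{odd}}_i$; (b) for all integers $0\le i\le q^{2\alpha n}$, we have $|R_i-T_i|\le q^{-\alpha n}$; (c) $T_{\lfloor q^{2\alpha n}\rfloor}\ge q^{\alpha n}$. Here the constant implied by $O(\cdot)$ depends only on $q$.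
   Context: $(a;q)_r=\prod_{i=0}^{r-1}(1-aq^i)$. $(X_i)_{i\ge0}=(X_i^{(n)})_{i\ge 0}$ is a discrete time Markov chain on $\{0,1,\dots,n\}$ with transition matrix $$P_n(d,r)=\mathbf{1}(d+r\le n)\,q^{-(n-d-r)(n-r)}\frac{(q^{-(n-d)};q)_r(q^{-n};q)_r}{(q^{-r};q)_r}.$$ For real $t\ge 0$, $Y_t=Y^{(n)}_t=X_{2\lfloor q^{n/2}(q-1)t\rfloor}-n/2$. Its jump times are $R_0=0$ and $R_i=\inf\{t>R_{i-1}: Y_t\ne Y_{R_{i-1}}\}$, and $\widehat{Y}_i=Y_{R_i}$. $(Z^{\mathrm{odd}}_t)_{t\ge 0}$ is the continuous time Markov chain on $\mathbb{Z}+\frac12=\{a+\frac12: a\in\mathbb{Z}\}$ with transition rates $Q(a,a+1)=q^{-a}$, $Q(a,a-1)=q^{a}$, $Q(a,a)=-q^a-q^{-a}$, and $Q(a,b)=0$ otherwise (it has no explosions). Its jump times are $T_0=0$ and $T_i=\inf\{t>T_{i-1}: Z^{\mathrm{odd}}_t\ne Z^{\mathrm{odd}}_{T_{i-1}}\}$, and $\widehat{Z}^{\mathrm{odd}}_i=Z^{\mathrm{odd}}_{T_i}$. *)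

theory Defs
  imports "HOL-Probability.Probability" "HOL-Number_Theory.Prime_Powers"
begin

definition qpoch :: "real \<Rightarrow> real \<Rightarrow> nat \<Rightarrow> real" where
  "qpoch a q r = (\<Prod>i<r. 1 - a * q ^ i)"

definition trans_prob :: "real \<Rightarrow> nat \<Rightarrow> nat \<Rightarrow> nat \<Rightarrow> real" where
  "trans_prob q n d r =
     of_bool (d + r \<le> n)
     * q powi (- ((int n - int d - int r) * (int n - int r)))
     * (qpoch (q powi (- (int n - int d))) q r * qpoch (q powi (- int n)) q r
        / qpoch (q powi (- int r)) q r)"

definition markov_chain ::
  "'w measure \<Rightarrow> 's set \<Rightarrow> ('s \<Rightarrow> 's \<Rightarrow> real) \<Rightarrow> 's \<Rightarrow> (nat \<Rightarrow> 'w \<Rightarrow> 's) \<Rightarrow> bool" where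
  "markov_chain M S P x0 X \<longleftrightarrow>
     prob_space M \<and>
     (\<forall>i. X i \<in> M \<rightarrow>\<^sub>M count_space S) \<and>
     (AE \<omega> in M. X 0 \<omega> = x0) \<and>
     (\<forall>i x. \<forall>y\<in>S. \<P>(\<omega> in M. \<forall>j\<le>i. X j \<omega> = x j) > 0 \<longrightarrow>
        \<P>(\<omega> in M. X (Suc i) \<omega> = y \<bar> \<forall>j\<le>i. X j \<omega> = x j) = P (x i) y)"

(* Jump times of a path on [0, \<infinity>). They are extended reals: the value is \<infinity> once no further
   jump occurs. *)
primrec jump_time :: "(real \<Rightarrow> 's) \<Rightarrow> nat \<Rightarrow> ereal" where
  "jump_time f 0 = 0"
| "jump_time f (Suc i) =
     Inf {ereal t | t. jump_time f i < ereal t \<and> f t \<noteq> f (real_of_ereal (jump_time f i))}"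

(* Only meaningful if the jump time is finite; real_of_ereal \<infinity> = 0 is a dummy value. *)
definition jump_value :: "(real \<Rightarrow> 's) \<Rightarrow> nat \<Rightarrow> 's" where
  "jump_value f i = f (real_of_ereal (jump_time f i))"

(* Non-explosive continuous time Markov chain started at x0, for a conservative rate matrix Q
   without absorbing states (Q x x < 0 on S), in terms of the jump chain and the holding times:
   the jump chain has transition probabilities Q x y / (- Q x x) for x \<noteq> y, and conditionally
   on the first k + 1 states x 0, ..., x k of the jump chain the holding times in them are
   independent and exponential with rates - Q (x j) (x j). *)
definition cont_markov_chain ::
  "'w measure \<Rightarrow> 's set \<Rightarrow> ('s \<Rightarrow> 's \<Rightarrow> real) \<Rightarrow> 's \<Rightarrow> (real \<Rightarrow> 'w \<Rightarrow> 's) \<Rightarrow> bool" where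
  "cont_markov_chain M S Q x0 Z \<longleftrightarrow>
     prob_space M \<and>
     (\<forall>t\<ge>0. Z t \<in> M \<rightarrow>\<^sub>M count_space S) \<and>
     (\<forall>\<omega>\<in>space M. \<forall>t\<ge>0. \<forall>\<^sub>F s in at_right t. Z s \<omega> = Z t \<omega>) \<and>
     (AE \<omega> in M. (\<lambda>i. jump_time (\<lambda>t. Z t \<omega>) i) \<longlonglongrightarrow> \<infinity>) \<and>
     markov_chain M S (\<lambda>x y. if x = y then 0 else Q x y / (- Q x x)) x0
       (\<lambda>i \<omega>. jump_value (\<lambda>t. Z t \<omega>) i) \<and>
     (\<forall>k x s. (\<forall>j\<le>k. 0 \<le> s j) \<and>
        \<P>(\<omega> in M. \<forall>j\<le>k. jump_value (\<lambda>t. Z t \<omega>) j = x j) > 0 \<longrightarrow>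
        \<P>(\<omega> in M. \<forall>j\<le>k. ereal (s j) <
              jump_time (\<lambda>t. Z t \<omega>) (Suc j) - jump_time (\<lambda>t. Z t \<omega>) j
            \<bar> \<forall>j\<le>k. jump_value (\<lambda>t. Z t \<omega>) j = x j)
        = (\<Prod>j\<le>k. exp (- (- Q (x j) (x j)) * s j)))"

definition half_ints :: "real set" where
  "half_ints = {of_int k + 1/2 | k. True}"

definition odd_rate :: "real \<Rightarrow> real \<Rightarrow> real \<Rightarrow> real" where
  "odd_rate q a b =
     (if b = a + 1 then q powr (- a)
      else if b = a - 1 then q powr a
      else if b = a then - (q powr a) - q powr (- a)
      else 0)"

definition Y_process :: "real \<Rightarrow> nat \<Rightarrow> (nat \<Rightarrow> 'w \<Rightarrow> nat) \<Rightarrow> real \<Rightarrow> 'w \<Rightarrow> real" where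
  "Y_process q n X t \<omega> =
     real (X (2 * nat \<lfloor>q powr (real n / 2) * (q - 1) * t\<rfloor>) \<omega>) - real n / 2"

end

theory Submission
  imports Defs "HOL-Real_Asymp.Real_Asymp"
begin

text \<open>
  The chain \<open>X\<close> is almost an involution: from \<open>d\<close> it moves to \<open>n - d\<close> except with a probability close
  to \<open>q powr (- d) / (q - 1)\<close>, in which case it nearly always lands one below. Two steps of \<open>X\<close> therefore form
  a lazy nearest-neighbour walk up to relative errors of order \<open>q powr (- d) + q powr (d - n)\<close>. In the centred coordinate
  \<open>a = d - n/2\<close> it moves up and down with probabilities close to \<open>q powr (- a) / N\<close> and
  \<open>q powr a / N\<close>, where \<open>N = q powr (n/2) * (q - 1)\<close>. These are the rates of \<open>Z\<close> once \<open>N\<close> pairs of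
  steps (ticks) count as one unit of time.

  The coupling has three layers, all functions of one sequence of independent uniform variables.
  First come the jump chain \<open>J\<close> of \<open>Z\<close> and its exponential holding times \<open>H\<close>. Rounding each \<open>H\<close> up on
  a grid that depends on the current state gives geometric holding times \<open>G\<close>, tuned so that the
  walk \<open>A\<close> that follows \<open>J\<close> with holding times \<open>G\<close> is a Markov chain in tick time that stays put with exactly
  the same probability as two steps of \<open>X\<close>. Last, \<open>X\<close> is sampled tick by tick from its conditional
  law given \<open>A\<close> under a maximal coupling of one tick of \<open>A\<close> with two steps of \<open>X\<close>; lemma \<open>path_event\<close>
  shows that the pair is a Markov chain with this coupling as its kernel. So \<open>X\<close>
  and \<open>Z\<close> have their prescribed laws by construction.

  Because the probabilities of staying agree, \<open>X\<close> and \<open>A\<close> separate only at a jump, with a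
  probability of order \<open>q powr (- 0.34 n)\<close> per jump as long as \<open>\<bar>a\<bar> \<le> 0.16 n + 1\<close>; and from inside
  \<open>\<bar>a\<bar> \<le> 0.16 n + 1\<close> a jump leaves this range with probability at most of order \<open>q powr (- 0.32 n)\<close>,
  because the walk drifts towards the centre. Summed over \<open>q powr (0.16 n)\<close> jumps both are
  \<open>O(q powr (- 0.16 n))\<close> (\<open>prob_mismatch\<close>, \<open>prob_breaks\<close>). The clocks differ by the rounding, at
  most \<open>1/N\<close> per jump, and by a relative error of order \<open>q powr (- 0.34 n)\<close> (\<open>tick_time\<close>);
  this is harmless because no holding time exceeds \<open>q powr (0.1 n) / (16 q)\<close>, up to a negligible
  probability (\<open>prob_H_large\<close>). Finally the walk returns to \<open>a = 1/2\<close> or \<open>a = - 1/2\<close>, where it holds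
  for a time of order one, after a positive proportion of its jumps; a potential that grows like
  \<open>2 powr \<bar>a\<bar>\<close> makes this quantitative (\<open>prob_slow_count\<close>). This bounds the jump times from below and
  also excludes explosion.
\<close>

section \<open>The one-step law as a rank distribution\<close>

text \<open>The law of the rank \<open>r\<close> of a uniformly random \<open>k \<times> n\<close> matrix over a field with \<open>q\<close> elements. One step
  of \<open>X\<close> from \<open>d\<close> is the case \<open>k = n - d\<close>. This reading explains why the numbers
  sum to one: adding a row raises the rank unless the row lies in the span of the others.\<close>
definition rank_prob :: "real \<Rightarrow> nat \<Rightarrow> nat \<Rightarrow> nat \<Rightarrow> real" where
  "rank_prob q n k r =
     q powi (- ((int k - int r) * (int n - int r)))
     * (qpoch (q powi (- int k)) q r * qpoch (q powi (- int n)) q r / qpoch (q powi (- int r)) q r)"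

lemma trans_prob_eq_rank_prob:
  "d \<le> n \<Longrightarrow> trans_prob q n d r = of_bool (d + r \<le> n) * rank_prob q n (n - d) r"
  by (simp add: trans_prob_def rank_prob_def of_nat_diff)

lemma qpoch_0 [simp]: "qpoch a q 0 = 1" by (simp add: qpoch_def)
lemma qpoch_Suc: "qpoch a q (Suc r) = qpoch a q r * (1 - a * q ^ r)" by (simp add: qpoch_def)
lemma qpoch_Suc_shift: "qpoch a q (Suc r) = (1 - a) * qpoch (a * q) q r"
  by (simp add: qpoch_def prod.lessThan_Suc_shift mult.assoc del: prod.lessThan_Suc)

text \<open>To leading order the probability that one step of the chain from \<open>d\<close> misses \<open>n - d\<close>; it is
  the value of the geometric series \<open>\<Sum>i > d. q powi (- i)\<close>.\<close>
definition step_scale :: "real \<Rightarrow> nat \<Rightarrow> real" where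
  "step_scale q d = q powi (- int d) / (q - 1)"

context
  fixes q :: real
  assumes q2: "2 \<le> q"
begin

lemma powi_neg_le_1: "0 \<le> k \<Longrightarrow> q powi (- k) \<le> 1" for k :: int
  using q2 by (metis neg_0_le_iff_le neg_le_0_iff_le order.trans one_le_numeral power_int_0_right power_int_increasing)

lemma qpoch_neg_pos:
  assumes "r \<le> k"
  shows "qpoch (q powi (- int k)) q r > 0"
proof -
  have "q powi (- int k) * q ^ i < 1" if "i < r" for i
  proof -
    have "q powi (- int k) * q ^ i = q powi (int i - int k)"
      using q2 by (simp add: power_int_diff power_int_minus field_simps)
    also have "\<dots> < q powi 0"
      using q2 assms that by (intro power_int_strict_increasing) auto
    finally show ?thesis by simp
  qed
  then show ?thesis unfolding qpoch_def by (intro prod_pos) auto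
qed

lemma qpoch_neg_nonneg: "qpoch (q powi (- int k)) q r \<ge> 0"
proof (cases "r \<le> k")
  case True then show ?thesis using qpoch_neg_pos[of r k] by simp
next
  case False
  then have "k \<in> {..<r}" by simp
  then have "qpoch (q powi (- int k)) q r = 0"
    unfolding qpoch_def using q2 
    by (intro prod_zero) (auto intro!: bexI[of _ k] simp: power_int_minus)
  then show ?thesis by simp
qed

lemma qpoch_neg_eq_0: "k < r \<Longrightarrow> qpoch (q powi (- int k)) q r = 0"
  unfolding qpoch_def using q2 
  by (intro prod_zero) (auto intro!: bexI[of _ k] simp: power_int_minus)

lemma rank_prob_nonneg: "rank_prob q n k r \<ge> 0"
  unfolding rank_prob_def using q2 qpoch_neg_nonneg by auto

lemma rank_prob_eq_0: "k < r \<Longrightarrow> rank_prob q n k r = 0"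
  unfolding rank_prob_def using qpoch_neg_eq_0 by simp

lemma rank_prob_Suc_0: "rank_prob q n (Suc k) 0 = rank_prob q n k 0 * q powi (- int n)"
  using q2 by (simp add: rank_prob_def power_int_add[symmetric] algebra_simps)

text \<open>A further row keeps the rank \<open>r + 1\<close> with probability \<open>q powi (r + 1 - n)\<close> and raises the rank \<open>r\<close>
  with probability \<open>1 - q powi (r - n)\<close>. Algebraically this is the Pascal rule of the Gaussian
  binomial coefficients, which here reads \<open>1 - v * u = (1 - v) + v * (1 - u)\<close>.\<close>
lemma rank_prob_Suc_Suc:
  "rank_prob q n (Suc k) (Suc r) =
     rank_prob q n k (Suc r) * q powi (int r + 1 - int n) + rank_prob q n k r * (1 - q powi (int r - int n))"
proof -
  define A where "A = qpoch (q powi (- int k)) q r"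
  define D where "D = qpoch (q powi (- int r)) q r"
  define c where "c = qpoch (q powi (- int n)) q r"
  have D0: "D > 0" unfolding D_def by (rule qpoch_neg_pos) simp
  have q0: "q \<noteq> 0" "q > 0" using q2 by auto
  have sh: "qpoch (q powi (- int (Suc m))) q (Suc r) = (1 - q powi (- int (Suc m))) * qpoch (q powi (- int m)) q r" for m
    using q0 by (simp add: qpoch_Suc_shift power_int_diff power_int_minus field_simps)
  have last: "qpoch (q powi (- int m)) q (Suc r) = qpoch (q powi (- int m)) q r * (1 - q powi (int r - int m))" for m
    using q0 by (simp add: qpoch_Suc power_int_diff power_int_minus field_simps)
  have B0: "1 - q powi (- int (Suc r)) \<noteq> 0" 
  proof -
    have "q powi (- int (Suc r)) < q powi 0" using q2 by (intro power_int_strict_increasing) auto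
    then show ?thesis by simp
  qed
  define u where "u = q powi (- int (Suc r))"
  define v where "v = q powi (int r - int k)"
  define w where "w = q powi (int r - int n)"
  define E where "E = q powi (- ((int k - int r) * (int n - int r - 1)))"
  have uv: "q powi (- int (Suc k)) = v * u"
    unfolding u_def v_def using q0 by (simp add: algebra_simps flip: power_int_add)
  have num: "qpoch (q powi (- int (Suc k))) q (Suc r) = (1 - v * u) * A"
    by (subst sh) (simp only: uv A_def)
  have den: "qpoch (q powi (- int (Suc r))) q (Suc r) = (1 - u) * D"
    by (subst sh) (simp only: u_def D_def)
  have top: "qpoch (q powi (- int n)) q (Suc r) = c * (1 - w)"
    by (subst last) (simp only: c_def w_def)
  have 1: "rank_prob q n (Suc k) (Suc r) = E * ((1 - v * u) * A * (c * (1 - w)) / ((1 - u) * D))"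
  proof -
    have "(int (Suc k) - int (Suc r)) * (int n - int (Suc r)) = (int k - int r) * (int n - int r - 1)"
      by (simp add: algebra_simps)
    then show ?thesis unfolding rank_prob_def num den top E_def by (simp only:)
  qed
  have 2: "rank_prob q n k (Suc r) * q powi (int r + 1 - int n) = E * (A * (1 - v) * (c * (1 - w)) / ((1 - u) * D))"
  proof -
    have "q powi (- ((int k - int (Suc r)) * (int n - int (Suc r)))) * q powi (int r + 1 - int n) = E"
      unfolding E_def using q0 by (simp flip: power_int_add add: algebra_simps)
    moreover have "rank_prob q n k (Suc r) = q powi (- ((int k - int (Suc r)) * (int n - int (Suc r)))) * (A * (1 - v) * (c * (1 - w)) / ((1 - u) * D))"
      unfolding rank_prob_def den top last[of k] by (simp only: A_def v_def)
    ultimately show ?thesis by (simp add: mult_ac)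
  qed
  have 3: "rank_prob q n k r * (1 - w) = E * (v * A * (c * (1 - w)) / D)"
  proof -
    have "q powi (- ((int k - int r) * (int n - int r))) = E * v"
      unfolding E_def v_def using q0 by (simp flip: power_int_add add: algebra_simps)
    then show ?thesis unfolding rank_prob_def
      by (simp add: A_def D_def c_def mult_ac)
  qed
  have "(1 - v * u) / (1 - u) = (1 - v) / (1 - u) + v"
    using B0 unfolding u_def[symmetric] by (simp add: field_simps)
  then have "E * A * c * (1 - w) / D * ((1 - v * u) / (1 - u)) = E * A * c * (1 - w) / D * ((1 - v) / (1 - u) + v)"
    by simp
  then show ?thesis unfolding 1 2 w_def[symmetric] 3 using D0 B0[folded u_def]
    by (simp add: field_simps)
qed

lemma sum_rank_prob: "(\<Sum>r\<le>k. rank_prob q n k r) = 1"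
proof (induction k)
  case 0
  then show ?case by (simp add: rank_prob_def)
next
  case (Suc k)
  have "(\<Sum>r\<le>Suc k. rank_prob q n (Suc k) r) = rank_prob q n (Suc k) 0 + (\<Sum>r\<le>k. rank_prob q n (Suc k) (Suc r))"
    by (rule sum.atMost_Suc_shift)
  also have "\<dots> = (rank_prob q n k 0 * q powi (int 0 - int n) + (\<Sum>r\<le>k. rank_prob q n k (Suc r) * q powi (int (Suc r) - int n)))
       + (\<Sum>r\<le>k. rank_prob q n k r * (1 - q powi (int r - int n)))"
    by (simp add: rank_prob_Suc_0 rank_prob_Suc_Suc sum.distrib add_ac)
  also have "rank_prob q n k 0 * q powi (int 0 - int n) + (\<Sum>r\<le>k. rank_prob q n k (Suc r) * q powi (int (Suc r) - int n))
     = (\<Sum>r\<le>Suc k. rank_prob q n k r * q powi (int r - int n))"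
    by (rule sum.atMost_Suc_shift[symmetric])
  also have "\<dots> = (\<Sum>r\<le>k. rank_prob q n k r * q powi (int r - int n))"
    by (simp add: rank_prob_eq_0)
  also have "\<dots> + (\<Sum>r\<le>k. rank_prob q n k r * (1 - q powi (int r - int n))) = (\<Sum>r\<le>k. rank_prob q n k r)"
    by (simp add: sum.distrib[symmetric] algebra_simps)
  finally show ?case using Suc by simp
qed

lemma trans_prob_nonneg: "d \<le> n \<Longrightarrow> trans_prob q n d r \<ge> 0"
  by (simp add: trans_prob_eq_rank_prob rank_prob_nonneg)

lemma sum_trans_prob: 
  assumes "d \<le> n" shows "(\<Sum>r\<le>n. trans_prob q n d r) = 1"
proof -
  have "(\<Sum>r\<le>n. trans_prob q n d r) = (\<Sum>r\<le>n - d. rank_prob q n (n - d) r)"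
    using assms by (intro sum.mono_neutral_cong_right) (auto simp: trans_prob_eq_rank_prob)
  then show ?thesis by (simp add: sum_rank_prob)
qed

lemma qpoch_lower:
  assumes "r \<le> n"
  shows "qpoch (q powi (- int n)) q r \<ge> 1 - q powi (int r - int n) / (q - 1)"
proof -
  have le1: "q powi (- int n) * q ^ i \<le> 1" if "i < r" for i
  proof -
    have "q powi (- int n) * q ^ i = q powi (int i - int n)"
      using q2 by (simp add: power_int_diff power_int_minus field_simps)
    also have "\<dots> \<le> q powi 0"
      using q2 assms that by (intro power_int_increasing) auto
    finally show ?thesis by simp
  qed
  have "qpoch (q powi (- int n)) q r \<ge> 1 - (\<Sum>i<r. q powi (- int n) * q ^ i)"
    unfolding qpoch_def using le1 q2 by (intro Weierstrass_prod_ineq) auto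
  moreover have "(\<Sum>i<r. q powi (- int n) * q ^ i) = q powi (- int n) * ((q ^ r - 1) / (q - 1))"
    using q2 by (simp add: sum_distrib_left[symmetric] geometric_sum)
  moreover have "\<dots> \<le> q powi (- int n) * (q ^ r / (q - 1))"
    using q2 by (intro mult_left_mono divide_right_mono) auto
  moreover have "q powi (- int n) * (q ^ r / (q - 1)) = q powi (int r - int n) / (q - 1)"
    using q2 by (simp add: power_int_diff power_int_minus field_simps)
  ultimately show ?thesis by linarith
qed

lemma step_scale_pos: "step_scale q d > 0" unfolding step_scale_def using q2 by simp

lemma trans_prob_reflect_lower:
  assumes "d \<le> n"
  shows "trans_prob q n d (n - d) \<ge> 1 - step_scale q d"
proof -
  have "qpoch (q powi (- int (n - d))) q (n - d) > 0" by (rule qpoch_neg_pos) simp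
  then show ?thesis using qpoch_lower[of "n - d" n] assms
    by (simp add: trans_prob_eq_rank_prob rank_prob_def step_scale_def of_nat_diff)
qed

text \<open>For rank \<open>k - 1\<close> the Gaussian binomial coefficient is the quotient of \<open>1 - q powi (- k)\<close> and
  \<open>1 - q powi (- 1)\<close>, which leaves a single factor of Pochhammer type to estimate.\<close>
lemma trans_prob_reflect_minus_one_lower:
  assumes "d < n"
  shows "trans_prob q n d (n - d - 1) \<ge> step_scale q d * (1 - q powi (int d - int n)) * (1 - step_scale q (Suc d))"
proof -
  define r where "r = n - d - 1"
  have r: "n = d + Suc r" using assms by (simp add: r_def)
  have D0: "qpoch (q powi (- int r)) q r > 0" "qpoch (q powi (- int (Suc r))) q r > 0" by (rule qpoch_neg_pos; simp)+
  have q0: "q \<noteq> 0" "q > 0" "q - 1 > 0" using q2 by auto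
  have *: "qpoch (q powi (- int (Suc r))) q r * (1 - q powi (-1)) = (1 - q powi (- int (Suc r))) * qpoch (q powi (- int r)) q r"
  proof -
    have "q powi (- int (Suc r)) * q = q powi (- int r)" "q powi (- int (Suc r)) * q ^ r = q powi (-1)"
      using q0 by (simp_all add: power_int_diff power_int_minus field_simps)
    then show ?thesis
      using qpoch_Suc_shift[of "q powi (- int (Suc r))" q r] qpoch_Suc[of "q powi (- int (Suc r))" q r] by metis
  qed
  have "1 - q powi (-1) \<noteq> 0" using q2 by (simp add: field_simps power_int_minus)
  then have b: "qpoch (q powi (- int (Suc r))) q r / qpoch (q powi (- int r)) q r = (1 - q powi (- int (Suc r))) / (1 - q powi (-1))"
    using * D0 by (simp add: field_simps)
  have "trans_prob q n d r = rank_prob q n (Suc r) r"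
    using r by (simp add: trans_prob_eq_rank_prob)
  also have "\<dots> = q powi (- (int d + 1)) * (qpoch (q powi (- int (Suc r))) q r / qpoch (q powi (- int r)) q r) * qpoch (q powi (- int n)) q r"
  proof -
    have "(int (Suc r) - int r) * (int n - int r) = int d + 1" by (simp add: r)
    then show ?thesis unfolding rank_prob_def by (simp only: times_divide_eq_right times_divide_eq_left mult_ac)
  qed
  also have "\<dots> = step_scale q d * (1 - q powi (int d - int n)) * qpoch (q powi (- int n)) q r"
    unfolding b using q0 r by (simp add: step_scale_def power_int_diff power_int_minus field_simps)
  also have "\<dots> \<ge> step_scale q d * (1 - q powi (int d - int n)) * (1 - step_scale q (Suc d))"
  proof (intro mult_left_mono mult_nonneg_nonneg)
    show "1 - step_scale q (Suc d) \<le> qpoch (q powi - int n) q r" using qpoch_lower[of r n] r by (simp add: step_scale_def)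
    show "0 \<le> 1 - q powi (int d - int n)" using powi_neg_le_1[of "int n - int d"] assms by simp
  qed (use step_scale_pos[of d] in auto)
  finally show ?thesis by (simp add: r_def)
qed

end

section \<open>Couplings of probability mass functions\<close>

lemma ex_pmf_finite:
  fixes f :: "'a \<Rightarrow> real"
  assumes "finite A" "\<And>x. x \<in> A \<Longrightarrow> 0 \<le> f x" "sum f A = 1"
  shows "\<exists>p. \<forall>x. pmf p x = (if x \<in> A then f x else 0)"
proof -
  let ?g = "\<lambda>x. if x \<in> A then f x else 0"
  have "(\<integral>\<^sup>+ x. ennreal (?g x) \<partial>count_space UNIV) = (\<Sum>x\<in>A. ennreal (?g x))"
    using assms by (intro nn_integral_count_space') auto
  also have "\<dots> = ennreal (\<Sum>x\<in>A. ?g x)"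
    using assms by (intro sum_ennreal) auto
  also have "(\<Sum>x\<in>A. ?g x) = 1" using assms(3) by simp
  finally have "pmf (embed_pmf ?g) x = ?g x" for x
    using assms by (intro pmf_embed_pmf) auto
  then show ?thesis by blast
qed

lemma prob_bind_pmf:
  "measure_pmf.prob (bind_pmf p g) A = (\<integral>x. measure_pmf.prob (g x) A \<partial>measure_pmf p)"
proof -
  have "ennreal (measure_pmf.prob (bind_pmf p g) A) = (\<integral>\<^sup>+x. ennreal (measure_pmf.prob (g x) A) \<partial>measure_pmf p)"
    by (simp flip: measure_pmf.emeasure_eq_measure)
  also have "\<dots> = ennreal (\<integral>x. measure_pmf.prob (g x) A \<partial>measure_pmf p)"
    by (intro nn_integral_eq_integral measure_pmf.integrable_const_bound[where B=1]) auto
  finally show ?thesis by (simp add: integral_nonneg_AE)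
qed

text \<open>Draw \<open>x\<close> from \<open>p\<close> and keep \<open>y = f x\<close> with probability \<open>min (p' y) (r y) / p' y\<close>, where \<open>p'\<close> is
  the law of \<open>f x\<close>; otherwise redraw \<open>y\<close> from the part of \<open>r\<close> that this does not cover. The
  redrawn mass is the excess of \<open>r\<close> over \<open>p'\<close>.\<close>
lemma maximal_coupling:
  fixes p :: "'a pmf" and r :: "'b pmf" and f :: "'a \<Rightarrow> 'b"
  assumes fin: "finite (set_pmf r)"
  shows "\<exists>c. map_pmf fst c = p \<and> map_pmf snd c = r \<and>
    measure_pmf.prob c {z. f (fst z) \<noteq> snd z} \<le> (\<Sum>y\<in>set_pmf r. max 0 (pmf r y - pmf (map_pmf f p) y))"
proof -
  let ?R = "set_pmf r"
  define p' where "p' = map_pmf f p"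
  define \<mu> where "\<mu> y = min (pmf p' y) (pmf r y)" for y
  define \<delta> where "\<delta> = (\<Sum>y\<in>?R. pmf r y - \<mu> y)"
  have \<mu>: "0 \<le> \<mu> y" "\<mu> y \<le> pmf r y" "\<mu> y \<le> pmf p' y" for y unfolding \<mu>_def by auto
  have \<delta>0: "\<delta> \<ge> 0" unfolding \<delta>_def using \<mu> by (intro sum_nonneg) auto
  have \<delta>1: "\<delta> = 1 - (\<Sum>y\<in>?R. \<mu> y)"
    unfolding \<delta>_def using fin by (simp add: sum_subtractf sum_pmf_eq_1)
  \<comment> \<open>The law from which \<open>y\<close> is redrawn; it is never used if the excess \<open>\<delta>\<close> vanishes.\<close>
  obtain \<rho> where \<rho>: "\<And>y. \<delta> * pmf \<rho> y = pmf r y - \<mu> y"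
  proof (cases "\<delta> = 0")
    case True
    then have "pmf r y - \<mu> y = 0" for y
    proof (cases "y \<in> ?R")
      case T: True
      from True have "\<forall>y\<in>?R. pmf r y - \<mu> y = 0"
        unfolding \<delta>_def using \<mu> fin by (subst (asm) sum_nonneg_eq_0_iff) auto
      with T show ?thesis by auto
    next
      case False then have "pmf r y = 0" by (simp add: pmf_eq_0_set_pmf)
      with \<mu>[of y] show ?thesis by simp
    qed
    then show ?thesis using True that[of r] by simp
  next
    case False
    have "\<exists>\<rho>. \<forall>x. pmf \<rho> x = (if x \<in> ?R then (pmf r x - \<mu> x) / \<delta> else 0)"
      using False \<mu> \<delta>0 fin
      by (intro ex_pmf_finite) (auto simp: sum_divide_distrib[symmetric] \<delta>_def[symmetric])
    then obtain \<rho> where *: "\<And>x. pmf \<rho> x = (if x \<in> ?R then (pmf r x - \<mu> x) / \<delta> else 0)" by blast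
    have "\<delta> * pmf \<rho> y = pmf r y - \<mu> y" for y
    proof (cases "y \<in> ?R")
      case True then show ?thesis using False * by simp
    next
      case F: False then have "pmf r y = 0" by (simp add: pmf_eq_0_set_pmf)
      with \<mu>[of y] F * show ?thesis by simp
    qed
    then show ?thesis using that by blast
  qed
  define \<theta> where "\<theta> y = \<mu> y / pmf p' y" for y
  have \<theta>: "0 \<le> \<theta> y" "\<theta> y \<le> 1" for y
    using \<mu>[of y] unfolding \<theta>_def by (auto simp: divide_le_eq)
  have p\<theta>: "\<theta> y * pmf p' y = \<mu> y" for y
    using \<mu>[of y] unfolding \<theta>_def by auto
  have \<theta>R: "\<theta> y \<noteq> 0 \<Longrightarrow> y \<in> ?R" for y
    unfolding \<theta>_def \<mu>_def by (auto simp: set_pmf_iff)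
  have int\<theta>: "(\<integral>y. \<theta> y \<partial>measure_pmf p') = 1 - \<delta>"
    using \<theta>R fin by (subst integral_measure_pmf_real[of ?R]) (auto simp: \<delta>1 p\<theta>)
  have int1: "integrable (measure_pmf p') \<theta>"
    using \<theta> by (intro measure_pmf.integrable_const_bound[where B=1]) auto
  define c where "c = bind_pmf p (\<lambda>x. bind_pmf (bernoulli_pmf (\<theta> (f x)))
     (\<lambda>b. if b then return_pmf (x, f x) else map_pmf (Pair x) \<rho>))"
  have "map_pmf fst c = bind_pmf p (\<lambda>x. bind_pmf (bernoulli_pmf (\<theta> (f x))) (\<lambda>b. return_pmf x))"
    unfolding c_def map_bind_pmf by (intro bind_pmf_cong refl) (auto simp: map_pmf_comp)
  then have 1: "map_pmf fst c = p" by (simp add: bind_return_pmf')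
  have "map_pmf snd c = bind_pmf p (\<lambda>x. bind_pmf (bernoulli_pmf (\<theta> (f x))) (\<lambda>b. if b then return_pmf (f x) else \<rho>))"
    unfolding c_def map_bind_pmf by (intro bind_pmf_cong refl) (auto simp: map_pmf_comp)
  also have "\<dots> = bind_pmf p' (\<lambda>y. bind_pmf (bernoulli_pmf (\<theta> y)) (\<lambda>b. if b then return_pmf y else \<rho>))"
    unfolding p'_def by (simp add: bind_map_pmf)
  also have "\<dots> = r"
  proof (rule pmf_eqI)
    fix y
    have "pmf (bind_pmf p' (\<lambda>y. bind_pmf (bernoulli_pmf (\<theta> y)) (\<lambda>b. if b then return_pmf y else \<rho>))) y
       = (\<integral>z. indicator {y} z * \<theta> z + pmf \<rho> y * (1 - \<theta> z) \<partial>measure_pmf p')"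
      unfolding pmf_bind[of p']
    proof (intro Bochner_Integration.integral_cong refl)
      fix z
      show "pmf (bind_pmf (bernoulli_pmf (\<theta> z)) (\<lambda>b. if b then return_pmf z else \<rho>)) y
         = indicator {y} z * \<theta> z + pmf \<rho> y * (1 - \<theta> z)"
        using \<theta>[of z] by (simp add: pmf_bind)
    qed
    also have "\<dots> = (\<integral>z. indicator {y} z * \<theta> z \<partial>measure_pmf p') + pmf \<rho> y * (1 - (1 - \<delta>))"
      using int1 \<theta> by (subst Bochner_Integration.integral_add)
        (auto simp: int\<theta> intro!: measure_pmf.integrable_const_bound[where B=1] simp: indicator_def)
    also have "(\<integral>z. indicator {y} z * \<theta> z \<partial>measure_pmf p') = \<mu> y"
      by (subst integral_measure_pmf_real[of "{y}"]) (auto simp: p\<theta> indicator_def split: if_splits)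
    also have "\<mu> y + pmf \<rho> y * (1 - (1 - \<delta>)) = pmf r y" using \<rho>[of y] by (simp add: mult.commute)
    finally show "pmf (bind_pmf p' (\<lambda>y. bind_pmf (bernoulli_pmf (\<theta> y)) (\<lambda>b. if b then return_pmf y else \<rho>))) y = pmf r y" .
  qed
  finally have 2: "map_pmf snd c = r" .
  have "measure_pmf.prob c {z. f (fst z) \<noteq> snd z} \<le> (\<integral>x. 1 - \<theta> (f x) \<partial>measure_pmf p)"
    unfolding c_def prob_bind_pmf[of p]
  proof (intro integral_mono)
    show "integrable (measure_pmf p) (\<lambda>x. 1 - \<theta> (f x))"
      using \<theta> by (intro measure_pmf.integrable_const_bound[where B=1]) auto
    show "integrable (measure_pmf p) (\<lambda>x. measure_pmf.prob (bind_pmf (bernoulli_pmf (\<theta> (f x)))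
        (\<lambda>b. if b then return_pmf (x, f x) else map_pmf (Pair x) \<rho>)) {z. f (fst z) \<noteq> snd z})"
      by (intro measure_pmf.integrable_const_bound[where B=1]) auto
    fix x
    have "measure_pmf.prob (map_pmf (Pair x) \<rho>) {z. f (fst z) \<noteq> snd z} * (1 - \<theta> (f x)) \<le> 1 * (1 - \<theta> (f x))"
      using \<theta>[of "f x"] by (intro mult_right_mono) auto
    then show "measure_pmf.prob (bind_pmf (bernoulli_pmf (\<theta> (f x)))
        (\<lambda>b. if b then return_pmf (x, f x) else map_pmf (Pair x) \<rho>)) {z. f (fst z) \<noteq> snd z} \<le> 1 - \<theta> (f x)"
      unfolding prob_bind_pmf[of "bernoulli_pmf _"] using \<theta>[of "f x"] 
      by (subst integral_bernoulli_pmf) (simp_all add: measure_return_pmf)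
  qed
  also have "\<dots> = (\<integral>y. 1 - \<theta> y \<partial>measure_pmf p')" by (simp add: p'_def)
  also have "\<dots> = \<delta>" using int1 by (simp add: int\<theta>)
  also have "\<dots> = (\<Sum>y\<in>?R. max 0 (pmf r y - pmf (map_pmf f p) y))"
    unfolding \<delta>_def \<mu>_def p'_def by (intro sum.cong) auto
  finally show ?thesis using 1 2 by blast
qed

text \<open>Off the support of the second marginal any law would do; taking the first marginal there keeps the
  support of the conditional law inside that of the first marginal everywhere.\<close>
lemma ex_conditional_pmf:
  fixes c :: "('a \<times> 'b) pmf"
  shows "\<exists>\<kappa>. \<forall>y. set_pmf (\<kappa> y) \<subseteq> set_pmf (map_pmf fst c) \<and>
    (\<forall>w. pmf (map_pmf snd c) y * pmf (\<kappa> y) w = pmf c (w, y))"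
proof -
  have "\<exists>\<kappa>. set_pmf \<kappa> \<subseteq> set_pmf (map_pmf fst c) \<and> (\<forall>w. pmf (map_pmf snd c) y * pmf \<kappa> w = pmf c (w, y))" for y
  proof (cases "set_pmf c \<inter> snd -` {y} = {}")
    case True
    then have "pmf (map_pmf snd c) y = 0" "\<And>w. pmf c (w, y) = 0"
      by (auto simp: pmf_eq_0_set_pmf)
    then show ?thesis by (intro exI[of _ "map_pmf fst c"]) auto
  next
    case False
    let ?\<kappa> = "map_pmf fst (cond_pmf c (snd -` {y}))"
    have pos: "measure_pmf.prob c (snd -` {y}) > 0" using False measure_pmf_posI[of _ c] by blast
    have "pmf ?\<kappa> w = pmf (cond_pmf c (snd -` {y})) (w, y)" for w
    proof -
      have "pmf ?\<kappa> w = measure_pmf.prob (cond_pmf c (snd -` {y})) (fst -` {w})" by (simp add: pmf_map)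
      also have "\<dots> = measure_pmf.prob (cond_pmf c (snd -` {y})) {(w, y)}"
      proof -
        have "fst -` {w} \<inter> set_pmf (cond_pmf c (snd -` {y})) = {(w, y)} \<inter> set_pmf (cond_pmf c (snd -` {y}))"
          using False by auto
        then show ?thesis by (metis measure_Int_set_pmf)
      qed
      finally show ?thesis by (simp add: measure_pmf_single)
    qed
    then have "pmf (map_pmf snd c) y * pmf ?\<kappa> w = pmf c (w, y)" for w
      using pos by (simp add: pmf_cond[OF False] pmf_map)
    moreover have "set_pmf ?\<kappa> \<subseteq> set_pmf (map_pmf fst c)" using False by auto
    ultimately show ?thesis by (intro exI[of _ ?\<kappa>] conjI allI)
  qed
  then show ?thesis by (intro choice allI)
qed

section \<open>Path laws of Markov chains\<close>

text \<open>The law of the next \<open>k\<close> states after \<open>s\<close>. Working with lists peels off the first step, which is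
  the direction in which all later estimates are proved by induction.\<close>
primrec path_pmf :: "('s \<Rightarrow> 's pmf) \<Rightarrow> nat \<Rightarrow> 's \<Rightarrow> 's list pmf" where
  "path_pmf K 0 s = return_pmf []"
| "path_pmf K (Suc k) s = bind_pmf (K s) (\<lambda>x. map_pmf ((#) x) (path_pmf K k x))"

primrec path_weight :: "('s \<Rightarrow> 's pmf) \<Rightarrow> 's \<Rightarrow> 's list \<Rightarrow> real" where
  "path_weight K s [] = 1"
| "path_weight K s (x # l) = pmf (K s) x * path_weight K x l"

lemma set_path_pmf: "l \<in> set_pmf (path_pmf K k s) \<Longrightarrow> length l = k"
  by (induction k arbitrary: s l) auto

lemma pmf_path_pmf: "length l = k \<Longrightarrow> pmf (path_pmf K k s) l = path_weight K s l"
proof (induction k arbitrary: s l)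
  case (Suc k)
  then obtain x l' where l: "l = x # l'" "length l' = k" by (cases l) auto
  have "pmf (map_pmf ((#) y) (path_pmf K k y)) (x # l') = indicator {x} y * pmf (path_pmf K k x) l'" for y
  proof (cases "y = x")
    case True
    then show ?thesis by (simp add: pmf_map_inj')
  next
    case False
    then show ?thesis by (auto simp: pmf_eq_0_set_pmf)
  qed
  then have "pmf (path_pmf K (Suc k) s) l = (\<integral>y. indicator {x} y * pmf (path_pmf K k x) l' \<partial>measure_pmf (K s))"
    by (simp add: l pmf_bind)
  also have "\<dots> = pmf (K s) x * pmf (path_pmf K k x) l'"
    by (subst integral_measure_pmf_real[of "{x}"]) (auto simp: indicator_def split: if_splits)
  finally show ?case using Suc.IH[OF l(2)] l by simp
qed simp

lemma prob_path_pmf_Suc: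
  "measure_pmf.prob (path_pmf K (Suc k) s) C =
     (\<integral>x. measure_pmf.prob (path_pmf K k x) {l. x # l \<in> C} \<partial>measure_pmf (K s))"
  by (simp add: prob_bind_pmf vimage_def)

lemma map_path_pmf:
  assumes "\<And>s. map_pmf f (K s) = K' (f s)"
  shows "map_pmf (map f) (path_pmf K k s) = path_pmf K' k (f s)"
proof (induction k arbitrary: s)
  case (Suc k)
  have "map_pmf (map f) (path_pmf K (Suc k) s) =
     bind_pmf (K s) (\<lambda>x. map_pmf ((#) (f x)) (map_pmf (map f) (path_pmf K k x)))"
    by (simp add: map_bind_pmf map_pmf_comp)
  also have "\<dots> = bind_pmf (map_pmf f (K s)) (\<lambda>x. map_pmf ((#) x) (path_pmf K' k x))"
    by (simp add: Suc bind_map_pmf)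
  finally show ?case by (simp add: assms)
qed simp

lemma path_weight_conv_prod:
  "path_weight K (\<sigma> 0) (map \<sigma> [1..<Suc k]) = (\<Prod>j<k. pmf (K (\<sigma> j)) (\<sigma> (Suc j)))"
proof (induction k arbitrary: \<sigma>)
  case (Suc k)
  have "map \<sigma> [1..<Suc (Suc k)] = \<sigma> 1 # map (\<lambda>i. \<sigma> (Suc i)) [1..<Suc k]"
    by (simp add: map_Suc_upt[symmetric] upt_conv_Cons del: upt_Suc)
  then show ?case using Suc[of "\<lambda>i. \<sigma> (Suc i)"]
    by (simp add: prod.lessThan_Suc_shift del: prod.lessThan_Suc upt_Suc)
qed simp

definition has_kernel :: "'w measure \<Rightarrow> ('s \<Rightarrow> 's pmf) \<Rightarrow> 's \<Rightarrow> (nat \<Rightarrow> 'w \<Rightarrow> 's) \<Rightarrow> bool" where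
  "has_kernel M K s S \<longleftrightarrow> (\<forall>i. S i \<in> M \<rightarrow>\<^sub>M count_space UNIV) \<and> (\<forall>\<omega>\<in>space M. S 0 \<omega> = s) \<and>
     (\<forall>k \<sigma>. \<sigma> 0 = s \<longrightarrow> \<P>(\<omega> in M. \<forall>j\<le>k. S j \<omega> = \<sigma> j) = (\<Prod>j<k. pmf (K (\<sigma> j)) (\<sigma> (Suc j))))"

lemma measurable_map_list:
  fixes S :: "nat \<Rightarrow> 'w \<Rightarrow> 's :: countable"
  assumes "\<And>i. S i \<in> M \<rightarrow>\<^sub>M count_space UNIV"
  shows "(\<lambda>\<omega>. map (\<lambda>i. S i \<omega>) is) \<in> M \<rightarrow>\<^sub>M count_space UNIV"
proof (induction "is")
  case (Cons i "is")
  have "(\<lambda>\<omega>. (\<lambda>x l. x # l) (S i \<omega>) (map (\<lambda>i. S i \<omega>) is)) \<in> M \<rightarrow>\<^sub>M count_space UNIV"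
  proof (rule measurable_compose_countable[OF _ assms])
    fix x :: 's
    show "(\<lambda>\<omega>. x # map (\<lambda>i. S i \<omega>) is) \<in> M \<rightarrow>\<^sub>M count_space UNIV"
      by (rule measurable_compose[OF Cons]) simp
  qed
  then show ?case by simp
qed simp

text \<open>Passes from cylinder probabilities to arbitrary events of a finite horizon, and so lets bounds on
  processes be proved as bounds on \<open>path_pmf\<close>.\<close>
lemma (in prob_space) prob_path:
  fixes S :: "nat \<Rightarrow> 'a \<Rightarrow> 's :: countable"
  assumes "has_kernel M K s S"
  shows "\<P>(\<omega> in M. map (\<lambda>i. S i \<omega>) [1..<Suc k] \<in> C) = measure_pmf.prob (path_pmf K k s) C"
proof -
  note [measurable] = assms[unfolded has_kernel_def, THEN conjunct1, rule_format]
  let ?f = "\<lambda>\<omega>. map (\<lambda>i. S i \<omega>) [1..<Suc k]"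
  have f[measurable]: "?f \<in> M \<rightarrow>\<^sub>M count_space UNIV" by (rule measurable_map_list[OF assms[unfolded has_kernel_def, THEN conjunct1, rule_format]])
  have md: "measure (distr M (count_space UNIV) ?f) A = measure M (?f -` A \<inter> space M)" for A
    by (rule measure_distr[OF f]) simp
  interpret D: prob_space "distr M (count_space UNIV) ?f" by (rule prob_space_distr[OF f])
  have "distr M (count_space UNIV) ?f = measure_pmf (path_pmf K k s)"
  proof (rule measure_eqI_countable[where A=UNIV])
    fix l :: "'s list"
    have "measure (distr M (count_space UNIV) ?f) {l} = pmf (path_pmf K k s) l"
    proof (cases "length l = k")
      case False
      then have "pmf (path_pmf K k s) l = 0" using set_path_pmf by (metis pmf_eq_0_set_pmf)
      moreover have "?f -` {l} \<inter> space M = {}" using False by auto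
      ultimately show ?thesis unfolding md by (simp del: upt_Suc)
    next
      case True
      obtain \<sigma> where \<sigma>0: "\<sigma> 0 = s" and l: "l = map \<sigma> [1..<Suc k]"
      proof (rule that[of "\<lambda>j. if j = 0 then s else l ! (j - 1)"])
        show "l = map (\<lambda>j. if j = 0 then s else l ! (j - 1)) [1..<Suc k]"
          using True by (intro nth_equalityI) (simp_all del: upt_Suc)
      qed simp
      have "map (\<lambda>i. S i \<omega>) [1..<Suc k] = l \<longleftrightarrow> (\<forall>j\<le>k. S j \<omega> = \<sigma> j)" if "\<omega> \<in> space M" for \<omega>
      proof -
        have "(\<forall>j\<le>k. S j \<omega> = \<sigma> j) \<longleftrightarrow> (\<forall>j\<in>{1..<Suc k}. S j \<omega> = \<sigma> j)"
        proof -
          have "S 0 \<omega> = \<sigma> 0" using assms that by (simp add: has_kernel_def \<sigma>0)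
          then have "S j \<omega> = \<sigma> j" if "\<forall>j\<in>{1..<Suc k}. S j \<omega> = \<sigma> j" "j \<le> k" for j
            using that by (cases "j = 0") auto
          then show ?thesis by auto
        qed
        then show ?thesis unfolding l by (simp del: upt_Suc)
      qed
      then have "?f -` {l} \<inter> space M = {\<omega>\<in>space M. \<forall>j\<le>k. S j \<omega> = \<sigma> j}" by (auto simp del: upt_Suc)
      then have "measure (distr M (count_space UNIV) ?f) {l} = (\<Prod>j<k. pmf (K (\<sigma> j)) (\<sigma> (Suc j)))"
        using assms unfolding md by (simp add: has_kernel_def \<sigma>0 del: upt_Suc)
      also have "\<dots> = path_weight K s l"
        unfolding l path_weight_conv_prod[symmetric] by (simp add: \<sigma>0)
      finally show ?thesis using True by (simp add: pmf_path_pmf)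
    qed
    then show "emeasure (distr M (count_space UNIV) ?f) {l} = emeasure (measure_pmf (path_pmf K k s)) {l}"
      by (simp only: D.emeasure_eq_measure emeasure_pmf_single)
  qed auto
  then have "measure (distr M (count_space UNIV) ?f) C = measure_pmf.prob (path_pmf K k s) C" by simp
  moreover have "?f -` C \<inter> space M = {\<omega> \<in> space M. ?f \<omega> \<in> C}" by (auto simp del: upt_Suc)
  ultimately show ?thesis unfolding md by (simp del: upt_Suc)
qed

lemma (in prob_space) has_kernel_map:
  fixes S :: "nat \<Rightarrow> 'a \<Rightarrow> 's :: countable"
    and f :: "'s \<Rightarrow> 't"
  assumes S: "has_kernel M K s S" and f: "\<And>s. map_pmf f (K s) = K' (f s)"
  shows "has_kernel M K' (f s) (\<lambda>i \<omega>. f (S i \<omega>))"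
  unfolding has_kernel_def
proof (intro conjI allI impI ballI)
  show "(\<lambda>\<omega>. f (S i \<omega>)) \<in> M \<rightarrow>\<^sub>M count_space UNIV" for i
    by (rule measurable_compose[of "S i" M "count_space UNIV" f]) (use S in \<open>simp_all add: has_kernel_def\<close>)
  show "f (S 0 \<omega>) = f s" if "\<omega> \<in> space M" for \<omega> using S that by (simp add: has_kernel_def)
  fix k and \<sigma> :: "nat \<Rightarrow> 't" assume \<sigma>: "\<sigma> 0 = f s"
  let ?l = "map \<sigma> [1..<Suc k]"
  have "(\<forall>j\<le>k. f (S j \<omega>) = \<sigma> j) \<longleftrightarrow> map (\<lambda>i. S i \<omega>) [1..<Suc k] \<in> {l. map f l = ?l}" if "\<omega> \<in> space M" for \<omega>
  proof -
    have "f (S 0 \<omega>) = \<sigma> 0" using S that \<sigma> by (simp add: has_kernel_def)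
    then have "f (S j \<omega>) = \<sigma> j" if "\<forall>j\<in>{1..<Suc k}. f (S j \<omega>) = \<sigma> j" "j \<le> k" for j
      using that by (cases "j = 0") auto
    then show ?thesis by (auto simp: comp_def simp del: upt_Suc)
  qed
  then have "\<P>(\<omega> in M. \<forall>j\<le>k. f (S j \<omega>) = \<sigma> j) = \<P>(\<omega> in M. map (\<lambda>i. S i \<omega>) [1..<Suc k] \<in> {l. map f l = ?l})"
    by (intro arg_cong[where f=prob]) (auto simp del: upt_Suc)
  also have "\<dots> = measure_pmf.prob (path_pmf K k s) (map f -` {?l})"
    unfolding prob_path[OF S] by (simp add: vimage_def)
  also have "\<dots> = pmf (path_pmf K' k (f s)) ?l"
    unfolding map_path_pmf[of f K K', OF f, symmetric] by (rule pmf_map[symmetric])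
  also have "\<dots> = (\<Prod>j<k. pmf (K' (\<sigma> j)) (\<sigma> (Suc j)))"
    using path_weight_conv_prod[of K' \<sigma> k] \<sigma> by (subst pmf_path_pmf) (simp_all del: upt_Suc)
  finally show "\<P>(\<omega> in M. \<forall>j\<le>k. f (S j \<omega>) = \<sigma> j) = (\<Prod>j<k. pmf (K' (\<sigma> j)) (\<sigma> (Suc j)))" .
qed

lemma markov_chainI:
  assumes M: "prob_space M" and X: "\<And>i. X i \<in> M \<rightarrow>\<^sub>M count_space S"
    and X0: "\<And>\<omega>. \<omega> \<in> space M \<Longrightarrow> X 0 \<omega> = x0"
    and law: "\<And>i x. x 0 = x0 \<Longrightarrow> (\<And>j. j \<le> i \<Longrightarrow> x j \<in> S) \<Longrightarrow>
      \<P>(\<omega> in M. \<forall>j\<le>i. X j \<omega> = x j) = (\<Prod>j<i. P (x j) (x (Suc j)))"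
  shows "markov_chain M S P x0 X"
  unfolding markov_chain_def
proof (intro conjI allI ballI impI)
  interpret prob_space M by fact
  show "AE \<omega> in M. X 0 \<omega> = x0" using X0 by auto
  fix i x y assume y: "y \<in> S" and pos: "\<P>(\<omega> in M. \<forall>j\<le>i. X j \<omega> = x j) > 0"
  then have "{\<omega> \<in> space M. \<forall>j\<le>i. X j \<omega> = x j} \<noteq> {}" by (metis less_irrefl measure_empty)
  then obtain \<omega> where \<omega>: "\<omega> \<in> space M" "\<And>j. j \<le> i \<Longrightarrow> X j \<omega> = x j" by blast
  have x0: "x 0 = x0" using X0[OF \<omega>(1)] \<omega>(2)[of 0] by simp
  have xS: "x j \<in> S" if "j \<le> i" for j
    using measurable_space[OF X[of j] \<omega>(1)] \<omega>(2)[OF that] by simp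
  let ?x = "x(Suc i := y)"
  have "\<P>(\<omega> in M. X (Suc i) \<omega> = y \<and> (\<forall>j\<le>i. X j \<omega> = x j)) = \<P>(\<omega> in M. \<forall>j\<le>Suc i. X j \<omega> = ?x j)"
    by (intro arg_cong[where f=prob]) (auto simp: le_Suc_eq)
  also have "\<dots> = (\<Prod>j<Suc i. P (?x j) (?x (Suc j)))"
    using x0 xS y by (intro law) (auto simp: le_Suc_eq)
  also have "\<dots> = (\<Prod>j<i. P (x j) (x (Suc j))) * P (x i) y" by simp
  finally show "\<P>(\<omega> in M. X (Suc i) \<omega> = y \<bar> \<forall>j\<le>i. X j \<omega> = x j) = P (x i) y"
    using pos law[where x=x and i=i, OF x0 xS] unfolding cond_prob_def
    by (metis less_irrefl nonzero_mult_div_cancel_left)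
qed (use M X in auto)

section \<open>Sampling from independent uniform variables\<close>

definition unit_measure :: "real measure" where
  "unit_measure = restrict_space lborel {0<..<1}"

lemma space_unit_measure [simp]: "space unit_measure = {0<..<1}"
  by (simp add: unit_measure_def space_restrict_space)

lemma sets_unit_measure: "A \<in> sets unit_measure \<longleftrightarrow> A \<subseteq> {0<..<1} \<and> A \<in> sets borel"
  by (simp add: unit_measure_def sets_restrict_space_iff)

lemma prob_space_unit_measure: "prob_space unit_measure"
  by (rule prob_spaceI) (simp add: unit_measure_def space_restrict_space emeasure_restrict_space)

lemma measurable_unit_measure: "f \<in> borel \<rightarrow>\<^sub>M N \<Longrightarrow> f \<in> unit_measure \<rightarrow>\<^sub>M N"
  unfolding unit_measure_def by (simp add: measurable_restrict_space1)

lemma unit_measure_interval: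
  assumes ab: "0 \<le> a" "a \<le> b" "b \<le> 1" and S: "S \<in> sets unit_measure"
    and sub: "{a<..<b} \<subseteq> S" "S \<subseteq> {a..b}"
  shows "measure unit_measure S = b - a"
proof -
  have Sb: "S \<in> sets borel" "S \<subseteq> {0<..<1}" using S by (auto simp: sets_unit_measure)
  have "emeasure lborel {a<..<b} \<le> emeasure lborel S" "emeasure lborel S \<le> emeasure lborel {a..b}"
    using sub Sb by (auto intro!: emeasure_mono)
  then have "emeasure lborel S = ennreal (b - a)" using ab by (simp add: antisym)
  then have "emeasure unit_measure S = ennreal (b - a)"
    using Sb unfolding unit_measure_def by (subst emeasure_restrict_space) auto
  then show ?thesis using ab by (simp add: measure_def)
qed

definition nat_cdf :: "'a :: countable pmf \<Rightarrow> nat \<Rightarrow> real" where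
  "nat_cdf p j = measure_pmf.prob p {x. to_nat x < j}"

text \<open>Inverse distribution function along an enumeration of the countable type.\<close>
definition sample :: "'a :: countable pmf \<Rightarrow> real \<Rightarrow> 'a" where
  "sample p u = from_nat (LEAST j. u < nat_cdf p (Suc j))"

lemma nat_cdf_Suc: "nat_cdf p (Suc j) = nat_cdf p j + measure_pmf.prob p {x. to_nat x = j}"
proof -
  have *: "{x. to_nat x < Suc j} = {x. to_nat x < j} \<union> {x. to_nat x = j}" by auto
  show ?thesis unfolding nat_cdf_def * by (rule measure_pmf.finite_measure_Union) auto
qed

lemma nat_cdf_mono: "i \<le> j \<Longrightarrow> nat_cdf p i \<le> nat_cdf p j"
  unfolding nat_cdf_def by (rule measure_pmf.finite_measure_mono) auto

lemma nat_cdf_limit: "nat_cdf p \<longlonglongrightarrow> 1"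
proof -
  have "(\<Union>j. {x. to_nat x < j}) = (UNIV :: 'a set)" by (auto intro: exI[of _ "Suc (to_nat _)"])
  then show ?thesis
    using measure_pmf.finite_Lim_measure_incseq[of "\<lambda>j. {x. to_nat x < j}" p]
    unfolding nat_cdf_def by (force simp: incseq_def)
qed

lemma sample_eq_iff:
  fixes p :: "'a :: countable pmf"
  assumes "u \<in> {0<..<1}"
  shows "sample p u = w \<longleftrightarrow> nat_cdf p (to_nat w) \<le> u \<and> u < nat_cdf p (to_nat w) + pmf p w"
proof -
  have w: "nat_cdf p (Suc (to_nat w)) = nat_cdf p (to_nat w) + pmf p w" for w
    unfolding nat_cdf_Suc by (simp add: measure_pmf_single[symmetric])
  have "eventually (\<lambda>j. u < nat_cdf p j) sequentially"
    using nat_cdf_limit assms by (intro order_tendstoD(1)) auto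
  then obtain j where "u < nat_cdf p j" by (auto simp: eventually_sequentially)
  then have ex: "\<exists>j. u < nat_cdf p (Suc j)" using nat_cdf_mono[of j "Suc j" p] by (meson le_SucI order_refl less_le_trans)
  define j where "j = (LEAST j. u < nat_cdf p (Suc j))"
  have j: "u < nat_cdf p (Suc j)" unfolding j_def using ex by (rule LeastI_ex)
  have jl: "nat_cdf p j \<le> u"
  proof (cases j)
    case 0 then show ?thesis using assms by (simp add: nat_cdf_def)
  next
    case (Suc i)
    then have "\<not> u < nat_cdf p (Suc i)" unfolding j_def by (metis lessI not_less_Least)
    then show ?thesis using Suc by simp
  qed
  have "measure_pmf.prob p {x. to_nat x = j} \<noteq> 0" using j jl nat_cdf_Suc[of p j] by linarith
  then have "{x :: 'a. to_nat x = j} \<noteq> {}" by (metis measure_empty)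
  then obtain x :: 'a where x: "to_nat x = j" by blast
  have s: "sample p u = x" unfolding sample_def j_def[symmetric] x[symmetric] by simp
  show ?thesis
  proof
    assume "sample p u = w"
    then show "nat_cdf p (to_nat w) \<le> u \<and> u < nat_cdf p (to_nat w) + pmf p w"
      using s x j jl w by auto
  next
    assume *: "nat_cdf p (to_nat w) \<le> u \<and> u < nat_cdf p (to_nat w) + pmf p w"
    have "to_nat w = j"
    proof (rule ccontr)
      assume "to_nat w \<noteq> j"
      then consider "Suc (to_nat w) \<le> j" | "Suc j \<le> to_nat w" by linarith
      then show False using * j jl w[of w] nat_cdf_mono[of "Suc (to_nat w)" j p] nat_cdf_mono[of "Suc j" "to_nat w" p]
        by cases auto
    qed
    then show "sample p u = w" using s x by (metis from_nat_to_nat)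
  qed
qed

lemma sample_in_set_pmf: "u \<in> {0<..<1} \<Longrightarrow> sample p u \<in> set_pmf p"
  using sample_eq_iff[of u p "sample p u"] by (auto simp: set_pmf_iff)

lemma measurable_sample [measurable]: "sample p \<in> unit_measure \<rightarrow>\<^sub>M count_space UNIV"
proof -
  have "sample p -` {w} \<inter> space unit_measure \<in> sets unit_measure" for w
  proof -
    have "sample p -` {w} \<inter> space unit_measure = {nat_cdf p (to_nat w) ..< nat_cdf p (to_nat w) + pmf p w} \<inter> {0<..<1}"
    proof (rule set_eqI)
      fix x show "x \<in> sample p -` {w} \<inter> space unit_measure \<longleftrightarrow>
          x \<in> {nat_cdf p (to_nat w) ..< nat_cdf p (to_nat w) + pmf p w} \<inter> {0<..<1}"
        using sample_eq_iff[of x p w] by auto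
    qed
    then show ?thesis by (simp add: sets_unit_measure)
  qed
  then show ?thesis by (simp add: measurable_count_space_eq2_countable)
qed

lemma measure_sample: "measure unit_measure {u \<in> {0<..<1}. sample p u = w} = pmf p w"
proof -
  have c1: "nat_cdf p (to_nat w) + pmf p w \<le> 1"
    using nat_cdf_Suc[of p "to_nat w"] measure_pmf.prob_le_1[of p "{x. to_nat x < Suc (to_nat w)}"]
    unfolding nat_cdf_def by (simp add: measure_pmf_single)
  have c0: "nat_cdf p (to_nat w) \<ge> 0" by (simp add: nat_cdf_def)
  have eq: "{u \<in> {0<..<1}. sample p u = w} = {nat_cdf p (to_nat w) ..< nat_cdf p (to_nat w) + pmf p w} \<inter> {0<..<1}"
  proof (rule set_eqI)
    fix x show "x \<in> {u \<in> {0<..<1}. sample p u = w} \<longleftrightarrow>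
        x \<in> {nat_cdf p (to_nat w) ..< nat_cdf p (to_nat w) + pmf p w} \<inter> {0<..<1}"
      using sample_eq_iff[of x p w] by auto
  qed
  have "measure unit_measure {u \<in> {0<..<1}. sample p u = w} = nat_cdf p (to_nat w) + pmf p w - nat_cdf p (to_nat w)"
    unfolding eq by (rule unit_measure_interval) (use c0 c1 in \<open>auto simp: sets_unit_measure\<close>)
  then show ?thesis by simp
qed

definition noise :: "(nat \<Rightarrow> real) measure" where
  "noise = PiM UNIV (\<lambda>_. unit_measure)"

interpretation unit: prob_space unit_measure by (rule prob_space_unit_measure)
interpretation nprod: product_prob_space "\<lambda>_. unit_measure" "UNIV :: nat set" by unfold_locales
interpretation noise: prob_space noise unfolding noise_def by unfold_locales

lemma space_noise: "\<omega> \<in> space noise \<longleftrightarrow> (\<forall>i. \<omega> i \<in> {0<..<1})"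
  by (auto simp: noise_def space_PiM)

lemma measurable_noise_component [measurable]: "(\<lambda>\<omega>. \<omega> i) \<in> noise \<rightarrow>\<^sub>M unit_measure"
  unfolding noise_def by (rule measurable_component_singleton) simp

lemma measurable_noise_component_borel [measurable]: "(\<lambda>\<omega>. \<omega> i) \<in> borel_measurable noise"
  by (rule measurable_compose[OF measurable_noise_component]) (simp add: measurable_unit_measure)

lemma indep_vars_noise: "noise.indep_vars (\<lambda>_. unit_measure) (\<lambda>i \<omega>. \<omega> i) UNIV"
proof -
  have "distr noise unit_measure (\<lambda>\<omega>. \<omega> i) = unit_measure" for i
    unfolding noise_def using nprod.PiM_component[of i] by simp
  moreover have "distr noise (\<Pi>\<^sub>M i\<in>UNIV. unit_measure) (\<lambda>\<omega>. \<lambda>i\<in>UNIV. \<omega> i) = noise"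
    unfolding noise_def by (simp add: distr_id restrict_def)
  ultimately show ?thesis
    by (subst noise.indep_vars_iff_distr_eq_PiM') (auto simp: noise_def)
qed

text \<open>Measurability with respect to a family of coordinates, in a pointwise form that is easy to check
  for intersections; events that depend on disjoint sets of coordinates are independent.\<close>
definition depends_on :: "nat set \<Rightarrow> (nat \<Rightarrow> real) set \<Rightarrow> bool" where
  "depends_on A E \<longleftrightarrow> E \<in> sets noise \<and>
     (\<forall>\<omega>\<in>space noise. \<forall>\<omega>'\<in>space noise. (\<forall>i\<in>A. \<omega> i = \<omega>' i) \<longrightarrow> (\<omega> \<in> E \<longleftrightarrow> \<omega>' \<in> E))"

lemma depends_on_restrict:
  assumes "depends_on A E"
  obtains E' where "E' \<in> sets (PiM A (\<lambda>_. unit_measure))"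
    "E = (\<lambda>\<omega>. restrict \<omega> A) -` E' \<inter> space noise"
proof
  let ?ext = "\<lambda>x i. if i \<in> A then x i else (1/2 :: real)"
  have ext: "?ext \<in> PiM A (\<lambda>_. unit_measure) \<rightarrow>\<^sub>M noise"
    unfolding noise_def
  proof (rule measurable_PiM_single')
    fix i :: nat
    show "(\<lambda>x. if i \<in> A then x i else 1/2) \<in> PiM A (\<lambda>_. unit_measure) \<rightarrow>\<^sub>M unit_measure"
      by (cases "i \<in> A") simp_all
  qed (auto simp: space_PiM)
  show "?ext -` E \<inter> space (PiM A (\<lambda>_. unit_measure)) \<in> sets (PiM A (\<lambda>_. unit_measure))"
    using assms by (intro measurable_sets[OF ext]) (simp add: depends_on_def)
  have "\<omega> \<in> E \<longleftrightarrow> ?ext (restrict \<omega> A) \<in> E" if "\<omega> \<in> space noise" for \<omega>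
  proof -
    have "?ext (restrict \<omega> A) \<in> space noise" using that by (auto simp: space_noise)
    then show ?thesis using assms that unfolding depends_on_def by (smt (verit, best) restrict_apply')
  qed
  moreover have "E \<subseteq> space noise" using assms sets.sets_into_space by (auto simp: depends_on_def)
  moreover have "restrict \<omega> A \<in> space (PiM A (\<lambda>_. unit_measure))" if "\<omega> \<in> space noise" for \<omega>
    using that by (auto simp: space_noise space_PiM)
  ultimately show "E = (\<lambda>\<omega>. restrict \<omega> A) -` (?ext -` E \<inter> space (PiM A (\<lambda>_. unit_measure))) \<inter> space noise"
    by auto
qed

lemma prob_depends_on_Int:
  assumes "depends_on A E" "depends_on B F" "A \<inter> B = {}"
  shows "noise.prob (E \<inter> F) = noise.prob E * noise.prob F"
proof -
  obtain E' where E': "E' \<in> sets (PiM A (\<lambda>_. unit_measure))" "E = (\<lambda>\<omega>. restrict \<omega> A) -` E' \<inter> space noise"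
    using depends_on_restrict[OF assms(1)] .
  obtain F' where F': "F' \<in> sets (PiM B (\<lambda>_. unit_measure))" "F = (\<lambda>\<omega>. restrict \<omega> B) -` F' \<inter> space noise"
    using depends_on_restrict[OF assms(2)] .
  have "noise.indep_var (PiM A (\<lambda>_. unit_measure)) (\<lambda>\<omega>. restrict (\<lambda>i. \<omega> i) A) (PiM B (\<lambda>_. unit_measure)) (\<lambda>\<omega>. restrict (\<lambda>i. \<omega> i) B)"
    using noise.indep_var_restrict[OF indep_vars_noise assms(3)] by simp
  from noise.indep_varD[OF this E'(1) F'(1)] show ?thesis
    unfolding E'(2) F'(2) by (simp add: vimage_def Int_def conj_ac)
qed

lemma prob_noise_box:
  assumes "finite I" "\<And>i. i \<in> I \<Longrightarrow> B i \<in> sets unit_measure"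
  shows "\<P>(\<omega> in noise. \<forall>i\<in>I. \<omega> i \<in> B i) = (\<Prod>i\<in>I. measure unit_measure (B i))"
proof -
  have "{\<omega> \<in> space noise. \<forall>i\<in>I. \<omega> i \<in> B i} = prod_emb UNIV (\<lambda>_. unit_measure) I (Pi\<^sub>E I B)"
    unfolding prod_emb_def noise_def by (auto simp: space_PiM Pi_iff)
  then show ?thesis unfolding noise_def using nprod.measure_PiM_emb[of I B] assms by simp
qed

lemma depends_on_single:
  assumes "B \<in> sets unit_measure"
  shows "depends_on {i} {\<omega> \<in> space noise. \<omega> i \<in> B}"
  unfolding depends_on_def using assms by (auto intro!: measurable_sets_Collect[OF measurable_noise_component])

lemma prob_noise_single: "B \<in> sets unit_measure \<Longrightarrow> \<P>(\<omega> in noise. \<omega> i \<in> B) = measure unit_measure B"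
  using prob_noise_box[of "{i}" "\<lambda>_. B"] by simp

lemma depends_on_Int: "depends_on A E \<Longrightarrow> depends_on B F \<Longrightarrow> A \<union> B \<subseteq> C \<Longrightarrow> depends_on C (E \<inter> F)"
  unfolding depends_on_def by blast

section \<open>Jump times of step functions\<close>

text \<open>Only the first \<open>K\<close> jumps are prescribed, because the discrete path is controlled only up to the time
  at which the coupling breaks.\<close>
lemma jump_time_step:
  fixes f :: "real \<Rightarrow> 's"
  assumes T0: "\<tau> 0 = 0"
    and mono: "\<And>k. k < K \<Longrightarrow> \<tau> k < \<tau> (Suc k)"
    and val: "\<And>k t. k < K \<Longrightarrow> \<tau> k \<le> t \<Longrightarrow> t < \<tau> (Suc k) \<Longrightarrow> f t = J k"
    and last: "f (\<tau> K) = J K"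
    and ne: "\<And>k. k < K \<Longrightarrow> J (Suc k) \<noteq> J k"
    and k: "k \<le> K"
  shows "jump_time f k = ereal (\<tau> k)" "jump_value f k = J k"
proof -
  have at: "f (\<tau> k) = J k" if "k \<le> K" for k
    using that val[of k "\<tau> k"] mono[of k] last by (cases "k = K") auto
  have "jump_time f k = ereal (\<tau> k)" using k
  proof (induction k)
    case (Suc k)
    then have IH: "jump_time f k = ereal (\<tau> k)" and kK: "k < K" by auto
    have "Inf {ereal t | t. ereal (\<tau> k) < ereal t \<and> f t \<noteq> f (\<tau> k)} = ereal (\<tau> (Suc k))"
    proof (rule antisym)
      show "Inf {ereal t | t. ereal (\<tau> k) < ereal t \<and> f t \<noteq> f (\<tau> k)} \<le> ereal (\<tau> (Suc k))"
        using mono[OF kK] ne[OF kK] at[of k] at[of "Suc k"] kK by (intro Inf_lower) auto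
      have "\<tau> (Suc k) \<le> t" if "\<tau> k < t" "f t \<noteq> f (\<tau> k)" for t
        using val[OF kK, of t] that at[of k] kK by (cases "t < \<tau> (Suc k)") auto
      then show "ereal (\<tau> (Suc k)) \<le> Inf {ereal t | t. ereal (\<tau> k) < ereal t \<and> f t \<noteq> f (\<tau> k)}"
        by (intro Inf_greatest) auto
    qed
    then show ?case using IH by simp
  qed (simp add: T0)
  then show "jump_time f k = ereal (\<tau> k)" "jump_value f k = J k"
    using at[OF k] by (auto simp: jump_value_def)
qed

lemma jump_time_inj: "inj h \<Longrightarrow> jump_time (\<lambda>t. h (f t)) i = jump_time f i"
  by (induction i) (simp_all add: inj_eq)

text \<open>A path that moves only on the grid \<open>\<nat> / N\<close> has its jump times on the grid, so the infimum over
  all times becomes a countable one. This is what makes the jump times measurable.\<close>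
lemma jump_time_grid:
  fixes N :: real and v :: "nat \<Rightarrow> 's"
  assumes N: "N > 0"
  defines "f \<equiv> \<lambda>t. v (nat \<lfloor>N * t\<rfloor>)"
  shows "jump_time f (Suc i) =
      (INF j. if jump_time f i < ereal (real j / N) \<and> v j \<noteq> f (real_of_ereal (jump_time f i))
              then ereal (real j / N) else \<infinity>)" (is "?A i")
    and "jump_time f i = \<infinity> \<or> (\<exists>j. jump_time f i = ereal (real j / N))" (is "?B i")
proof -
  have fj: "f (real j / N) = v j" for j using N by (simp add: f_def)
  have BA: "?A i" if "?B i" for i
  proof (cases "jump_time f i = \<infinity>")
    case False
    with that obtain j0 where j0: "jump_time f i = ereal (real j0 / N)" by blast
    let ?S = "{ereal t | t. ereal (real j0 / N) < ereal t \<and> f t \<noteq> v j0}"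
    let ?g = "\<lambda>j. if real j0 / N < real j / N \<and> v j \<noteq> v j0 then ereal (real j / N) else \<infinity>"
    have "Inf ?S = (INF j. ?g j)"
    proof (rule antisym)
      show "Inf ?S \<le> (INF j. ?g j)"
      proof (rule INF_greatest)
        fix j show "Inf ?S \<le> ?g j"
          using fj[of j] by (auto intro!: Inf_lower)
      qed
      show "(INF j. ?g j) \<le> Inf ?S"
      proof (rule Inf_greatest, clarify)
        fix t assume t: "ereal (real j0 / N) < ereal t" "f t \<noteq> v j0"
        define j where "j = nat \<lfloor>N * t\<rfloor>"
        have "real j0 < N * t" using t N by (simp add: field_simps)
        moreover have "v j \<noteq> v j0" using t by (simp add: f_def j_def)
        ultimately have "j0 \<le> j" "real j \<le> N * t" "j \<noteq> j0" unfolding j_def by (auto simp: le_nat_iff le_floor_iff)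
        then have "?g j = ereal (real j / N)" "real j / N \<le> t" 
          using \<open>v j \<noteq> v j0\<close> N by (auto simp: field_simps)
        then show "(INF j. ?g j) \<le> ereal t" by (intro INF_lower2[of j]) auto
      qed
    qed
    then show ?thesis by (simp add: j0 fj)
  qed (simp add: top_ereal_def)
  have B: "?B i" for i
  proof (induction i)
    case 0
    show ?case by (auto intro!: exI[of _ 0] simp: zero_ereal_def)
  next
    case (Suc i)
    let ?P = "\<lambda>j. jump_time f i < ereal (real j / N) \<and> v j \<noteq> f (real_of_ereal (jump_time f i))"
    show ?case
    proof (cases "\<exists>j. ?P j")
      case False
      then have "(INF j. if ?P j then ereal (real j / N) else \<infinity>) = (INF j::nat. \<infinity>)"
        by (intro INF_cong) auto
      then show ?thesis unfolding BA[OF Suc] by simp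
    next
      case True
      define j1 where "j1 = (LEAST j. ?P j)"
      have j1: "?P j1" unfolding j1_def using True by (rule LeastI_ex)
      have "(INF j. if ?P j then ereal (real j / N) else \<infinity>) = ereal (real j1 / N)"
      proof (rule antisym)
        show "(INF j. if ?P j then ereal (real j / N) else \<infinity>) \<le> ereal (real j1 / N)"
          using j1 by (intro INF_lower2[of j1]) auto
        have "j1 \<le> j" if "?P j" for j unfolding j1_def using that by (rule Least_le)
        then show "ereal (real j1 / N) \<le> (INF j. if ?P j then ereal (real j / N) else \<infinity>)"
          using N by (intro INF_greatest) (auto simp: divide_right_mono)
      qed
      then show ?thesis unfolding BA[OF Suc] by blast
    qed
  qed
  show "?A i" "?B i" using BA B by blast+
qed

lemma measurable_jump_grid:
  fixes N :: real and v :: "nat \<Rightarrow> 'w \<Rightarrow> 's :: countable"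
  assumes N: "N > 0" and v[measurable]: "\<And>j. v j \<in> M \<rightarrow>\<^sub>M count_space UNIV"
  shows "(\<lambda>\<omega>. jump_time (\<lambda>t. v (nat \<lfloor>N * t\<rfloor>) \<omega>) i) \<in> borel_measurable M" (is "?A i")
    and "(\<lambda>\<omega>. jump_value (\<lambda>t. v (nat \<lfloor>N * t\<rfloor>) \<omega>) i) \<in> M \<rightarrow>\<^sub>M count_space UNIV" (is "?B i")
proof -
  have AB: "?B i" if [measurable]: "?A i" for i
    unfolding jump_value_def
  proof (rule measurable_compose_countable[OF v])
    show "(\<lambda>x. nat \<lfloor>N * real_of_ereal (jump_time (\<lambda>t. v (nat \<lfloor>N * t\<rfloor>) x) i)\<rfloor>) \<in> M \<rightarrow>\<^sub>M count_space UNIV"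
      by measurable
  qed
  have A: "?A i" for i
  proof (induction i)
    case (Suc i)
    note [measurable] = Suc
    have "(\<lambda>\<omega>. jump_time (\<lambda>t. v (nat \<lfloor>N * t\<rfloor>) \<omega>) (Suc i)) =
      (\<lambda>\<omega>. INF j. if jump_time (\<lambda>t. v (nat \<lfloor>N * t\<rfloor>) \<omega>) i < ereal (real j / N) \<and>
         v j \<omega> \<noteq> v (nat \<lfloor>N * real_of_ereal (jump_time (\<lambda>t. v (nat \<lfloor>N * t\<rfloor>) \<omega>) i)\<rfloor>) \<omega>
         then ereal (real j / N) else \<infinity>)"
      by (rule ext, rule jump_time_grid(1)[OF N])
    also have "\<dots> \<in> borel_measurable M" by measurable
    finally show ?case .
  qed simp
  show "?A i" "?B i" using A AB by blast+
qed

text \<open>The three conclusions of the theorem about \<open>m\<close> jumps, error \<open>c\<close> and elapsed time \<open>t\<close>.\<close>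
definition paths_close :: "nat \<Rightarrow> real \<Rightarrow> real \<Rightarrow> (real \<Rightarrow> real) \<Rightarrow> (real \<Rightarrow> real) \<Rightarrow> bool" where
  "paths_close m c t f g \<longleftrightarrow> (\<forall>i\<le>m. jump_value f i = jump_value g i) \<and>
     (\<forall>i\<le>m. \<bar>jump_time f i - jump_time g i\<bar> \<le> ereal c) \<and> ereal t \<le> jump_time g m"

section \<open>Construction of the coupled processes\<close>

text \<open>Sites of the walks are recorded by integers \<open>e\<close>, on the same scale as the states of \<open>X\<close>; the
  half-integer position is \<open>e - n/2\<close>.\<close>
definition walk_pos :: "nat \<Rightarrow> int \<Rightarrow> real" where
  "walk_pos n e = real_of_int e - real n / 2"

text \<open>The construction works for arbitrary rates and laws: \<open>rate\<close> and \<open>up\<close> give the holding rate and the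
  probability of an upward jump of the continuous-time walk, \<open>leave\<close> the probability with which the
  tick walk leaves a site, and \<open>P\<close> the one-step law of the discrete chain. Coordinate \<open>3 k\<close> of
  the noise drives the holding time of stage \<open>k\<close>, coordinate \<open>3 k + 1\<close> the direction of the jump
  that ends it, and coordinate \<open>3 i + 2\<close> the discrete chain in tick \<open>i\<close>.\<close>
locale tick_coupling =
  fixes rate up leave :: "int \<Rightarrow> real" and P :: "nat \<Rightarrow> nat pmf" and d0 n :: nat
  assumes rate_pos: "rate e > 0"
    and up: "0 < up e" "up e < 1"
    and leave: "0 < leave e" "leave e < 1"
    and set_P: "set_pmf (P d) \<subseteq> {..n}"
    and d0: "d0 \<le> n"
begin

definition dir :: "int \<Rightarrow> real \<Rightarrow> int" where
  "dir e u = (if u < up e then e + 1 else e - 1)"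

definition dir_prob :: "int \<Rightarrow> int \<Rightarrow> real" where
  "dir_prob e e' = (if e' = e + 1 then up e else if e' = e - 1 then 1 - up e else 0)"

text \<open>If \<open>u\<close> is uniform then \<open>- ln u / rate e\<close> is exponential, and the number of intervals of length
  \<open>- ln (1 - leave e) / rate e\<close> that it meets is geometric with parameter \<open>leave e\<close>. The rate cancels.\<close>
definition hold_ticks :: "int \<Rightarrow> real \<Rightarrow> nat" where
  "hold_ticks e u = Suc (nat \<lfloor>ln u / ln (1 - leave e)\<rfloor>)"

primrec J :: "nat \<Rightarrow> (nat \<Rightarrow> real) \<Rightarrow> int" where
  "J 0 \<omega> = int d0"
| "J (Suc k) \<omega> = dir (J k \<omega>) (\<omega> (3 * k + 1))"

definition H :: "nat \<Rightarrow> (nat \<Rightarrow> real) \<Rightarrow> real" where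
  "H k \<omega> = - ln (\<omega> (3 * k)) / rate (J k \<omega>)"

definition G :: "nat \<Rightarrow> (nat \<Rightarrow> real) \<Rightarrow> nat" where
  "G k \<omega> = hold_ticks (J k \<omega>) (\<omega> (3 * k))"

definition T :: "nat \<Rightarrow> (nat \<Rightarrow> real) \<Rightarrow> real" where
  "T k \<omega> = (\<Sum>j<k. H j \<omega>)"

definition tick :: "nat \<Rightarrow> (nat \<Rightarrow> real) \<Rightarrow> nat" where
  "tick k \<omega> = (\<Sum>j<k. G j \<omega>)"

text \<open>The stage to which tick \<open>i\<close> belongs; stage \<open>k\<close> covers the ticks from \<open>tick k\<close> up to, and not
  including, \<open>tick (Suc k)\<close>.\<close>
definition stage :: "nat \<Rightarrow> (nat \<Rightarrow> real) \<Rightarrow> nat" where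
  "stage i \<omega> = (LEAST k. i < tick (Suc k) \<omega>)"

definition A :: "nat \<Rightarrow> (nat \<Rightarrow> real) \<Rightarrow> int" where
  "A i \<omega> = J (stage i \<omega>) \<omega>"

definition tick_law :: "int \<Rightarrow> int pmf" where
  "tick_law e = bind_pmf (bernoulli_pmf (leave e)) (\<lambda>l. if l
     then map_pmf (\<lambda>b. if b then e + 1 else e - 1) (bernoulli_pmf (up e)) else return_pmf e)"

definition W :: "nat \<Rightarrow> (nat \<times> nat) pmf" where
  "W d = bind_pmf (P d) (\<lambda>m. map_pmf (Pair m) (P m))"

text \<open>A maximal coupling of two steps of the chain from \<open>d\<close> with one tick of the walk from \<open>e\<close>. It is
  used for all \<open>d\<close> and \<open>e\<close>, also after the two have separated.\<close>
definition joint_law :: "nat \<Rightarrow> int \<Rightarrow> ((nat \<times> nat) \<times> int) pmf" where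
  "joint_law d e = (SOME c. map_pmf fst c = W d \<and> map_pmf snd c = tick_law e \<and>
     measure_pmf.prob c {z. int (snd (fst z)) \<noteq> snd z}
       \<le> (\<Sum>y\<in>set_pmf (tick_law e). max 0 (pmf (tick_law e) y - pmf (map_pmf (\<lambda>w. int (snd w)) (W d)) y)))"

definition cond_law :: "nat \<Rightarrow> int \<Rightarrow> int \<Rightarrow> (nat \<times> nat) pmf" where
  "cond_law d e = (SOME \<kappa>. \<forall>y. set_pmf (\<kappa> y) \<subseteq> set_pmf (map_pmf fst (joint_law d e)) \<and>
    (\<forall>w. pmf (map_pmf snd (joint_law d e)) y * pmf (\<kappa> y) w = pmf (joint_law d e) (w, y)))"

text \<open>The states of \<open>X\<close> at the times \<open>2 i - 1\<close> and \<open>2 i\<close>. Nothing precedes time \<open>0\<close>, so the first component of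
  \<open>D 0\<close> is a dummy.\<close>
primrec D :: "nat \<Rightarrow> (nat \<Rightarrow> real) \<Rightarrow> nat \<times> nat" where
  "D 0 \<omega> = (0, d0)"
| "D (Suc i) \<omega> = sample (cond_law (snd (D i \<omega>)) (A i \<omega>) (A (Suc i) \<omega>)) (\<omega> (3 * i + 2))"

definition S :: "nat \<Rightarrow> (nat \<Rightarrow> real) \<Rightarrow> (nat \<times> nat) \<times> int" where
  "S i \<omega> = (D i \<omega>, A i \<omega>)"

definition K :: "(nat \<times> nat) \<times> int \<Rightarrow> ((nat \<times> nat) \<times> int) pmf" where
  "K s = joint_law (snd (fst s)) (snd s)"

definition X :: "nat \<Rightarrow> (nat \<Rightarrow> real) \<Rightarrow> nat" where
  "X i \<omega> = (if even i then snd (D (i div 2) \<omega>) else fst (D (Suc (i div 2)) \<omega>))"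

lemma dir_neq: "dir e u \<noteq> e" by (simp add: dir_def)
lemma J_Suc_neq: "J (Suc k) \<omega> \<noteq> J k \<omega>" by (simp add: dir_neq)

lemma H_pos: "\<omega> \<in> space noise \<Longrightarrow> H k \<omega> > 0"
  using rate_pos by (auto simp: H_def space_noise intro!: divide_neg_pos)

lemma G_pos: "G k \<omega> > 0" by (simp add: G_def hold_ticks_def)

lemma tick_0 [simp]: "tick 0 \<omega> = 0" and T_0 [simp]: "T 0 \<omega> = 0" by (simp_all add: tick_def T_def)
lemma tick_Suc: "tick (Suc k) \<omega> = tick k \<omega> + G k \<omega>" by (simp add: tick_def)
lemma T_Suc: "T (Suc k) \<omega> = T k \<omega> + H k \<omega>" by (simp add: T_def)

lemma tick_ge: "k \<le> tick k \<omega>"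
proof (induction k)
  case (Suc k) then show ?case using G_pos[of k \<omega>] by (simp add: tick_Suc)
qed simp

lemma tick_mono: "k \<le> l \<Longrightarrow> tick k \<omega> \<le> tick l \<omega>"
  by (rule lift_Suc_mono_le[of "\<lambda>k. tick k \<omega>"]) (simp_all add: tick_Suc)

lemma stageI: "tick k \<omega> \<le> i \<Longrightarrow> i < tick (Suc k) \<omega> \<Longrightarrow> stage i \<omega> = k"
  unfolding stage_def
proof (rule Least_equality)
  fix l assume "tick k \<omega> \<le> i" "i < tick (Suc l) \<omega>"
  then show "k \<le> l" using tick_mono[of "Suc l" k \<omega>] by (meson Suc_leI leD le_trans not_le_imp_less)
qed

lemma stage_bounds: "tick (stage i \<omega>) \<omega> \<le> i" "i < tick (Suc (stage i \<omega>)) \<omega>"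
proof -
  have ex: "\<exists>k. i < tick (Suc k) \<omega>" using tick_ge[of "Suc i" \<omega>] by (intro exI[of _ i]) simp
  show "i < tick (Suc (stage i \<omega>)) \<omega>" unfolding stage_def using ex by (rule LeastI_ex)
  show "tick (stage i \<omega>) \<omega> \<le> i"
  proof (cases "stage i \<omega>")
    case (Suc l)
    then have "\<not> i < tick (Suc l) \<omega>" unfolding stage_def by (metis lessI not_less_Least)
    then show ?thesis using Suc by simp
  qed simp
qed

lemma stage_tick [simp]: "stage (tick k \<omega>) \<omega> = k"
  by (rule stageI) (simp_all add: tick_Suc G_pos)

lemma stage_0 [simp]: "stage 0 \<omega> = 0" using stage_tick[of 0 \<omega>] by simp

lemma stage_Suc: "stage (Suc i) \<omega> = (if Suc i < tick (Suc (stage i \<omega>)) \<omega> then stage i \<omega> else Suc (stage i \<omega>))"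
proof (cases "Suc i < tick (Suc (stage i \<omega>)) \<omega>")
  case True
  then have "stage (Suc i) \<omega> = stage i \<omega>"
    by (intro stageI) (use stage_bounds[of i \<omega>] in simp_all)
  then show ?thesis using True by simp
next
  case False
  then have "tick (Suc (stage i \<omega>)) \<omega> = Suc i" using stage_bounds[of i \<omega>] by simp
  then have "stage (Suc i) \<omega> = Suc (stage i \<omega>)" using stage_tick[of "Suc (stage i \<omega>)" \<omega>] by simp
  then show ?thesis using False by simp
qed

lemma A_Suc_eq_iff: "A (Suc i) \<omega> = A i \<omega> \<longleftrightarrow> stage (Suc i) \<omega> = stage i \<omega>"
  unfolding A_def stage_Suc by (auto simp: dir_neq)

lemma measurable_dir: "dir e \<in> unit_measure \<rightarrow>\<^sub>M count_space UNIV"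
  unfolding dir_def by (rule measurable_unit_measure) measurable

lemma measurable_hold_ticks: "hold_ticks e \<in> unit_measure \<rightarrow>\<^sub>M count_space UNIV"
  unfolding hold_ticks_def by (rule measurable_unit_measure) measurable

lemma measurable_J [measurable]: "J k \<in> noise \<rightarrow>\<^sub>M count_space UNIV"
proof (induction k)
  case (Suc k)
  have "(\<lambda>\<omega>. dir (J k \<omega>) (\<omega> (3 * k + 1))) \<in> noise \<rightarrow>\<^sub>M count_space UNIV"
    by (rule measurable_compose_countable[OF _ Suc])
       (rule measurable_compose[OF measurable_noise_component measurable_dir])
  then show ?case by simp
qed simp

lemma measurable_H [measurable]: "H k \<in> borel_measurable noise"
  unfolding H_def by (rule measurable_compose_countable[OF _ measurable_J]) measurable

lemma measurable_T [measurable]: "T k \<in> borel_measurable noise"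
  unfolding T_def by measurable

lemma measurable_G [measurable]: "G k \<in> noise \<rightarrow>\<^sub>M count_space UNIV"
  unfolding G_def by (rule measurable_compose_countable[OF _ measurable_J])
       (rule measurable_compose[OF measurable_noise_component measurable_hold_ticks])

lemma measurable_tick [measurable]: "tick k \<in> noise \<rightarrow>\<^sub>M count_space UNIV"
  unfolding tick_def by measurable

lemma measurable_stage [measurable]: "stage i \<in> noise \<rightarrow>\<^sub>M count_space UNIV"
  unfolding stage_def by measurable

lemma measurable_A [measurable]: "A i \<in> noise \<rightarrow>\<^sub>M count_space UNIV"
  unfolding A_def by (rule measurable_compose_countable[OF _ measurable_stage]) measurable

lemma measurable_D [measurable]: "D i \<in> noise \<rightarrow>\<^sub>M count_space UNIV"
proof (induction i)
  case (Suc i)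
  have "(\<lambda>\<omega>. sample (cond_law (snd (D i \<omega>)) (A i \<omega>) (A (Suc i) \<omega>)) (\<omega> (3 * i + 2))) \<in> noise \<rightarrow>\<^sub>M count_space UNIV"
    by (rule measurable_compose_countable[OF _ Suc, where f="\<lambda>d \<omega>. sample (cond_law (snd d) (A i \<omega>) (A (Suc i) \<omega>)) (\<omega> (3 * i + 2))"],
        rule measurable_compose_countable[OF _ measurable_A, where f="\<lambda>a \<omega>. sample (cond_law _ a (A (Suc i) \<omega>)) (\<omega> (3 * i + 2))"],
        rule measurable_compose_countable[OF _ measurable_A, where f="\<lambda>a \<omega>. sample (cond_law _ _ a) (\<omega> (3 * i + 2))"],
        rule measurable_compose[OF measurable_noise_component measurable_sample])
  then show ?case by simp
qed simp

lemma measurable_S [measurable]: "S i \<in> noise \<rightarrow>\<^sub>M count_space UNIV"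
  unfolding S_def
  by (rule measurable_compose_countable[OF _ measurable_A, where f="\<lambda>a \<omega>. (D i \<omega>, a)"],
      rule measurable_compose[OF measurable_D]) simp

section \<open>The joint chain in tick time\<close>

lemma dir_cases: "{u \<in> {0<..<1}. dir e u = e'} =
    (if e' = e + 1 then {0<..<up e} else if e' = e - 1 then {up e..<1} else {})"
  using up[of e] by (auto simp: dir_def)

lemma sets_dir: "{u \<in> {0<..<1}. dir e u = e'} \<in> sets unit_measure"
  unfolding dir_cases sets_unit_measure using up[of e] by auto

lemma measure_dir: "measure unit_measure {u \<in> {0<..<1}. dir e u = e'} = dir_prob e e'"
proof -
  have "measure unit_measure {0<..<up e} = up e - 0" "measure unit_measure {up e..<1} = 1 - up e"
    using up[of e] by (intro unit_measure_interval; force simp: sets_unit_measure)+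
  then show ?thesis unfolding dir_cases dir_prob_def by simp
qed

lemma hold_ticks_ge_iff:
  assumes "u \<in> {0<..<1}"
  shows "Suc g \<le> hold_ticks e u \<longleftrightarrow> u \<le> (1 - leave e) ^ g"
proof -
  have l: "0 < 1 - leave e" "1 - leave e < 1" using leave[of e] by auto
  have "Suc g \<le> hold_ticks e u \<longleftrightarrow> real g \<le> ln u / ln (1 - leave e)"
  proof -
    have "ln u / ln (1 - leave e) \<ge> 0" using assms l by (intro divide_nonpos_nonpos) auto
    then show ?thesis unfolding hold_ticks_def by (simp add: le_nat_iff le_floor_iff)
  qed
  also have "\<dots> \<longleftrightarrow> ln u \<le> ln ((1 - leave e) ^ g)"
    using l by (simp add: ln_realpow neg_le_divide_eq)
  also have "\<dots> \<longleftrightarrow> u \<le> (1 - leave e) ^ g"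
    using assms l by (subst ln_le_cancel_iff) auto
  finally show ?thesis .
qed

lemma sets_hold_ticks: "{u \<in> {0<..<1}. Q (hold_ticks e u)} \<in> sets unit_measure"
  using measurable_sets[OF measurable_hold_ticks, of "{g. Q g}" e] by (simp add: vimage_def Int_def conj_commute)

lemma measure_hold_ticks_ge: "measure unit_measure {u \<in> {0<..<1}. Suc g \<le> hold_ticks e u} = (1 - leave e) ^ g"
proof -
  have "0 \<le> (1 - leave e) ^ g" "(1 - leave e) ^ g \<le> 1" using leave[of e] by (auto intro: power_le_one)
  then have "measure unit_measure {u \<in> {0<..<1}. Suc g \<le> hold_ticks e u} = (1 - leave e) ^ g - 0"
    using hold_ticks_ge_iff by (intro unit_measure_interval sets_hold_ticks) auto
  then show ?thesis by simp
qed

lemma measure_hold_ticks_eq: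
  "measure unit_measure {u \<in> {0<..<1}. hold_ticks e u = Suc g} = (1 - leave e) ^ g * leave e"
proof -
  let ?B = "\<lambda>g. {u \<in> {0<..<1}. Suc g \<le> hold_ticks e u}"
  have "{u \<in> {0<..<1}. hold_ticks e u = Suc g} = ?B g - ?B (Suc g)" by auto
  then have "measure unit_measure {u \<in> {0<..<1}. hold_ticks e u = Suc g} = measure unit_measure (?B g) - measure unit_measure (?B (Suc g))"
    using sets_hold_ticks by (simp only:) (rule unit.finite_measure_Diff, auto)
  then show ?thesis unfolding measure_hold_ticks_ge by (simp add: algebra_simps)
qed

lemma pmf_tick_law: "pmf (tick_law e) e' = (if e' = e then 1 - leave e else leave e * dir_prob e e')"
proof -
  have "map_pmf (\<lambda>b. if b then e + 1 else e - 1) (bernoulli_pmf (up e)) =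
     bind_pmf (bernoulli_pmf (up e)) (\<lambda>b. return_pmf (if b then e + 1 else e - 1))"
    by (simp add: map_pmf_def)
  then show ?thesis using leave[of e] up[of e]
    by (auto simp: tick_law_def pmf_bind dir_prob_def)
qed

lemma set_tick_law: "set_pmf (tick_law e) = {e - 1, e, e + 1}"
  using leave[of e] up[of e] by (auto simp: set_pmf_eq pmf_tick_law dir_prob_def)

lemma joint_law: "map_pmf fst (joint_law d e) = W d" "map_pmf snd (joint_law d e) = tick_law e"
    "measure_pmf.prob (joint_law d e) {z. int (snd (fst z)) \<noteq> snd z}
       \<le> (\<Sum>y\<in>set_pmf (tick_law e). max 0 (pmf (tick_law e) y - pmf (map_pmf (\<lambda>w. int (snd w)) (W d)) y))"
  using someI_ex[OF maximal_coupling[of "tick_law e" "W d" "\<lambda>w. int (snd w)"], folded joint_law_def]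
  by (auto simp: set_tick_law)

lemma cond_law: "set_pmf (cond_law d e e') \<subseteq> set_pmf (W d)"
    "pmf (tick_law e) e' * pmf (cond_law d e e') w = pmf (joint_law d e) (w, e')"
  using someI_ex[OF ex_conditional_pmf[of "joint_law d e"], folded cond_law_def] by (cases w; auto simp: joint_law)+

lemma tick_coord_mod [simp]: "Suc (Suc (3 * k)) mod 3 = 2" "Suc (3 * k) mod 3 = 1"
  by presburger+

text \<open>The coordinates used by \<open>r\<close> completed stages and \<open>k\<close> ticks.\<close>
definition coords :: "nat \<Rightarrow> nat \<Rightarrow> nat set" where
  "coords r k = {i. if i mod 3 = 2 then i < 3 * k else i < 3 * r}"

lemma depends_on_tick_event: "{ u \<in> {0<..<1}. Q u} \<in> sets unit_measure \<Longrightarrow> depends_on {i} {\<omega> \<in> space noise. Q (\<omega> i)}"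
  using depends_on_single[of "{ u \<in> {0<..<1}. Q u}" i]
  by (rule back_subst[where P="depends_on {i}"]) (auto simp: space_noise)

lemma prob_single_event: "{ u \<in> {0<..<1}. Q u} \<in> sets unit_measure \<Longrightarrow>
   \<P>(\<omega> in noise. Q (\<omega> i)) = measure unit_measure {u \<in> {0<..<1}. Q u}"
  by (subst prob_noise_single[of "{ u \<in> {0<..<1}. Q u}" i, symmetric])
     (auto simp: space_noise intro!: arg_cong[where f="noise.prob"])

text \<open>The Markov property of the joint chain. A path of \<open>k\<close> ticks determines how many stages \<open>r\<close> it has
  completed and that the current one has lasted more than \<open>g\<close> ticks. It is thus the conjunction of
  an event \<open>Q\<close> about the completed stages and the sampling of \<open>X\<close>, and of the event that the running
  holding time exceeds \<open>g\<close>, which concerns a coordinate that \<open>Q\<close> leaves untouched. As the geometric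
  law is memoryless, one more tick multiplies the probability by one kernel factor: either the running stage goes on, or it ends now and the next direction is drawn.\<close>
lemma path_event:
  assumes "\<sigma> 0 = ((0, d0), int d0)"
  shows "\<exists>r g Q. depends_on (coords r k) Q \<and>
     {\<omega> \<in> space noise. \<forall>j\<le>k. S j \<omega> = \<sigma> j} = Q \<inter> {\<omega> \<in> space noise. Suc g \<le> hold_ticks (snd (\<sigma> k)) (\<omega> (3 * r))} \<and>
     (\<forall>\<omega>\<in>Q. J r \<omega> = snd (\<sigma> k) \<and> tick r \<omega> + g = k) \<and>
     noise.prob Q * (1 - leave (snd (\<sigma> k))) ^ g = (\<Prod>j<k. pmf (K (\<sigma> j)) (\<sigma> (Suc j)))"
proof (induction k)
  case 0
  have "{\<omega> \<in> space noise. \<forall>j\<le>0. S j \<omega> = \<sigma> j} = space noise"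
    using assms by (auto simp: S_def A_def)
  moreover have "depends_on {} (space noise)" by (auto simp: depends_on_def)
  ultimately show ?case using assms
    by (intro exI[of _ 0] exI[of _ "space noise"]) (auto simp: coords_def hold_ticks_def noise.prob_space depends_on_def)
next
  case (Suc k)
  then obtain r g Q where
    Q: "depends_on (coords r k) Q"
    and ev: "{\<omega> \<in> space noise. \<forall>j\<le>k. S j \<omega> = \<sigma> j} = Q \<inter> {\<omega> \<in> space noise. Suc g \<le> hold_ticks (snd (\<sigma> k)) (\<omega> (3 * r))}"
    and J: "\<And>\<omega>. \<omega> \<in> Q \<Longrightarrow> J r \<omega> = snd (\<sigma> k)" and tick: "\<And>\<omega>. \<omega> \<in> Q \<Longrightarrow> tick r \<omega> + g = k"
    and prob: "noise.prob Q * (1 - leave (snd (\<sigma> k))) ^ g = (\<Prod>j<k. pmf (K (\<sigma> j)) (\<sigma> (Suc j)))"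
    by blast
  define e d e' w' where defs: "e = snd (\<sigma> k)" "d = snd (fst (\<sigma> k))" "e' = snd (\<sigma> (Suc k))" "w' = fst (\<sigma> (Suc k))"
  define U where "U = {\<omega> \<in> space noise. sample (cond_law d e e') (\<omega> (3 * k + 2)) = w'}"
  have sU: "{u \<in> {0<..<1}. sample (cond_law d e e') u = w'} \<in> sets unit_measure"
    using measurable_sets[OF measurable_sample, of "{w'}" "cond_law d e e'"] by (simp add: vimage_def Int_def conj_commute)
  have U: "depends_on {3 * k + 2} U" unfolding U_def by (rule depends_on_tick_event[OF sU])
  have PU: "noise.prob U = pmf (cond_law d e e') w'"
    unfolding U_def prob_single_event[OF sU] by (rule measure_sample)
  have QU: "depends_on (coords r (Suc k)) (Q \<inter> U)"
    by (rule depends_on_Int[OF Q U]) (auto simp: coords_def)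
  have "coords r k \<inter> {3 * k + 2} = {}" by (auto simp: coords_def)
  then have PQU: "noise.prob (Q \<inter> U) = noise.prob Q * pmf (cond_law d e e') w'"
    using prob_depends_on_Int[OF Q U] PU by simp
  have QS: "Q \<subseteq> space noise" using Q sets.sets_into_space unfolding depends_on_def by blast
  \<comment> \<open>The running stage either covers the next tick or ends exactly there.\<close>
  have nxt: "A (Suc k) \<omega> = (if Suc (Suc g) \<le> hold_ticks e (\<omega> (3 * r)) then e else dir e (\<omega> (3 * r + 1)))"
    if "\<omega> \<in> Q" "Suc g \<le> hold_ticks e (\<omega> (3 * r))" for \<omega>
  proof -
    have Gr: "G r \<omega> = hold_ticks e (\<omega> (3 * r))" using J[OF that(1)] by (simp add: G_def defs)
    then have "stage k \<omega> = r" using tick[OF that(1)] that(2) by (intro stageI) (auto simp: tick_Suc)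
    then show ?thesis
      using tick[OF that(1)] J[OF that(1)] Gr by (auto simp: A_def stage_Suc tick_Suc defs)
  qed
  have step: "{\<omega> \<in> space noise. \<forall>j\<le>Suc k. S j \<omega> = \<sigma> j} =
     {\<omega> \<in> Q \<inter> U. Suc g \<le> hold_ticks e (\<omega> (3 * r)) \<and> A (Suc k) \<omega> = e'}" (is "?L = ?R")
  proof (rule set_eqI)
    fix \<omega>
    have "\<omega> \<in> ?L \<longleftrightarrow> \<omega> \<in> {\<omega> \<in> space noise. \<forall>j\<le>k. S j \<omega> = \<sigma> j} \<and> S (Suc k) \<omega> = \<sigma> (Suc k)"
      by (auto simp: le_Suc_eq)
    also have "\<dots> \<longleftrightarrow> \<omega> \<in> {\<omega> \<in> space noise. \<forall>j\<le>k. S j \<omega> = \<sigma> j} \<and> 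
        sample (cond_law d e e') (\<omega> (3 * k + 2)) = w' \<and> A (Suc k) \<omega> = e'"
    proof (rule conj_cong[OF refl])
      assume "\<omega> \<in> {\<omega> \<in> space noise. \<forall>j\<le>k. S j \<omega> = \<sigma> j}"
      then have "S k \<omega> = \<sigma> k" by auto
      then have "snd (D k \<omega>) = d" "A k \<omega> = e" by (auto simp: S_def defs prod_eq_iff)
      then show "S (Suc k) \<omega> = \<sigma> (Suc k) \<longleftrightarrow> sample (cond_law d e e') (\<omega> (3 * k + 2)) = w' \<and> A (Suc k) \<omega> = e'"
        by (auto simp: S_def defs prod_eq_iff)
    qed
    also have "\<dots> \<longleftrightarrow> \<omega> \<in> ?R" unfolding ev using QS by (auto simp: U_def defs)
    finally show "\<omega> \<in> ?L \<longleftrightarrow> \<omega> \<in> ?R" .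
  qed
  have pK: "pmf (K (\<sigma> k)) (\<sigma> (Suc k)) = pmf (tick_law e) e' * pmf (cond_law d e e') w'"
    unfolding cond_law(2) by (simp add: K_def defs)
  show ?case
  proof (cases "e' = e")
    case True
    show ?thesis
    proof (rule exI[of _ r], rule exI[of _ "Suc g"], rule exI[of _ "Q \<inter> U"], intro conjI ballI)
      show "depends_on (coords r (Suc k)) (Q \<inter> U)" by (rule QU)
      show "{\<omega> \<in> space noise. \<forall>j\<le>Suc k. S j \<omega> = \<sigma> j} = Q \<inter> U \<inter> {\<omega> \<in> space noise. Suc (Suc g) \<le> hold_ticks (snd (\<sigma> (Suc k))) (\<omega> (3 * r))}"
      proof -
        have se: "snd (\<sigma> (Suc k)) = e" using True by (simp add: defs)
        have "(Suc g \<le> hold_ticks e (\<omega> (3 * r)) \<and> A (Suc k) \<omega> = e') \<longleftrightarrow> Suc (Suc g) \<le> hold_ticks e (\<omega> (3 * r))"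
          if "\<omega> \<in> Q" for \<omega>
          using nxt[OF that] True dir_neq[of e "\<omega> (3 * r + 1)"] by (cases "Suc (Suc g) \<le> hold_ticks e (\<omega> (3 * r))") auto
        then show ?thesis unfolding step se using QS by blast
      qed
      show "noise.prob (Q \<inter> U) * (1 - leave (snd (\<sigma> (Suc k)))) ^ Suc g = (\<Prod>j<Suc k. pmf (K (\<sigma> j)) (\<sigma> (Suc j)))"
        using prob True unfolding PQU prod.lessThan_Suc pK by (simp add: pmf_tick_law defs[symmetric] mult_ac)
      fix \<omega> assume "\<omega> \<in> Q \<inter> U"
      then show "J r \<omega> = snd (\<sigma> (Suc k))" "tick r \<omega> + Suc g = Suc k"
        using J[of \<omega>] tick[of \<omega>] True by (auto simp: defs)
    qed
  next
    case False
    define E1 where "E1 = {\<omega> \<in> space noise. hold_ticks e (\<omega> (3 * r)) = Suc g}"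
    define E2 where "E2 = {\<omega> \<in> space noise. dir e (\<omega> (3 * r + 1)) = e'}"
    have E1: "depends_on {3 * r} E1" unfolding E1_def by (rule depends_on_tick_event[OF sets_hold_ticks])
    have E2: "depends_on {3 * r + 1} E2" unfolding E2_def by (rule depends_on_tick_event[OF sets_dir])
    have PE1: "noise.prob E1 = (1 - leave e) ^ g * leave e"
      unfolding E1_def prob_single_event[OF sets_hold_ticks[where Q="\<lambda>h. h = Suc g"]] by (rule measure_hold_ticks_eq)
    have PE2: "noise.prob E2 = dir_prob e e'"
      unfolding E2_def prob_single_event[OF sets_dir] by (rule measure_dir)
    have dj: "coords r (Suc k) \<inter> {3 * r} = {}" "(coords r (Suc k) \<union> {3 * r}) \<inter> {3 * r + 1} = {}"
      by (auto simp: coords_def)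
    have QUE: "depends_on (coords r (Suc k) \<union> {3 * r}) (Q \<inter> U \<inter> E1)"
      by (rule depends_on_Int[OF QU E1]) auto
    have P': "noise.prob (Q \<inter> U \<inter> E1 \<inter> E2) = noise.prob Q * pmf (cond_law d e e') w' * ((1 - leave e) ^ g * leave e) * dir_prob e e'"
      using prob_depends_on_Int[OF QU E1 dj(1)] prob_depends_on_Int[OF QUE E2 dj(2)] by (simp add: PE1 PE2 PQU)
    show ?thesis
    proof (rule exI[of _ "Suc r"], rule exI[of _ 0], rule exI[of _ "Q \<inter> U \<inter> E1 \<inter> E2"], intro conjI ballI)
      show "depends_on (coords (Suc r) (Suc k)) (Q \<inter> U \<inter> E1 \<inter> E2)"
        by (rule depends_on_Int[OF QUE E2]) (auto simp: coords_def split: if_splits)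
      show "{\<omega> \<in> space noise. \<forall>j\<le>Suc k. S j \<omega> = \<sigma> j} = Q \<inter> U \<inter> E1 \<inter> E2 \<inter>
          {\<omega> \<in> space noise. Suc 0 \<le> hold_ticks (snd (\<sigma> (Suc k))) (\<omega> (3 * Suc r))}"
      proof -
        have "Suc 0 \<le> hold_ticks x u" for x u by (simp add: hold_ticks_def)
        moreover have "(Suc g \<le> hold_ticks e (\<omega> (3 * r)) \<and> A (Suc k) \<omega> = e') \<longleftrightarrow>
            hold_ticks e (\<omega> (3 * r)) = Suc g \<and> dir e (\<omega> (3 * r + 1)) = e'" if "\<omega> \<in> Q" for \<omega>
          using nxt[OF that] False by (cases "Suc (Suc g) \<le> hold_ticks e (\<omega> (3 * r))") auto
        ultimately show ?thesis unfolding step E1_def E2_def using QS by blast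
      qed
      show "noise.prob (Q \<inter> U \<inter> E1 \<inter> E2) * (1 - leave (snd (\<sigma> (Suc k)))) ^ 0 = (\<Prod>j<Suc k. pmf (K (\<sigma> j)) (\<sigma> (Suc j)))"
        using prob False unfolding P' prod.lessThan_Suc pK by (simp add: pmf_tick_law defs[symmetric] mult_ac)
      fix \<omega> assume \<omega>: "\<omega> \<in> Q \<inter> U \<inter> E1 \<inter> E2"
      then show "J (Suc r) \<omega> = snd (\<sigma> (Suc k))" using J[of \<omega>] by (auto simp: E2_def defs)
      have "G r \<omega> = Suc g" using \<omega> J[of \<omega>] by (simp add: G_def E1_def defs)
      then show "tick (Suc r) \<omega> + 0 = Suc k" using \<omega> tick[of \<omega>] by (simp add: tick_Suc)
    qed
  qed
qed

lemma S_has_kernel: "has_kernel noise K ((0, d0), int d0) S"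
  unfolding has_kernel_def
proof (intro conjI allI impI ballI)
  fix k and \<sigma> :: "nat \<Rightarrow> (nat \<times> nat) \<times> int" assume "\<sigma> 0 = ((0, d0), int d0)"
  from path_event[where \<sigma>=\<sigma> and k=k, OF this] obtain r g Q where
    Q: "depends_on (coords r k) Q"
    and ev: "{\<omega> \<in> space noise. \<forall>j\<le>k. S j \<omega> = \<sigma> j} = Q \<inter> {\<omega> \<in> space noise. Suc g \<le> hold_ticks (snd (\<sigma> k)) (\<omega> (3 * r))}"
    and prob: "noise.prob Q * (1 - leave (snd (\<sigma> k))) ^ g = (\<Prod>j<k. pmf (K (\<sigma> j)) (\<sigma> (Suc j)))"
    by blast
  have dep: "depends_on {3 * r} {\<omega> \<in> space noise. Suc g \<le> hold_ticks (snd (\<sigma> k)) (\<omega> (3 * r))}"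
    by (rule depends_on_tick_event[OF sets_hold_ticks])
  have dj: "coords r k \<inter> {3 * r} = {}" by (auto simp: coords_def)
  have "\<P>(\<omega> in noise. Suc g \<le> hold_ticks (snd (\<sigma> k)) (\<omega> (3 * r))) = (1 - leave (snd (\<sigma> k))) ^ g"
    unfolding prob_single_event[OF sets_hold_ticks[where Q="\<lambda>h. Suc g \<le> h"]] by (rule measure_hold_ticks_ge)
  then show "\<P>(\<omega> in noise. \<forall>j\<le>k. S j \<omega> = \<sigma> j) = (\<Prod>j<k. pmf (K (\<sigma> j)) (\<sigma> (Suc j)))"
    unfolding ev prob_depends_on_Int[OF Q dep dj] using prob by simp
qed (auto simp: S_def A_def)

section \<open>The law of the discrete chain\<close>

lemma pmf_W: "pmf (W d) (m, d') = pmf (P d) m * pmf (P m) d'"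
proof -
  have "pmf (map_pmf (Pair y) (P y)) (m, d') = indicator {m} y * pmf (P m) d'" for y
  proof (cases "y = m")
    case True then show ?thesis by (simp add: pmf_map_inj' inj_on_def)
  next
    case False then show ?thesis by (auto simp: pmf_eq_0_set_pmf)
  qed
  then have "pmf (W d) (m, d') = (\<integral>y. indicator {m} y * pmf (P m) d' \<partial>measure_pmf (P d))"
    by (simp add: W_def pmf_bind)
  then show ?thesis
    by (subst (asm) integral_measure_pmf_real[of "{m}"]) (auto simp: indicator_def split: if_splits)
qed

lemma set_W: "set_pmf (W d) \<subseteq> {..n} \<times> {..n}"
  using set_P unfolding W_def by fastforce

lemma D_Suc_le: assumes "\<omega> \<in> space noise" shows "fst (D (Suc i) \<omega>) \<le> n" "snd (D (Suc i) \<omega>) \<le> n"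
proof -
  have "D (Suc i) \<omega> \<in> set_pmf (cond_law (snd (D i \<omega>)) (A i \<omega>) (A (Suc i) \<omega>))"
    using assms by (simp only: D.simps) (intro sample_in_set_pmf, simp add: space_noise)
  then have "D (Suc i) \<omega> \<in> {..n} \<times> {..n}" using cond_law(1) set_W by blast
  then show "fst (D (Suc i) \<omega>) \<le> n" "snd (D (Suc i) \<omega>) \<le> n" by (auto simp: mem_Times_iff)
qed

lemma X_le: "\<omega> \<in> space noise \<Longrightarrow> X i \<omega> \<le> n"
  unfolding X_def using D_Suc_le[of \<omega>] d0 by (cases "i div 2") (auto simp del: D.simps(2))

lemma measurable_X: "X i \<in> noise \<rightarrow>\<^sub>M count_space UNIV"
  unfolding X_def by (cases "even i") (auto intro: measurable_compose[OF measurable_D] simp del: D.simps)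

lemma D_has_kernel: "has_kernel noise (\<lambda>w. W (snd w)) (0, d0) D"
  using noise.has_kernel_map[OF S_has_kernel, of fst "\<lambda>w. W (snd w)"]
  by (simp add: K_def joint_law S_def)

text \<open>After an even number of steps the path of \<open>X\<close> is a path of the pairs \<open>D\<close>, whose law is a projection
  of the joint chain.\<close>
lemma X_law_even:
  assumes "x 0 = d0"
  shows "\<P>(\<omega> in noise. \<forall>j\<le>2 * k. X j \<omega> = x j) = (\<Prod>j<2 * k. pmf (P (x j)) (x (Suc j)))"
proof -
  define \<delta> where "\<delta> j = (case j of 0 \<Rightarrow> (0, d0) | Suc i \<Rightarrow> (x (2 * i + 1), x (2 * i + 2)))" for j
  have sn: "snd (\<delta> j) = x (2 * j)" for j using assms by (cases j) (auto simp: \<delta>_def)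
  have "(\<forall>j\<le>2 * k. X j \<omega> = x j) \<longleftrightarrow> (\<forall>j\<le>k. D j \<omega> = \<delta> j)" for \<omega>
  proof
    assume *: "\<forall>j\<le>2 * k. X j \<omega> = x j"
    show "\<forall>j\<le>k. D j \<omega> = \<delta> j"
    proof (intro allI impI)
      fix j assume "j \<le> k"
      then show "D j \<omega> = \<delta> j"
      proof (cases j)
        case 0 then show ?thesis by (simp add: \<delta>_def)
      next
        case (Suc i)
        then have "X (2 * i + 1) \<omega> = x (2 * i + 1)" "X (2 * i + 2) \<omega> = x (2 * i + 2)" using * \<open>j \<le> k\<close> by auto
        then show ?thesis by (simp add: X_def \<delta>_def Suc prod_eq_iff del: D.simps)
      qed
    qed
  next
    assume *: "\<forall>j\<le>k. D j \<omega> = \<delta> j"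
    show "\<forall>j\<le>2 * k. X j \<omega> = x j"
    proof (intro allI impI)
      fix j assume j: "j \<le> 2 * k"
      show "X j \<omega> = x j"
      proof (cases "even j")
        case True
        then obtain i where "j = 2 * i" by (auto elim: evenE)
        then show ?thesis using * j sn[of i] by (simp add: X_def)
      next
        case False
        then obtain i where i: "j = 2 * i + 1" by (auto elim: oddE)
        then have "D (Suc i) \<omega> = \<delta> (Suc i)" using * j by (simp del: D.simps)
        then show ?thesis using i by (simp add: X_def \<delta>_def del: D.simps)
      qed
    qed
  qed
  then have "\<P>(\<omega> in noise. \<forall>j\<le>2 * k. X j \<omega> = x j) = (\<Prod>j<k. pmf (W (snd (\<delta> j))) (\<delta> (Suc j)))"
    using D_has_kernel by (simp add: has_kernel_def \<delta>_def)
  also have "\<dots> = (\<Prod>j<k. pmf (P (x (2 * j))) (x (2 * j + 1)) * pmf (P (x (2 * j + 1))) (x (2 * j + 2)))"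
    by (simp add: sn) (simp add: \<delta>_def pmf_W)
  also have "\<dots> = (\<Prod>j<2 * k. pmf (P (x j)) (x (Suc j)))"
    by (induction k) (simp_all add: mult_ac)
  finally show ?thesis .
qed

text \<open>An odd number of steps is reduced to an even number by summing over one further state.\<close>
lemma X_law:
  assumes "x 0 = d0"
  shows "\<P>(\<omega> in noise. \<forall>j\<le>i. X j \<omega> = x j) = (\<Prod>j<i. pmf (P (x j)) (x (Suc j)))"
proof (cases "even i")
  case True then show ?thesis using X_law_even[where x=x, OF assms] by (auto elim: evenE)
next
  case False
  then obtain k where i: "Suc i = 2 * Suc k" by (auto elim: oddE)
  note [measurable] = measurable_X
  let ?E = "\<lambda>y. {\<omega> \<in> space noise. \<forall>j\<le>Suc i. X j \<omega> = (x(Suc i := y)) j}"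
  have "{\<omega> \<in> space noise. \<forall>j\<le>i. X j \<omega> = x j} = (\<Union>y\<in>{..n}. ?E y)"
    using X_le by (auto simp: le_Suc_eq)
  moreover have "noise.prob (\<Union>y\<in>{..n}. ?E y) = (\<Sum>y\<in>{..n}. noise.prob (?E y))"
  proof (rule noise.finite_measure_finite_Union)
    show "disjoint_family_on ?E {..n}" unfolding disjoint_family_on_def by auto
    show "?E ` {..n} \<subseteq> noise.events" by auto
  qed simp
  moreover have "noise.prob (?E y) = (\<Prod>j<i. pmf (P (x j)) (x (Suc j))) * pmf (P (x i)) y" for y
    using X_law_even[of "x(Suc i := y)" "Suc k"] assms unfolding i[symmetric] by simp
  moreover have "(\<Sum>y\<in>{..n}. pmf (P (x i)) y) = 1" using set_P by (intro sum_pmf_eq_1) auto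
  ultimately show ?thesis by (simp add: sum_distrib_left[symmetric])
qed

section \<open>The law of the jump chain and the holding times\<close>

text \<open>In terms of the noise the event is a box: given the prescribed states, each jump and each
  holding time is a condition on a coordinate of its own.\<close>
lemma J_box_prob:
  assumes x0: "x 0 = int d0" and B: "\<And>j. B j \<in> sets unit_measure"
  shows "\<P>(\<omega> in noise. \<forall>j\<le>k. J j \<omega> = x j \<and> \<omega> (3 * j) \<in> B j) =
    (\<Prod>j<k. dir_prob (x j) (x (Suc j))) * (\<Prod>j\<le>k. measure unit_measure (B j))"
proof -
  define C where "C i = (if i mod 3 = 0 then B (i div 3) else if i mod 3 = 1
     then {u \<in> {0<..<1}. dir (x (i div 3)) u = x (Suc (i div 3))} else {0<..<1})" for i
  have C[simp]: "C (3 * j) = B j" "C (Suc (3 * j)) = {u \<in> {0<..<1}. dir (x j) u = x (Suc j)}"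
      "C (Suc (Suc (3 * j))) = {0<..<1}" "C (Suc (Suc (Suc (3 * j)))) = B (Suc j)" for j
  proof -
    have "Suc (3 * j) div 3 = j" "Suc (Suc (Suc (3 * j))) mod 3 = 0" "Suc (Suc (Suc (3 * j))) div 3 = Suc j" by presburger+
    then show "C (3 * j) = B j" "C (Suc (3 * j)) = {u \<in> {0<..<1}. dir (x j) u = x (Suc j)}"
      "C (Suc (Suc (3 * j))) = {0<..<1}" "C (Suc (Suc (Suc (3 * j)))) = B (Suc j)" unfolding C_def by simp_all
  qed
  have C0: "C 0 = B 0" using C(1)[of 0] by simp
  have range: "{..<3 * Suc j + 1} = {..<3 * j + 1} \<union> {Suc (3 * j), Suc (Suc (3 * j)), Suc (Suc (Suc (3 * j)))}" for j by auto
  have "(\<forall>j\<le>k. J j \<omega> = x j \<and> \<omega> (3 * j) \<in> B j) \<longleftrightarrow> (\<forall>i\<in>{..<3 * k + 1}. \<omega> i \<in> C i)" if "\<omega> \<in> space noise" for \<omega>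
  proof (induction k)
    case 0 show ?case using x0 C0 by (auto simp: less_Suc_eq)
  next
    case (Suc k)
    have *: "\<omega> i \<in> {0<..<1}" for i using that by (simp add: space_noise)
    have split: "(\<forall>j\<le>Suc k. Q j) \<longleftrightarrow> (\<forall>j\<le>k. Q j) \<and> Q (Suc k)" for Q by (auto simp: le_Suc_eq)
    have e3: "3 * Suc k = Suc (Suc (Suc (3 * k)))" by simp
    have "(\<forall>j\<le>Suc k. J j \<omega> = x j \<and> \<omega> (3 * j) \<in> B j) \<longleftrightarrow>
       (\<forall>j\<le>k. J j \<omega> = x j \<and> \<omega> (3 * j) \<in> B j) \<and>
         dir (x k) (\<omega> (Suc (3 * k))) = x (Suc k) \<and> \<omega> (Suc (Suc (Suc (3 * k)))) \<in> B (Suc k)"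
      unfolding split e3 by (rule conj_cong[OF refl]) simp
    then show ?case unfolding Suc range ball_Un using *[of "Suc (3 * k)"] *[of "Suc (Suc (3 * k))"] by simp
  qed
  then have "\<P>(\<omega> in noise. \<forall>j\<le>k. J j \<omega> = x j \<and> \<omega> (3 * j) \<in> B j) = \<P>(\<omega> in noise. \<forall>i\<in>{..<3 * k + 1}. \<omega> i \<in> C i)"
    by (intro arg_cong[where f="noise.prob"]) auto
  also have "\<dots> = (\<Prod>i<3 * k + 1. measure unit_measure (C i))"
    using B sets_dir by (intro prob_noise_box) (auto simp: C_def sets_unit_measure)
  also have "\<dots> = (\<Prod>j<k. dir_prob (x j) (x (Suc j))) * (\<Prod>j\<le>k. measure unit_measure (B j))"
  proof (induction k)
    case (Suc k)
    have "(\<Prod>i<3 * Suc k + 1. measure unit_measure (C i)) = (\<Prod>i<3 * k + 1. measure unit_measure (C i)) *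
       measure unit_measure (C (Suc (3 * k))) * measure unit_measure (C (Suc (Suc (3 * k)))) * measure unit_measure (C (Suc (Suc (Suc (3 * k)))))"
    proof -
      have "3 * Suc k + 1 = Suc (Suc (Suc (3 * k + 1)))" "3 * k + 1 = Suc (3 * k)" by simp_all
      then show ?thesis by (simp only: prod.lessThan_Suc)
    qed
    also have "\<dots> = (\<Prod>i<3 * k + 1. measure unit_measure (C i)) * dir_prob (x k) (x (Suc k)) * measure unit_measure (B (Suc k))"
      unfolding C measure_dir using unit.prob_space by simp
    finally show ?case unfolding Suc by (simp add: mult_ac)
  qed (simp add: C0)
  finally show ?thesis .
qed

lemma J_law:
  assumes "x 0 = int d0"
  shows "\<P>(\<omega> in noise. \<forall>j\<le>k. J j \<omega> = x j) = (\<Prod>j<k. dir_prob (x j) (x (Suc j)))"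
proof -
  have "\<P>(\<omega> in noise. \<forall>j\<le>k. J j \<omega> = x j) = \<P>(\<omega> in noise. \<forall>j\<le>k. J j \<omega> = x j \<and> \<omega> (3 * j) \<in> {0<..<1})"
    by (intro arg_cong[where f="noise.prob"]) (auto simp: space_noise)
  also have "\<dots> = (\<Prod>j<k. dir_prob (x j) (x (Suc j)))"
    using unit.prob_space by (subst J_box_prob[where x=x, OF assms]) (auto simp: sets_unit_measure)
  finally show ?thesis .
qed

lemma J_H_law:
  assumes x0: "x 0 = int d0" and s: "\<And>j. j \<le> k \<Longrightarrow> 0 \<le> s j"
  shows "\<P>(\<omega> in noise. (\<forall>j\<le>k. s j < H j \<omega>) \<and> (\<forall>j\<le>k. J j \<omega> = x j)) =
    (\<Prod>j\<le>k. exp (- rate (x j) * s j)) * \<P>(\<omega> in noise. \<forall>j\<le>k. J j \<omega> = x j)"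
proof -
  define B where "B j = {0<..<1} \<inter> {..<exp (- rate (x j) * s j)}" for j
  have mem: "s j < - ln u / rate (x j) \<longleftrightarrow> u \<in> B j" if "u \<in> {0<..<1}" for u j
  proof -
    have "s j < - ln u / rate (x j) \<longleftrightarrow> ln u < - rate (x j) * s j"
      using rate_pos[of "x j"] by (simp add: field_simps) linarith
    also have "\<dots> \<longleftrightarrow> u < exp (- rate (x j) * s j)" using that by (metis exp_less_cancel_iff exp_ln greaterThanLessThan_iff)
    finally show ?thesis using that by (simp add: B_def)
  qed
  have B: "B j \<in> sets unit_measure" for j unfolding B_def by (auto simp: sets_unit_measure)
  have mB: "measure unit_measure (B j) = exp (- rate (x j) * s j)" if "j \<le> k" for j
  proof -
    define y where "y = exp (- rate (x j) * s j)"
    have y: "0 \<le> y" "y \<le> 1" using s[OF that] rate_pos[of "x j"] by (simp_all add: y_def)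
    have "z \<in> B j \<longleftrightarrow> 0 < z \<and> z < 1 \<and> z < y" for z by (simp add: B_def y_def)
    then have sub: "{0<..<y} \<subseteq> B j" "B j \<subseteq> {0..y}" using y by (simp_all add: subset_iff)
    have "measure unit_measure (B j) = y - 0"
      by (rule unit_measure_interval[OF order.refl y(1) y(2) B sub])
    then show ?thesis by (simp add: y_def)
  qed
  have "\<P>(\<omega> in noise. (\<forall>j\<le>k. s j < H j \<omega>) \<and> (\<forall>j\<le>k. J j \<omega> = x j)) = \<P>(\<omega> in noise. \<forall>j\<le>k. J j \<omega> = x j \<and> \<omega> (3 * j) \<in> B j)"
    using mem by (intro arg_cong[where f="noise.prob"]) (auto simp: H_def space_noise)
  then show ?thesis unfolding J_box_prob[where x=x and B=B, OF x0 B] J_law[where x=x, OF x0] using mB by simp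
qed

section \<open>How long the two walks agree\<close>

definition matched :: "int set \<Rightarrow> (nat \<times> nat) \<times> int \<Rightarrow> bool" where
  "matched R s \<longleftrightarrow> int (snd (fst s)) = snd s \<and> snd s \<in> R"

text \<open>The path \<open>l\<close> that starts in \<open>s\<close> ceases to be matched before the walk has made \<open>r\<close> further jumps. The
  counter \<open>r\<close> goes down with each jump of the walk, and nothing counts once it is zero.\<close>
primrec breaks :: "int set \<Rightarrow> nat \<Rightarrow> (nat \<times> nat) \<times> int \<Rightarrow> ((nat \<times> nat) \<times> int) list \<Rightarrow> bool" where
  "breaks R r s [] \<longleftrightarrow> False"
| "breaks R r s (x # l) \<longleftrightarrow> r > 0 \<and> (\<not> matched R x \<or> breaks R (if snd x = snd s then r else r - 1) x l)"

lemma breaks_0 [simp]: "\<not> breaks R 0 s l" by (cases l) simp_all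

lemma breaks_append: "breaks R r s l \<Longrightarrow> breaks R r s (l @ l')"
  by (induction l arbitrary: r s) auto

text \<open>Per tick the risk is at most \<open>leave e * \<delta>\<close>, and \<open>leave e\<close> is also the probability that the
  counter goes down. So \<open>r * \<delta>\<close> is a supermartingale that pays for the risk, however many
  ticks the jumps take.\<close>
lemma prob_breaks:
  assumes \<delta>: "\<delta> \<ge> 0" and step: "\<And>e. e \<in> R \<Longrightarrow> measure_pmf.prob (joint_law (nat e) e) {z. \<not> matched R z} \<le> leave e * \<delta>"
    and s: "matched R s"
  shows "measure_pmf.prob (path_pmf K i s) {l. breaks R r s l} \<le> real r * \<delta>"
  using s
proof (induction i arbitrary: r s)
  case 0 then show ?case using \<delta> by simp
next
  case (Suc i)
  define e where "e = snd s"
  have s: "e \<in> R" "snd (fst s) = nat e" using Suc.prems by (auto simp: matched_def e_def)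
  have K: "K s = joint_law (nat e) e" by (simp add: K_def s e_def)
  show ?case
  proof (cases "r = 0")
    case False
    let ?M = "{z. \<not> matched R z}" and ?L = "{z :: (nat \<times> nat) \<times> int. snd z \<noteq> e}"
    \<comment> \<open>An unmatched next state costs at most 1; otherwise the induction hypothesis applies with a
      counter that has gone down if the walk has jumped.\<close>
    have bound: "measure_pmf.prob (path_pmf K i x) {l. breaks R r s (x # l)} \<le> indicator ?M x + (real r * \<delta> - \<delta> * indicator ?L x)" for x
    proof (cases "matched R x")
      case True
      have "measure_pmf.prob (path_pmf K i x) {l. breaks R r s (x # l)} = 
         measure_pmf.prob (path_pmf K i x) {l. breaks R (if snd x = e then r else r - 1) x l}"
        using True False by (simp add: e_def)
      also have "\<dots> \<le> real (if snd x = e then r else r - 1) * \<delta>" by (rule Suc.IH[OF True])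
      also have "\<dots> = real r * \<delta> - \<delta> * indicator ?L x" using False by (simp add: of_nat_diff algebra_simps)
      finally show ?thesis using True by simp
    next
      case F: False
      have "measure_pmf.prob (path_pmf K i x) {l. breaks R r s (x # l)} \<le> 1" by simp
      moreover have "real r * \<delta> - \<delta> * indicator ?L x \<ge> 0"
        using mult_right_mono[of 1 "real r" \<delta>] False \<delta> by (auto simp: indicator_def)
      moreover have "indicator ?M x = (1 :: real)" using F by simp
      ultimately show ?thesis by linarith
    qed
    have int: "integrable (measure_pmf (K s)) (\<lambda>x. indicator B x :: real)" for B
      by (intro measure_pmf.integrable_const_bound[where B=1]) auto
    have "measure_pmf.prob (path_pmf K (Suc i) s) {l. breaks R r s l}
        \<le> (\<integral>x. indicator ?M x + (real r * \<delta> - \<delta> * indicator ?L x) \<partial>measure_pmf (K s))"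
      unfolding prob_path_pmf_Suc mem_Collect_eq
    proof (rule integral_mono[OF _ _ bound])
      show "integrable (measure_pmf (K s)) (\<lambda>x. measure_pmf.prob (path_pmf K i x) {l. breaks R r s (x # l)})"
        by (intro measure_pmf.integrable_const_bound[where B=1]) auto
      show "integrable (measure_pmf (K s)) (\<lambda>x. indicator ?M x + (real r * \<delta> - \<delta> * indicator ?L x))"
        by (intro Bochner_Integration.integrable_add Bochner_Integration.integrable_diff integrable_mult_right int) simp
    qed
    also have "\<dots> = measure_pmf.prob (K s) ?M + (real r * \<delta> - \<delta> * measure_pmf.prob (K s) ?L)"
      using int by (simp add: Bochner_Integration.integral_add Bochner_Integration.integral_diff)
    also have "measure_pmf.prob (K s) ?L = leave e"
    proof -
      have "measure_pmf.prob (K s) ?L = measure_pmf.prob (map_pmf snd (K s)) {y. y \<noteq> e}" by (simp add: vimage_def)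
      also have "\<dots> = 1 - measure_pmf.prob (tick_law e) {e}"
        unfolding K joint_law using measure_pmf.prob_compl[of "{e}" "tick_law e"] by (simp add: Compl_eq_Diff_UNIV[symmetric] Compl_eq)
      finally show ?thesis by (simp add: measure_pmf_single pmf_tick_law)
    qed
    also have "measure_pmf.prob (K s) ?M + (real r * \<delta> - \<delta> * leave e) \<le> real r * \<delta>"
      using step[OF s(1)] unfolding K by (simp add: mult.commute)
    finally show ?thesis .
  qed simp
qed

lemma prob_ever_breaks:
  assumes \<delta>: "\<delta> \<ge> 0" and step: "\<And>e. e \<in> R \<Longrightarrow> measure_pmf.prob (joint_law (nat e) e) {z. \<not> matched R z} \<le> leave e * \<delta>"
    and d0R: "int d0 \<in> R"
  shows "\<P>(\<omega> in noise. \<exists>i. breaks R m ((0, d0), int d0) (map (\<lambda>i. S i \<omega>) [1..<Suc i])) \<le> real m * \<delta>"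
proof -
  let ?s = "((0, d0), int d0)"
  let ?E = "\<lambda>i. {\<omega> \<in> space noise. breaks R m ?s (map (\<lambda>i. S i \<omega>) [1..<Suc i])}"
  have meas: "?E i \<in> noise.events" for i
  proof -
    have "(\<lambda>\<omega>. map (\<lambda>i. S i \<omega>) [1..<Suc i]) \<in> noise \<rightarrow>\<^sub>M count_space UNIV"
      by (rule measurable_map_list) (rule measurable_S)
    then show ?thesis by (rule measurable_sets_Collect) simp
  qed
  have bound: "noise.prob (?E i) \<le> real m * \<delta>" for i
    using noise.prob_path[OF S_has_kernel, of i "{l. breaks R m ?s l}"]
      prob_breaks[OF \<delta> step, of ?s i m] d0R by (simp add: matched_def)
  have "incseq ?E"
  proof (rule incseq_SucI, clarify)
    fix i \<omega> assume "breaks R m ?s (map (\<lambda>i. S i \<omega>) [1..<Suc i])"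
    moreover have "[1..<Suc (Suc i)] = [1..<Suc i] @ [Suc i]" by simp
    ultimately show "breaks R m ?s (map (\<lambda>i. S i \<omega>) [1..<Suc (Suc i)])"
      by (simp only: map_append breaks_append)
  qed
  then have "(\<lambda>i. noise.prob (?E i)) \<longlonglongrightarrow> noise.prob (\<Union>i. ?E i)"
    using meas by (intro noise.finite_Lim_measure_incseq) auto
  then have "noise.prob (\<Union>i. ?E i) \<le> real m * \<delta>" using bound by (intro LIMSEQ_le_const2) auto
  moreover have "(\<Union>i. ?E i) = {\<omega> \<in> space noise. \<exists>i. breaks R m ?s (map (\<lambda>i. S i \<omega>) [1..<Suc i])}" by (auto simp del: upt_Suc)
  ultimately show ?thesis by simp
qed

text \<open>The last tick covered is the one at which jump \<open>m\<close> takes place.\<close>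
lemma unbroken_matched:
  assumes nb: "\<And>i. \<not> breaks R m ((0, d0), int d0) (map (\<lambda>i. S i \<omega>) [1..<Suc i])"
    and d0R: "int d0 \<in> R" and i: "i \<le> tick m \<omega>"
  shows "matched R (S i \<omega>)"
proof -
  have S0: "S 0 \<omega> = ((0, d0), int d0)" by (simp add: S_def A_def)
  have "matched R (S i \<omega>) \<and> (\<forall>l. \<not> breaks R (m - stage i \<omega>) (S i \<omega>) (map (\<lambda>i. S i \<omega>) [Suc i..<Suc i + l]))"
    using i
  proof (induction i)
    case 0
    have "\<not> breaks R m (S 0 \<omega>) (map (\<lambda>i. S i \<omega>) [Suc 0..<Suc 0 + l])" for l
      using nb[of l] unfolding S0 by (simp del: upt_Suc)
    then show ?case using d0R S0 by (simp add: matched_def)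
  next
    case (Suc i)
    then have IH: "\<And>l. \<not> breaks R (m - stage i \<omega>) (S i \<omega>) (map (\<lambda>i. S i \<omega>) [Suc i..<Suc i + l])" by simp
    have "stage i \<omega> < m"
    proof (rule ccontr)
      assume "\<not> stage i \<omega> < m"
      then show False using tick_mono[of m "stage i \<omega>" \<omega>] stage_bounds(1)[of i \<omega>] Suc.prems by simp
    qed
    have up: "[Suc i..<Suc i + Suc l] = Suc i # [Suc (Suc i)..<Suc (Suc i) + l]" for l
      by (simp add: upt_conv_Cons del: upt_Suc)
    \<comment> \<open>Unfold one tick of \<open>breaks\<close>; the counter is still positive because jump \<open>m\<close> is yet to come.\<close>
    have nx: "\<not> (\<not> matched R (S (Suc i) \<omega>) \<or> breaks R (if snd (S (Suc i) \<omega>) = snd (S i \<omega>) then m - stage i \<omega> else m - stage i \<omega> - 1)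
        (S (Suc i) \<omega>) (map (\<lambda>i. S i \<omega>) [Suc (Suc i)..<Suc (Suc i) + l]))" for l
      using IH[of "Suc l"] \<open>stage i \<omega> < m\<close> unfolding up list.map(2) breaks.simps(2) by simp
    have "(if snd (S (Suc i) \<omega>) = snd (S i \<omega>) then m - stage i \<omega> else m - stage i \<omega> - 1) = m - stage (Suc i) \<omega>"
      using A_Suc_eq_iff[of i \<omega>] stage_Suc[of i \<omega>] by (auto simp: S_def split: if_splits)
    then show ?case using nx by simp
  qed
  then show ?thesis by simp
qed

section \<open>The continuous-time process\<close>

text \<open>After an explosion the path is frozen at the starting point. This has probability zero and keeps
  every path right-continuous.\<close>
definition Z :: "real \<Rightarrow> (nat \<Rightarrow> real) \<Rightarrow> real" where
  "Z t \<omega> = walk_pos n (if \<exists>k. t < T (Suc k) \<omega> then J (LEAST k. t < T (Suc k) \<omega>) \<omega> else int d0)"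

lemma inj_walk_pos: "inj (walk_pos n)" by (auto simp: walk_pos_def inj_def)

lemma T_mono: "\<omega> \<in> space noise \<Longrightarrow> k \<le> l \<Longrightarrow> T k \<omega> \<le> T l \<omega>"
  by (rule lift_Suc_mono_le[of "\<lambda>k. T k \<omega>"]) (simp_all add: T_Suc H_pos less_imp_le)

lemma Z_eq:
  assumes "\<omega> \<in> space noise" "T k \<omega> \<le> t" "t < T (Suc k) \<omega>"
  shows "Z t \<omega> = walk_pos n (J k \<omega>)"
proof -
  have "(LEAST k. t < T (Suc k) \<omega>) = k"
  proof (rule Least_equality)
    fix l assume "t < T (Suc l) \<omega>"
    then show "k \<le> l" using T_mono[OF assms(1), of "Suc l" k] assms(2) by (meson Suc_leI leD le_less_trans not_le_imp_less)
  qed (rule assms(3))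
  then show ?thesis using assms(3) unfolding Z_def by auto
qed

lemma jump_Z:
  assumes "\<omega> \<in> space noise"
  shows "jump_time (\<lambda>t. Z t \<omega>) k = ereal (T k \<omega>)" "jump_value (\<lambda>t. Z t \<omega>) k = walk_pos n (J k \<omega>)"
proof -
  have Tl: "T k \<omega> < T (Suc k) \<omega>" for k using H_pos[OF assms] by (simp add: T_Suc)
  have ne: "walk_pos n (J (Suc k) \<omega>) \<noteq> walk_pos n (J k \<omega>)" for k using J_Suc_neq inj_walk_pos by (simp add: inj_eq del: J.simps)
  have last: "Z (T k \<omega>) \<omega> = walk_pos n (J k \<omega>)" by (rule Z_eq[OF assms order.refl Tl])
  show "jump_time (\<lambda>t. Z t \<omega>) k = ereal (T k \<omega>)"
    by (rule jump_time_step(1)[where \<tau>="\<lambda>k. T k \<omega>" and J="\<lambda>k. walk_pos n (J k \<omega>)" and K=k and k=k and f="\<lambda>t. Z t \<omega>",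
        OF T_0 Tl Z_eq[OF assms] last ne order.refl])
  show "jump_value (\<lambda>t. Z t \<omega>) k = walk_pos n (J k \<omega>)"
    by (rule jump_time_step(2)[where \<tau>="\<lambda>k. T k \<omega>" and J="\<lambda>k. walk_pos n (J k \<omega>)" and K=k and k=k and f="\<lambda>t. Z t \<omega>",
        OF T_0 Tl Z_eq[OF assms] last ne order.refl])
qed

lemma measurable_Z: "Z t \<in> noise \<rightarrow>\<^sub>M count_space UNIV"
proof -
  have "(\<lambda>\<omega>. if \<exists>k. t < T (Suc k) \<omega> then J (LEAST k. t < T (Suc k) \<omega>) \<omega> else int d0) \<in> noise \<rightarrow>\<^sub>M count_space UNIV"
    by (intro measurable_If measurable_compose_countable[OF measurable_J]) measurable
  then show ?thesis unfolding Z_def by (rule measurable_compose) simp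
qed

lemma Z_right_const:
  assumes \<omega>: "\<omega> \<in> space noise" and t: "t \<ge> 0"
  shows "\<forall>\<^sub>F s in at_right t. Z s \<omega> = Z t \<omega>"
proof (cases "\<exists>k. t < T (Suc k) \<omega>")
  case True
  define k where "k = (LEAST k. t < T (Suc k) \<omega>)"
  have k: "t < T (Suc k) \<omega>" unfolding k_def using True by (rule LeastI_ex)
  have "T k \<omega> \<le> t"
  proof (cases k)
    case 0 then show ?thesis using t by simp
  next
    case (Suc l)
    then have "\<not> t < T (Suc l) \<omega>" unfolding k_def by (metis lessI not_less_Least)
    then show ?thesis using Suc by simp
  qed
  then have same: "Z s \<omega> = Z t \<omega>" if "t \<le> s" "s < T (Suc k) \<omega>" for s
    using Z_eq[OF \<omega>, of k] that k by simp
  show ?thesis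
  proof (rule eventually_at_rightI[OF _ k])
    fix s assume "s \<in> {t<..<T (Suc k) \<omega>}"
    then show "Z s \<omega> = Z t \<omega>" by (intro same) auto
  qed
next
  case False
  then have "Z s \<omega> = Z t \<omega>" if "t < s" for s
  proof -
    have "\<not> (\<exists>k. s < T (Suc k) \<omega>)" using False that by (meson less_trans)
    then show ?thesis using False unfolding Z_def by simp
  qed
  then show ?thesis by (intro eventually_at_rightI[of t "t + 1"]) simp_all
qed

section \<open>Time spent at the two central sites\<close>

text \<open>The flag at index \<open>j\<close> says that stage \<open>j - 1\<close> had a holding time of at least its median.\<close>
definition flagged :: "nat \<Rightarrow> (nat \<Rightarrow> real) \<Rightarrow> int \<times> bool" where
  "flagged j \<omega> = (J j \<omega>, j > 0 \<and> \<omega> (3 * (j - 1)) \<le> 1/2)"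

definition flag_kernel :: "int \<times> bool \<Rightarrow> (int \<times> bool) pmf" where
  "flag_kernel s = map_pmf (\<lambda>(b, f). (if b then fst s + 1 else fst s - 1, f))
     (pair_pmf (bernoulli_pmf (up (fst s))) (bernoulli_pmf (1/2)))"

lemma pmf_flag_kernel: "pmf (flag_kernel s) (e', f) = dir_prob (fst s) e' / 2"
proof -
  let ?g = "\<lambda>(b, f). (if b then fst s + 1 else fst s - 1, f :: bool)"
  have inj: "inj ?g" by (auto simp: inj_def split: if_splits)
  show ?thesis
  proof (cases "e' = fst s + 1 \<or> e' = fst s - 1")
    case True
    define b where "b \<longleftrightarrow> e' = fst s + 1"
    have "(e', f) = ?g (b, f)" using True by (auto simp: b_def)
    then have "pmf (flag_kernel s) (e', f) = pmf (pair_pmf (bernoulli_pmf (up (fst s))) (bernoulli_pmf (1/2))) (b, f)"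
      unfolding flag_kernel_def using pmf_map_inj'[OF inj] by metis
    then show ?thesis using True up[of "fst s"] by (cases b; cases f) (auto simp: pmf_pair dir_prob_def b_def)
  next
    case False
    then have "(e', f) \<notin> set_pmf (flag_kernel s)" unfolding flag_kernel_def by (auto split: if_splits)
    then show ?thesis using False by (simp add: pmf_eq_0_set_pmf dir_prob_def)
  qed
qed

lemma measurable_flagged: "flagged j \<in> noise \<rightarrow>\<^sub>M count_space UNIV"
  unfolding flagged_def
proof (rule measurable_compose_countable[OF _ measurable_J, where f="\<lambda>e \<omega>. (e, j > 0 \<and> \<omega> (3 * (j - 1)) \<le> 1/2)"])
  fix e
  have "(\<lambda>\<omega>. j > 0 \<and> \<omega> (3 * (j - 1)) \<le> 1/2) \<in> noise \<rightarrow>\<^sub>M count_space UNIV" by measurable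
  then show "(\<lambda>\<omega>. (e, j > 0 \<and> \<omega> (3 * (j - 1)) \<le> 1/2)) \<in> noise \<rightarrow>\<^sub>M count_space UNIV"
    by (rule measurable_compose) simp
qed

lemma flagged_has_kernel: "has_kernel noise flag_kernel (int d0, False) flagged"
  unfolding has_kernel_def
proof (intro conjI allI impI ballI measurable_flagged)
  fix k and \<sigma> :: "nat \<Rightarrow> int \<times> bool" assume \<sigma>: "\<sigma> 0 = (int d0, False)"
  define B where "B j = (if j < k then if snd (\<sigma> (Suc j)) then {0<..1/2} else {1/2<..<1} else {0<..<1 :: real})" for j
  have B: "B j \<in> sets unit_measure" for j by (auto simp: B_def sets_unit_measure)
  have mB: "measure unit_measure (B j) = (if j < k then 1/2 else 1)" for j
  proof -
    have "measure unit_measure {0<..1/2} = 1/2 - 0" "measure unit_measure {1/2<..<1} = 1 - 1/2"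
      by (rule unit_measure_interval; auto simp: sets_unit_measure)+
    then show ?thesis using unit.prob_space by (simp add: B_def)
  qed
  have "(\<forall>j\<le>k. flagged j \<omega> = \<sigma> j) \<longleftrightarrow> (\<forall>j\<le>k. J j \<omega> = fst (\<sigma> j) \<and> \<omega> (3 * j) \<in> B j)" if "\<omega> \<in> space noise" for \<omega>
  proof -
    have r: "0 < \<omega> i" "\<omega> i < 1" for i using that by (auto simp: space_noise)
    have "(\<forall>j\<le>k. flagged j \<omega> = \<sigma> j) \<longleftrightarrow> (\<forall>j\<le>k. J j \<omega> = fst (\<sigma> j)) \<and> (\<forall>j\<le>k. (j > 0 \<and> \<omega> (3 * (j - 1)) \<le> 1/2) = snd (\<sigma> j))"
      by (auto simp: flagged_def prod_eq_iff)
    also have "(\<forall>j\<le>k. (j > 0 \<and> \<omega> (3 * (j - 1)) \<le> 1/2) = snd (\<sigma> j)) \<longleftrightarrow> (\<forall>j<k. (\<omega> (3 * j) \<le> 1/2) = snd (\<sigma> (Suc j)))" (is "?L \<longleftrightarrow> ?R")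
    proof
      assume L: ?L
      show ?R
      proof (intro allI impI)
        fix j assume "j < k"
        then show "(\<omega> (3 * j) \<le> 1/2) = snd (\<sigma> (Suc j))" using L[rule_format, of "Suc j"] by simp
      qed
    next
      assume R: ?R
      show ?L
      proof (intro allI impI)
        fix j assume "j \<le> k"
        then show "(j > 0 \<and> \<omega> (3 * (j - 1)) \<le> 1/2) = snd (\<sigma> j)" using R \<sigma> by (cases j) auto
      qed
    qed
    also have "\<dots> \<longleftrightarrow> (\<forall>j\<le>k. \<omega> (3 * j) \<in> B j)" using r by (auto simp: B_def not_le)
    finally show ?thesis by auto
  qed
  then have "\<P>(\<omega> in noise. \<forall>j\<le>k. flagged j \<omega> = \<sigma> j) = \<P>(\<omega> in noise. \<forall>j\<le>k. J j \<omega> = fst (\<sigma> j) \<and> \<omega> (3 * j) \<in> B j)"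
    by (intro arg_cong[where f="noise.prob"]) auto
  also have "\<dots> = (\<Prod>j<k. dir_prob (fst (\<sigma> j)) (fst (\<sigma> (Suc j)))) * (\<Prod>j\<le>k. measure unit_measure (B j))"
    using \<sigma> by (intro J_box_prob B) simp
  also have "(\<Prod>j\<le>k. measure unit_measure (B j)) = (\<Prod>j<k. 1/2)"
    unfolding mB by (simp flip: lessThan_Suc_atMost)
  also have "(\<Prod>j<k. dir_prob (fst (\<sigma> j)) (fst (\<sigma> (Suc j)))) * (\<Prod>j<k. 1/2) = (\<Prod>j<k. pmf (flag_kernel (\<sigma> j)) (\<sigma> (Suc j)))"
  proof -
    have "pmf (flag_kernel (\<sigma> j)) (\<sigma> (Suc j)) = dir_prob (fst (\<sigma> j)) (fst (\<sigma> (Suc j))) * (1/2)" for j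
      using pmf_flag_kernel[of "\<sigma> j" "fst (\<sigma> (Suc j))" "snd (\<sigma> (Suc j))"] by simp
    then show ?thesis by (simp only: prod.distrib)
  qed
  finally show "\<P>(\<omega> in noise. \<forall>j\<le>k. flagged j \<omega> = \<sigma> j) = (\<Prod>j<k. pmf (flag_kernel (\<sigma> j)) (\<sigma> (Suc j)))" .
qed (auto simp: flagged_def)

primrec slow_count :: "int set \<Rightarrow> int \<Rightarrow> (int \<times> bool) list \<Rightarrow> nat" where
  "slow_count C e [] = 0"
| "slow_count C e (x # l) = (if e \<in> C \<and> snd x then 1 else 0) + slow_count C (fst x) l"

text \<open>The growth by a third on \<open>C\<close> is made up for by long holding times: half of the visits are
  flagged, and if a flagged visit counts with the factor \<open>1/4\<close>, the average factor on \<open>C\<close> is at most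
  \<open>(1/2 + 1/8) * 4/3 = 5/6\<close> as well.\<close>
definition drift_potential :: "(int \<Rightarrow> real) \<Rightarrow> int set \<Rightarrow> bool" where
  "drift_potential V C \<longleftrightarrow> (\<forall>e. 1 \<le> V e) \<and>
     (\<forall>e\<in>C. up e * V (e + 1) + (1 - up e) * V (e - 1) \<le> 4/3 * V e) \<and>
     (\<forall>e\<in>- C. up e * V (e + 1) + (1 - up e) * V (e - 1) \<le> 5/6 * V e)"

text \<open>A Chernoff bound for the number of flagged visits to \<open>C\<close>: \<open>4 ^ L * V\<close> is contracted by \<open>5/6\<close> in
  every stage if \<open>L\<close> is decreased at each flagged visit.\<close>
lemma prob_slow_count:
  assumes V: "drift_potential V C"
  shows "measure_pmf.prob (path_pmf flag_kernel m s) {l. slow_count C (fst s) l \<le> L} \<le> (5/6) ^ m * 4 ^ L * V (fst s)"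
proof -
  have V0: "V e \<ge> 1" for e using V by (simp add: drift_potential_def)
  have V1: "up e * V (e + 1) + (1 - up e) * V (e - 1) \<le> 4/3 * V e" if "e \<in> C" for e
    using V that by (simp add: drift_potential_def)
  have V2: "up e * V (e + 1) + (1 - up e) * V (e - 1) \<le> 5/6 * V e" if "e \<notin> C" for e
    using V that by (simp add: drift_potential_def)
  show ?thesis
  proof (induction m arbitrary: s L)
    case 0
    have "1 * 1 \<le> 4 ^ L * V (fst s)" using V0 by (intro mult_mono) auto
    then show ?case by (auto simp: indicator_def)
  next
    case (Suc m)
    define e where "e = fst s"
    define c :: real where "c = (5/6) ^ m * 4 ^ L"
    define g :: "bool \<Rightarrow> real" where "g f = (if e \<in> C \<and> f then 1/4 else 1)" for f
    define F where "F x = measure_pmf.prob (path_pmf flag_kernel m x) {l. slow_count C e (x # l) \<le> L}" for x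
    have c0: "c \<ge> 0" by (simp add: c_def)
    have F: "F (e', f) \<le> c * V e' * g f" for e' f
    proof (cases "e \<in> C \<and> f")
      case True
      show ?thesis
      proof (cases L)
        case 0
        then have "F (e', f) = 0" using True by (simp add: F_def)
        then show ?thesis using c0 V0[of e'] by (simp add: g_def)
      next
        case (Suc L')
        have "F (e', f) \<le> (5/6) ^ m * 4 ^ L' * V e'"
          using Suc.IH[of "(e', f)" L'] True Suc by (simp add: F_def)
        then show ?thesis using True Suc by (simp add: g_def c_def)
      qed
    next
      case False
      then show ?thesis using Suc.IH[of "(e', f)" L] by (auto simp: F_def g_def c_def)
    qed
    let ?A = "{(e + 1, True), (e + 1, False), (e - 1, True), (e - 1, False)}"
    have supp: "set_pmf (flag_kernel s) \<subseteq> ?A"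
      by (auto simp: flag_kernel_def e_def split: if_splits)
    have "measure_pmf.prob (path_pmf flag_kernel (Suc m) s) {l. slow_count C e l \<le> L} = (\<integral>x. F x \<partial>measure_pmf (flag_kernel s))"
      unfolding prob_path_pmf_Suc F_def by simp
    also have "\<dots> = (\<Sum>x\<in>?A. F x * pmf (flag_kernel s) x)"
      using supp by (intro integral_measure_pmf_real) auto
    also have "\<dots> = up e / 2 * F (e + 1, True) + up e / 2 * F (e + 1, False) + (1 - up e) / 2 * F (e - 1, True) + (1 - up e) / 2 * F (e - 1, False)"
      by (simp add: pmf_flag_kernel e_def[symmetric] dir_prob_def mult_ac)
    also have "\<dots> \<le> up e / 2 * (c * V (e + 1) * g True) + up e / 2 * (c * V (e + 1) * g False)
         + (1 - up e) / 2 * (c * V (e - 1) * g True) + (1 - up e) / 2 * (c * V (e - 1) * g False)"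
      using up[of e] by (intro add_mono mult_left_mono F) auto
    also have "\<dots> = c * ((g True + g False) / 2) * (up e * V (e + 1) + (1 - up e) * V (e - 1))"
      by (simp add: field_simps)
    also have "\<dots> \<le> c * (5/6 * V e)"
    proof (cases "e \<in> C")
      case True
      have "c * ((g True + g False) / 2) * (up e * V (e + 1) + (1 - up e) * V (e - 1)) \<le> c * ((g True + g False) / 2) * (4/3 * V e)"
        using c0 V1[OF True] by (intro mult_left_mono) (auto simp: g_def)
      then show ?thesis using True by (simp add: g_def)
    next
      case False
      then show ?thesis using mult_left_mono[OF V2[OF False] c0] by (simp add: g_def)
    qed
    finally show ?case by (simp add: e_def c_def)
  qed
qed

text \<open>A flag records that a holding time exceeds its median \<open>ln 2 / rate e\<close>.\<close>
lemma T_ge_slow_count: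
  assumes \<omega>: "\<omega> \<in> space noise" and \<rho>: "\<And>e. e \<in> C \<Longrightarrow> rate e \<le> \<rho>"
  shows "ln 2 / \<rho> * slow_count C (J i \<omega>) (map (\<lambda>j. flagged j \<omega>) [Suc i..<Suc i + m]) \<le> T (i + m) \<omega> - T i \<omega>"
proof (induction m arbitrary: i)
  case (Suc m)
  let ?c = "if J i \<omega> \<in> C \<and> snd (flagged (Suc i) \<omega>) then 1 else 0 :: real"
  let ?s = "slow_count C (J (Suc i) \<omega>) (map (\<lambda>j. flagged j \<omega>) [Suc (Suc i)..<Suc (Suc i) + m])"
  have up: "[Suc i..<Suc i + Suc m] = Suc i # [Suc (Suc i)..<Suc (Suc i) + m]" by (simp add: upt_conv_Cons del: upt_Suc)
  have first: "ln 2 / \<rho> * ?c \<le> H i \<omega>"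
  proof (cases "J i \<omega> \<in> C \<and> snd (flagged (Suc i) \<omega>)")
    case True
    then have u: "\<omega> (3 * i) \<le> 1/2" "rate (J i \<omega>) \<le> \<rho>" using \<rho> by (auto simp: flagged_def)
    have u0: "\<omega> (3 * i) > 0" using \<omega> by (auto simp: space_noise)
    then have "ln (\<omega> (3 * i)) \<le> ln (1/2)" using u by (subst ln_le_cancel_iff) auto
    then have "ln 2 \<le> - ln (\<omega> (3 * i))" by (simp add: ln_div)
    then have "ln 2 / \<rho> \<le> - ln (\<omega> (3 * i)) / rate (J i \<omega>)"
      using u rate_pos[of "J i \<omega>"] ln_gt_zero[of "2::real"] by (intro frac_le) linarith+
    then show ?thesis using True by (simp add: H_def)
  next
    case False
    then show ?thesis using H_pos[OF \<omega>, of i] by auto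
  qed
  have "fst (flagged (Suc i) \<omega>) = J (Suc i) \<omega>" by (simp add: flagged_def)
  then have "real (slow_count C (J i \<omega>) (map (\<lambda>j. flagged j \<omega>) [Suc i..<Suc i + Suc m])) = ?c + real ?s"
    unfolding up list.map(2) slow_count.simps(2) by simp
  then have "ln 2 / \<rho> * real (slow_count C (J i \<omega>) (map (\<lambda>j. flagged j \<omega>) [Suc i..<Suc i + Suc m]))
      = ln 2 / \<rho> * ?c + ln 2 / \<rho> * real ?s" by (simp only: distrib_left)
  also have "\<dots> \<le> H i \<omega> + (T (Suc i + m) \<omega> - T (Suc i) \<omega>)" by (rule add_mono[OF first Suc])
  also have "\<dots> = T (i + Suc m) \<omega> - T i \<omega>" by (simp add: T_Suc)
  finally show ?case .
qed simp

lemma prob_T_less: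
  assumes V: "drift_potential V C"
    and \<rho>: "\<And>e. e \<in> C \<Longrightarrow> rate e \<le> \<rho>" and \<rho>0: "\<rho> > 0" and t: "t \<ge> 0"
  shows "\<P>(\<omega> in noise. T m \<omega> < t) \<le> (5/6) ^ m * 4 powr (\<rho> * t / ln 2) * V (int d0)"
proof -
  define L where "L = nat \<lfloor>\<rho> * t / ln 2\<rfloor>"
  let ?l = "\<lambda>\<omega>. map (\<lambda>j. flagged j \<omega>) [1..<Suc m]"
  have mM: "?l \<in> noise \<rightarrow>\<^sub>M count_space UNIV" by (rule measurable_map_list[OF measurable_flagged])
  have "\<P>(\<omega> in noise. T m \<omega> < t) \<le> \<P>(\<omega> in noise. ?l \<omega> \<in> {l. slow_count C (int d0) l \<le> L})"
  proof (rule noise.finite_measure_mono)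
    show "{\<omega> \<in> space noise. ?l \<omega> \<in> {l. slow_count C (int d0) l \<le> L}} \<in> noise.events"
      by (rule measurable_sets_Collect[OF mM]) simp
    show "{\<omega> \<in> space noise. T m \<omega> < t} \<subseteq> {\<omega> \<in> space noise. ?l \<omega> \<in> {l. slow_count C (int d0) l \<le> L}}"
    proof clarify
      fix \<omega> assume \<omega>: "\<omega> \<in> space noise" and less: "T m \<omega> < t"
      have "ln 2 / \<rho> * slow_count C (int d0) (?l \<omega>) \<le> T m \<omega>"
        using T_ge_slow_count[OF \<omega> \<rho>, of C 0 m] by (simp del: upt_Suc)
      then have "real (slow_count C (int d0) (?l \<omega>)) \<le> \<rho> * t / ln 2"
      proof -
        have "\<rho> * T m \<omega> \<le> \<rho> * t" using less \<rho>0 by simp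
        moreover have "ln 2 * slow_count C (int d0) (?l \<omega>) \<le> \<rho> * T m \<omega>"
          using \<open>ln 2 / \<rho> * _ \<le> _\<close> \<rho>0 by (simp add: field_simps del: upt_Suc)
        ultimately show ?thesis by (simp add: field_simps del: upt_Suc)
      qed
      then show "slow_count C (int d0) (?l \<omega>) \<le> L" unfolding L_def by (simp add: le_nat_iff le_floor_iff del: upt_Suc)
    qed
  qed
  also have "\<dots> \<le> (5/6) ^ m * 4 ^ L * V (int d0)"
    unfolding noise.prob_path[OF flagged_has_kernel]
    using prob_slow_count[OF V, of m "(int d0, False)" L] by simp
  also have "\<dots> \<le> (5/6) ^ m * 4 powr (\<rho> * t / ln 2) * V (int d0)"
  proof -
    have "(4::real) ^ L = 4 powr (real L)" by (simp add: powr_realpow)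
    also have "\<dots> \<le> 4 powr (\<rho> * t / ln 2)"
      using \<rho>0 t unfolding L_def by (intro powr_mono) auto
    moreover have "0 \<le> V (int d0)"
      using V unfolding drift_potential_def by (meson order.trans zero_le_one)
    ultimately show ?thesis by (intro mult_right_mono mult_left_mono) auto
  qed
  finally show ?thesis .
qed

lemma AE_T_at_top:
  assumes V: "drift_potential V C"
    and \<rho>: "\<And>e. e \<in> C \<Longrightarrow> rate e \<le> \<rho>" and \<rho>0: "\<rho> > 0"
  shows "AE \<omega> in noise. filterlim (\<lambda>k. T k \<omega>) at_top sequentially"
proof -
  have "AE \<omega> in noise. \<exists>m. real j \<le> T m \<omega>" for j :: nat
  proof -
    let ?E = "{\<omega> \<in> space noise. \<forall>m. T m \<omega> < real j}"
    let ?b = "\<lambda>m. (5/6) ^ m * 4 powr (\<rho> * real j / ln 2) * V (int d0)"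
    have "noise.prob ?E \<le> ?b m" for m
    proof -
      have "noise.prob ?E \<le> \<P>(\<omega> in noise. T m \<omega> < real j)"
        by (rule noise.finite_measure_mono) auto
      also have "\<dots> \<le> ?b m" using prob_T_less[of V C \<rho> "real j" m] assms by simp
      finally show ?thesis .
    qed
    moreover have "?b \<longlonglongrightarrow> 0 * 4 powr (\<rho> * real j / ln 2) * V (int d0)"
      by (intro tendsto_mult tendsto_const LIMSEQ_power_zero) simp
    ultimately have "noise.prob ?E \<le> 0" by (intro LIMSEQ_le_const) auto
    then have "noise.prob ?E = 0" by (simp add: measure_le_0_iff)
    then have "AE \<omega> in noise. \<not> (\<forall>m. T m \<omega> < real j)"
      by (intro AE_I'[of ?E]) (auto simp: null_sets_def noise.emeasure_eq_measure)
    then show ?thesis by (auto simp: not_less)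
  qed
  then have "AE \<omega> in noise. \<forall>j::nat. \<exists>m. real j \<le> T m \<omega>" by (simp add: AE_all_countable)
  then show ?thesis
  proof (rule AE_mp, intro AE_I2 impI)
    fix \<omega> assume \<omega>: "\<omega> \<in> space noise" and ex: "\<forall>j::nat. \<exists>m. real j \<le> T m \<omega>"
    show "filterlim (\<lambda>k. T k \<omega>) at_top sequentially"
      unfolding filterlim_at_top eventually_sequentially
    proof
      fix x :: real
      obtain m where "real (nat \<lceil>x\<rceil>) \<le> T m \<omega>" using ex by blast
      then have "x \<le> T m \<omega>" by linarith
      then show "\<exists>N. \<forall>k\<ge>N. x \<le> T k \<omega>" using T_mono[OF \<omega>, of m] by (meson order.trans)
    qed
  qed
qed

section \<open>Comparison of the two clocks\<close>

lemma prob_H_large: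
  assumes \<rho>: "\<And>e. \<rho> \<le> rate e" "\<rho> > 0" and s: "s \<ge> 0"
  shows "\<P>(\<omega> in noise. \<exists>l<m. s < H l \<omega>) \<le> real m * exp (- \<rho> * s)"
proof -
  let ?E = "\<lambda>l. {\<omega> \<in> space noise. \<omega> (3 * l) \<in> {0<..<exp (- \<rho> * s)}}"
  have e1: "exp (- \<rho> * s) \<le> 1" using \<rho>(2) s by simp
  have "{0<..<y} \<in> sets unit_measure" if "y \<le> 1" for y :: real
    using that by (auto simp: sets_unit_measure)
  then have B: "{0<..<exp (- \<rho> * s)} \<in> sets unit_measure" using e1 .
  have "measure unit_measure {0<..<exp (- \<rho> * s)} = exp (- \<rho> * s) - 0"
    by (rule unit_measure_interval[OF order.refl exp_ge_zero e1 B order.refl]) (simp add: greaterThanLessThan_subseteq_atLeastAtMost_iff)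
  then have PE: "noise.prob (?E l) = exp (- \<rho> * s)" for l
    using prob_noise_single[OF B, of "3 * l"] by simp
  have E: "?E l \<in> noise.events" for l using depends_on_single[OF B, of "3 * l"] by (simp add: depends_on_def)
  have "\<P>(\<omega> in noise. \<exists>l<m. s < H l \<omega>) \<le> noise.prob (\<Union>l\<in>{..<m}. ?E l)"
  proof (rule noise.finite_measure_mono)
    show "{\<omega> \<in> space noise. \<exists>l<m. s < H l \<omega>} \<subseteq> (\<Union>l\<in>{..<m}. ?E l)"
    proof clarify
      fix \<omega> l assume \<omega>: "\<omega> \<in> space noise" and l: "l < m" "s < H l \<omega>"
      have u: "0 < \<omega> (3 * l)" using \<omega> by (auto simp: space_noise)
      have "s * rate (J l \<omega>) < - ln (\<omega> (3 * l))"
        using l(2) rate_pos[of "J l \<omega>"] by (simp add: H_def field_simps)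
      moreover have "s * \<rho> \<le> s * rate (J l \<omega>)" using \<rho> s by (intro mult_left_mono) auto
      ultimately have "ln (\<omega> (3 * l)) < - \<rho> * s" by (simp add: mult.commute)
      then have "\<omega> (3 * l) < exp (- \<rho> * s)" using u by (metis exp_less_cancel_iff exp_ln)
      then show "\<omega> \<in> (\<Union>l\<in>{..<m}. ?E l)" using \<omega> l u by auto
    qed
  qed (use E in auto)
  also have "\<dots> \<le> (\<Sum>l<m. noise.prob (?E l))"
    using E by (intro noise.finite_measure_subadditive_finite) auto
  finally show ?thesis unfolding PE by simp
qed

text \<open>With \<open>y\<close> the unrounded number of ticks, \<open>y / N\<close> and the holding time are proportional, with a
  factor that \<open>\<epsilon>\<close> keeps close to one, and rounding adds at most one tick.\<close>
lemma hold_ticks_time: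
  assumes \<omega>: "\<omega> \<in> space noise" and N: "N > 0"
    and \<epsilon>: "\<bar>rate (J l \<omega>) / (N * - ln (1 - leave (J l \<omega>))) - 1\<bar> \<le> \<epsilon>"
  shows "\<bar>real (G l \<omega>) / N - H l \<omega>\<bar> \<le> 1 / N + H l \<omega> * \<epsilon>"
proof -
  define e where "e = J l \<omega>"
  define b where "b = - ln (1 - leave e)"
  define y where "y = ln (\<omega> (3 * l)) / ln (1 - leave e)"
  have b0: "b > 0" using leave[of e] by (simp add: b_def)
  have u: "0 < \<omega> (3 * l)" "\<omega> (3 * l) < 1" using \<omega> by (auto simp: space_noise)
  have y0: "y \<ge> 0" unfolding y_def using u leave[of e] by (intro divide_nonpos_nonpos) auto
  have "real (G l \<omega>) = 1 + real_of_int \<lfloor>y\<rfloor>"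
    using y0 by (simp add: G_def hold_ticks_def y_def e_def)
  then have G: "y \<le> real (G l \<omega>)" "real (G l \<omega>) \<le> y + 1" by linarith+
  have H: "H l \<omega> = y * b / rate e" unfolding H_def y_def b_def e_def using leave[of "J l \<omega>"] by simp
  have "y / N = H l \<omega> * (rate e / (N * b))" unfolding H using rate_pos[of e] b0 by simp
  then have "y / N - H l \<omega> = H l \<omega> * (rate e / (N * b) - 1)" by (simp add: algebra_simps)
  then have 1: "\<bar>y / N - H l \<omega>\<bar> \<le> H l \<omega> * \<epsilon>"
    using \<epsilon> H_pos[OF \<omega>, of l] by (simp add: abs_mult e_def b_def)
  have "y / N \<le> real (G l \<omega>) / N" "real (G l \<omega>) / N \<le> y / N + 1 / N"
    using G N by (simp_all add: divide_right_mono add_divide_distrib[symmetric])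
  then show ?thesis using 1 by linarith
qed

lemma tick_time:
  assumes \<omega>: "\<omega> \<in> space noise" and N: "N > 0" and k: "k \<le> m"
    and \<epsilon>: "\<And>l. l < m \<Longrightarrow> \<bar>rate (J l \<omega>) / (N * - ln (1 - leave (J l \<omega>))) - 1\<bar> \<le> \<epsilon>"
    and s: "\<And>l. l < m \<Longrightarrow> H l \<omega> \<le> s" and \<epsilon>0: "\<epsilon> \<ge> 0" and s0: "s \<ge> 0"
  shows "\<bar>real (tick k \<omega>) / N - T k \<omega>\<bar> \<le> real m * (1 / N + s * \<epsilon>)"
proof -
  have "real (tick k \<omega>) / N - T k \<omega> = (\<Sum>l<k. real (G l \<omega>) / N - H l \<omega>)"
    by (simp add: tick_def T_def sum_subtractf sum_divide_distrib)
  also have "\<bar>\<dots>\<bar> \<le> (\<Sum>l<k. \<bar>real (G l \<omega>) / N - H l \<omega>\<bar>)" by (rule sum_abs)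
  also have "\<dots> \<le> (\<Sum>l<k. 1 / N + s * \<epsilon>)"
  proof (rule sum_mono)
    fix l assume "l \<in> {..<k}"
    then have l: "l < m" using k by simp
    have "H l \<omega> * \<epsilon> \<le> s * \<epsilon>" using s[OF l] \<epsilon>0 by (intro mult_right_mono) auto
    then show "\<bar>real (G l \<omega>) / N - H l \<omega>\<bar> \<le> 1 / N + s * \<epsilon>"
      using hold_ticks_time[OF \<omega> N \<epsilon>[OF l]] by linarith
  qed
  also have "\<dots> \<le> real m * (1 / N + s * \<epsilon>)"
    using k N \<epsilon>0 s0 by (simp add: mult_right_mono)
  finally show ?thesis .
qed

lemma jump_Y:
  assumes N: "N > 0" and match: "\<And>i. i \<le> tick m \<omega> \<Longrightarrow> int (snd (D i \<omega>)) = A i \<omega>" and k: "k \<le> m"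
  shows "jump_time (\<lambda>t. real (X (2 * nat \<lfloor>N * t\<rfloor>) \<omega>) - real n / 2) k = ereal (real (tick k \<omega>) / N)"
    "jump_value (\<lambda>t. real (X (2 * nat \<lfloor>N * t\<rfloor>) \<omega>) - real n / 2) k = walk_pos n (J k \<omega>)"
proof -
  let ?f = "\<lambda>t. real (X (2 * nat \<lfloor>N * t\<rfloor>) \<omega>) - real n / 2"
  have Xi: "real (X (2 * i) \<omega>) - real n / 2 = walk_pos n (A i \<omega>)" if "i \<le> tick m \<omega>" for i
  proof -
    have "real (snd (D i \<omega>)) = real_of_int (A i \<omega>)" using match[OF that] by (metis of_int_of_nat_eq)
    then show ?thesis by (simp add: X_def walk_pos_def)
  qed
  have f: "?f t = walk_pos n (J l \<omega>)" if l: "l < m" "real (tick l \<omega>) / N \<le> t" "t < real (tick (Suc l) \<omega>) / N" for l t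
  proof -
    define i where "i = nat \<lfloor>N * t\<rfloor>"
    have "real (tick l \<omega>) \<le> N * t" "N * t < real (tick (Suc l) \<omega>)" using l N by (simp_all add: field_simps)
    then have "tick l \<omega> \<le> i" "i < tick (Suc l) \<omega>" unfolding i_def by linarith+
    moreover have "i \<le> tick m \<omega>" using \<open>i < tick (Suc l) \<omega>\<close> tick_mono[of "Suc l" m \<omega>] l(1) by simp
    ultimately show ?thesis using Xi[of i] stageI[of l \<omega> i] by (simp add: A_def i_def)
  qed
  have last: "?f (real (tick m \<omega>) / N) = walk_pos n (J m \<omega>)" using Xi[of "tick m \<omega>"] N by (simp add: A_def)
  have less: "real (tick l \<omega>) / N < real (tick (Suc l) \<omega>) / N" for l
    using N G_pos[of l \<omega>] by (simp add: tick_Suc divide_strict_right_mono)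
  have ne: "walk_pos n (J (Suc l) \<omega>) \<noteq> walk_pos n (J l \<omega>)" for l using J_Suc_neq inj_walk_pos by (simp add: inj_eq del: J.simps)
  have 0: "real (tick 0 \<omega>) / N = 0" by simp
  show "jump_time ?f k = ereal (real (tick k \<omega>) / N)"
    by (rule jump_time_step(1)[where \<tau>="\<lambda>k. real (tick k \<omega>) / N" and J="\<lambda>k. walk_pos n (J k \<omega>)" and K=m and k=k and f="?f",
        OF 0 less f last ne k])
  show "jump_value ?f k = walk_pos n (J k \<omega>)"
    by (rule jump_time_step(2)[where \<tau>="\<lambda>k. real (tick k \<omega>) / N" and J="\<lambda>k. walk_pos n (J k \<omega>)" and K=m and k=k and f="?f",
        OF 0 less f last ne k])
qed

lemma measurable_jump_Y:
  assumes N: "N > 0"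
  shows "(\<lambda>\<omega>. jump_time (\<lambda>t. real (X (2 * nat \<lfloor>N * t\<rfloor>) \<omega>) - real n / 2) i) \<in> borel_measurable noise"
    "(\<lambda>\<omega>. jump_value (\<lambda>t. real (X (2 * nat \<lfloor>N * t\<rfloor>) \<omega>) - real n / 2) i) \<in> borel_measurable noise"
proof -
  have X2: "X (2 * j) \<in> noise \<rightarrow>\<^sub>M count_space UNIV" for j by (rule measurable_X)
  have "inj (\<lambda>x :: nat. real x - real n / 2)" by (auto simp: inj_def)
  note jt = jump_time_inj[OF this]
  show "(\<lambda>\<omega>. jump_time (\<lambda>t. real (X (2 * nat \<lfloor>N * t\<rfloor>) \<omega>) - real n / 2) i) \<in> borel_measurable noise"
    unfolding jt using measurable_jump_grid(1)[OF N, of "\<lambda>j. X (2 * j)" noise i] X2 by simp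
  have "(\<lambda>\<omega>. real (jump_value (\<lambda>t. X (2 * nat \<lfloor>N * t\<rfloor>) \<omega>) i) - real n / 2) \<in> borel_measurable noise"
    by (rule measurable_compose[OF measurable_jump_grid(2)[OF N, of "\<lambda>j. X (2 * j)" noise i]]) (use X2 in auto)
  then show "(\<lambda>\<omega>. jump_value (\<lambda>t. real (X (2 * nat \<lfloor>N * t\<rfloor>) \<omega>) - real n / 2) i) \<in> borel_measurable noise"
    by (simp add: jump_value_def jt)
qed

section \<open>The coupling for general rates\<close>

lemma X_markov:
  assumes "\<And>d r. d \<le> n \<Longrightarrow> r \<le> n \<Longrightarrow> pmf (P d) r = p d r"
  shows "markov_chain noise {0..n} p d0 X"
proof (rule markov_chainI)
  show "prob_space noise" by unfold_locales
  show "X i \<in> noise \<rightarrow>\<^sub>M count_space {0..n}" for i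
  proof -
    have "X i -` {x} \<inter> space noise \<in> sets noise" for x
      by (rule measurable_sets[OF measurable_X]) simp
    moreover have "X i \<in> space noise \<rightarrow> {0..n}" using X_le by auto
    ultimately show ?thesis by (simp add: measurable_count_space_eq2_countable)
  qed
  show "X 0 \<omega> = d0" for \<omega> by (simp add: X_def)
  fix i and x :: "nat \<Rightarrow> nat" assume x: "x 0 = d0" "\<And>j. j \<le> i \<Longrightarrow> x j \<in> {0..n}"
  show "\<P>(\<omega> in noise. \<forall>j\<le>i. X j \<omega> = x j) = (\<Prod>j<i. p (x j) (x (Suc j)))"
    unfolding X_law[where x=x, OF x(1)] using x(2) assms by (intro prod.cong) auto
qed

lemma half_ints_eq_range: "odd n \<Longrightarrow> half_ints = range (walk_pos n)"
proof
  assume "odd n"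
  then obtain k where k: "n = 2 * k + 1" by (auto elim: oddE)
  show "half_ints \<subseteq> range (walk_pos n)"
  proof
    fix x assume "x \<in> half_ints"
    then obtain j where "x = of_int j + 1/2" by (auto simp: half_ints_def)
    then have "x = walk_pos n (j + int k + 1)" unfolding walk_pos_def by (simp add: k field_simps)
    then show "x \<in> range (walk_pos n)" by blast
  qed
  have "walk_pos n e = of_int (e - int k - 1) + 1/2" for e unfolding walk_pos_def by (simp add: k field_simps)
  then show "range (walk_pos n) \<subseteq> half_ints" unfolding half_ints_def by blast
qed

lemma Z_markov:
  fixes q :: real
  assumes n: "odd n"
    and rate: "\<And>e. rate e = q powr (walk_pos n e) + q powr (- walk_pos n e)"
    and upr: "\<And>e. up e * rate e = q powr (- walk_pos n e)"
    and top: "AE \<omega> in noise. filterlim (\<lambda>k. T k \<omega>) at_top sequentially"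
  shows "cont_markov_chain noise half_ints (odd_rate q) (walk_pos n (int d0)) Z"
  unfolding cont_markov_chain_def
proof (intro conjI allI impI ballI)
  let ?P = "\<lambda>x y. if x = y then 0 else odd_rate q x y / (- odd_rate q x x)"
  have S: "half_ints = range (walk_pos n)" by (rule half_ints_eq_range[OF n])
  have meas: "f \<in> noise \<rightarrow>\<^sub>M count_space half_ints" if "f \<in> noise \<rightarrow>\<^sub>M count_space UNIV" "f \<in> space noise \<rightarrow> half_ints" for f
  proof -
    have "countable half_ints" unfolding S by simp
    moreover have "f -` {x} \<inter> space noise \<in> sets noise" for x by (rule measurable_sets[OF that(1)]) simp
    ultimately show ?thesis using that(2) by (simp add: measurable_count_space_eq_countable)
  qed
  have Q: "- odd_rate q (walk_pos n e) (walk_pos n e) = rate e" for e by (simp add: odd_rate_def rate)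
  have dirp: "dir_prob e e' = ?P (walk_pos n e) (walk_pos n e')" for e e'
  proof -
    have ups: "up e = q powr (- walk_pos n e) / rate e" "1 - up e = q powr walk_pos n e / rate e"
      using upr[of e] rate[of e] rate_pos[of e] by (simp_all add: field_simps)
    consider "e' = e + 1" | "e' = e - 1" | "e' = e" | "e' \<noteq> e + 1" "e' \<noteq> e - 1" "e' \<noteq> e" by blast
    then show ?thesis
    proof cases
      case 1
      then have "walk_pos n e' = walk_pos n e + 1" by (simp add: walk_pos_def)
      then have "odd_rate q (walk_pos n e) (walk_pos n e') = q powr (- walk_pos n e)" "walk_pos n e \<noteq> walk_pos n e'" by (simp_all add: odd_rate_def)
      then show ?thesis using 1 ups by (simp add: Q dir_prob_def)
    next
      case 2
      then have "walk_pos n e' = walk_pos n e - 1" by (simp add: walk_pos_def)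
      then have "odd_rate q (walk_pos n e) (walk_pos n e') = q powr walk_pos n e" "walk_pos n e \<noteq> walk_pos n e'" by (simp_all add: odd_rate_def)
      then show ?thesis using 2 ups by (simp add: Q dir_prob_def)
    next
      case 3
      then show ?thesis by (simp add: dir_prob_def)
    next
      case 4
      then have "walk_pos n e' \<noteq> walk_pos n e + 1" "walk_pos n e' \<noteq> walk_pos n e - 1" "walk_pos n e' \<noteq> walk_pos n e" unfolding walk_pos_def by linarith+
      then have "odd_rate q (walk_pos n e) (walk_pos n e') = 0" by (simp add: odd_rate_def)
      then show ?thesis using 4 by (simp add: dir_prob_def)
    qed
  qed
  show "prob_space noise" by unfold_locales
  show "Z t \<in> noise \<rightarrow>\<^sub>M count_space half_ints" for t
    by (rule meas[OF measurable_Z]) (auto simp: Z_def S)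
  show "\<forall>\<^sub>F s in at_right t. Z s \<omega> = Z t \<omega>" if "\<omega> \<in> space noise" "t \<ge> 0" for \<omega> t
    by (rule Z_right_const[OF that])
  show "AE \<omega> in noise. (\<lambda>i. jump_time (\<lambda>t. Z t \<omega>) i) \<longlonglongrightarrow> \<infinity>"
    using top by (rule AE_mp, intro AE_I2 impI) (simp add: jump_Z tendsto_PInfty_eq_at_top)
  show "markov_chain noise half_ints ?P (walk_pos n (int d0)) (\<lambda>i \<omega>. jump_value (\<lambda>t. Z t \<omega>) i)"
  proof (rule markov_chainI)
    show "prob_space noise" by unfold_locales
    fix i
    have "(\<lambda>\<omega>. walk_pos n (J i \<omega>)) \<in> noise \<rightarrow>\<^sub>M count_space half_ints"
      by (rule meas[OF measurable_compose[OF measurable_J]]) (auto simp: S)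
    also have "?this \<longleftrightarrow> (\<lambda>\<omega>. jump_value (\<lambda>t. Z t \<omega>) i) \<in> noise \<rightarrow>\<^sub>M count_space half_ints"
      by (rule measurable_cong) (simp add: jump_Z)
    finally show "(\<lambda>\<omega>. jump_value (\<lambda>t. Z t \<omega>) i) \<in> noise \<rightarrow>\<^sub>M count_space half_ints" .
  next
    show "jump_value (\<lambda>t. Z t \<omega>) 0 = walk_pos n (int d0)" if "\<omega> \<in> space noise" for \<omega> using jump_Z[OF that] by simp
  next
    fix i and x :: "nat \<Rightarrow> real" assume x: "x 0 = walk_pos n (int d0)" "\<And>j. j \<le> i \<Longrightarrow> x j \<in> half_ints"
    define y where "y j = inv (walk_pos n) (x j)" for j
    have y: "x j = walk_pos n (y j)" if "j \<le> i" for j using x(2)[OF that] unfolding y_def S by (simp add: f_inv_into_f)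
    have y0: "y 0 = int d0" unfolding y_def x(1) using inj_walk_pos by (simp add: inv_f_f)
    have "\<P>(\<omega> in noise. \<forall>j\<le>i. jump_value (\<lambda>t. Z t \<omega>) j = x j) = \<P>(\<omega> in noise. \<forall>j\<le>i. J j \<omega> = y j)"
      using y inj_walk_pos by (intro arg_cong[where f="noise.prob"]) (auto simp: jump_Z inj_eq)
    also have "\<dots> = (\<Prod>j<i. ?P (x j) (x (Suc j)))"
      unfolding J_law[where x=y, OF y0] using y dirp by (intro prod.cong) auto
    finally show "\<P>(\<omega> in noise. \<forall>j\<le>i. jump_value (\<lambda>t. Z t \<omega>) j = x j) = (\<Prod>j<i. ?P (x j) (x (Suc j)))" .
  qed
  fix k and x s :: "nat \<Rightarrow> real"
  assume "(\<forall>j\<le>k. 0 \<le> s j) \<and> \<P>(\<omega> in noise. \<forall>j\<le>k. jump_value (\<lambda>t. Z t \<omega>) j = x j) > 0"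
  then have s: "\<And>j. j \<le> k \<Longrightarrow> 0 \<le> s j" and pos: "\<P>(\<omega> in noise. \<forall>j\<le>k. jump_value (\<lambda>t. Z t \<omega>) j = x j) > 0" by auto
  then have "{\<omega> \<in> space noise. \<forall>j\<le>k. jump_value (\<lambda>t. Z t \<omega>) j = x j} \<noteq> {}" by (metis less_irrefl measure_empty)
  then obtain \<omega>0 where \<omega>0: "\<omega>0 \<in> space noise" "\<And>j. j \<le> k \<Longrightarrow> jump_value (\<lambda>t. Z t \<omega>0) j = x j" by blast
  define y where "y j = J j \<omega>0" for j
  have y: "x j = walk_pos n (y j)" if "j \<le> k" for j using \<omega>0(2)[OF that] jump_Z(2)[OF \<omega>0(1)] by (simp add: y_def)
  have y0: "y 0 = int d0" by (simp add: y_def)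
  have ev: "{\<omega> \<in> space noise. \<forall>j\<le>k. jump_value (\<lambda>t. Z t \<omega>) j = x j} = {\<omega> \<in> space noise. \<forall>j\<le>k. J j \<omega> = y j}"
    using y inj_walk_pos by (auto simp: jump_Z inj_eq)
  have "{\<omega> \<in> space noise. (\<forall>j\<le>k. ereal (s j) < jump_time (\<lambda>t. Z t \<omega>) (Suc j) - jump_time (\<lambda>t. Z t \<omega>) j) \<and>
      (\<forall>j\<le>k. jump_value (\<lambda>t. Z t \<omega>) j = x j)} = {\<omega> \<in> space noise. (\<forall>j\<le>k. s j < H j \<omega>) \<and> (\<forall>j\<le>k. J j \<omega> = y j)}"
    using y inj_walk_pos by (auto simp: jump_Z inj_eq T_Suc simp del: jump_time.simps)
  then show "\<P>(\<omega> in noise. \<forall>j\<le>k. ereal (s j) < jump_time (\<lambda>t. Z t \<omega>) (Suc j) - jump_time (\<lambda>t. Z t \<omega>) j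
      \<bar> \<forall>j\<le>k. jump_value (\<lambda>t. Z t \<omega>) j = x j) = (\<Prod>j\<le>k. exp (- (- odd_rate q (x j) (x j)) * s j))"
    using pos J_H_law[where x=y and s=s and k=k, OF y0 s] y unfolding cond_prob_def ev by (simp add: Q)
qed

text \<open>Three things can go wrong: the walks separate, a holding time is too long, or too little time
  passes. Off these events the conclusions hold path by path.\<close>
lemma prob_coupling:
  assumes N: "N > 0" and \<delta>: "\<delta> \<ge> 0"
    and step: "\<And>e. e \<in> R \<Longrightarrow> measure_pmf.prob (joint_law (nat e) e) {z. \<not> matched R z} \<le> leave e * \<delta>"
    and d0R: "int d0 \<in> R"
    and \<epsilon>: "\<And>e. e \<in> R \<Longrightarrow> \<bar>rate e / (N * - ln (1 - leave e)) - 1\<bar> \<le> \<epsilon>"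
    and s: "s \<ge> 0" and \<rho>0: "\<rho>0 > 0" "\<And>e. \<rho>0 \<le> rate e"
    and V: "drift_potential V C"
    and \<rho>: "\<And>e. e \<in> C \<Longrightarrow> rate e \<le> \<rho>" "\<rho> > 0" and t: "t \<ge> 0"
    and c: "real m * (1 / N + s * \<epsilon>) \<le> c"
  defines "Y \<equiv> \<lambda>\<omega> t. real (X (2 * nat \<lfloor>N * t\<rfloor>) \<omega>) - real n / 2"
  shows "\<P>(\<omega> in noise. paths_close m c t (Y \<omega>) (\<lambda>t. Z t \<omega>))
    \<ge> 1 - (real m * \<delta> + real m * exp (- \<rho>0 * s) + (5/6) ^ m * 4 powr (\<rho> * t / ln 2) * V (int d0))"
    (is "noise.prob ?E \<ge> _")
proof -
  let ?B1 = "{\<omega> \<in> space noise. \<exists>i. breaks R m ((0, d0), int d0) (map (\<lambda>i. S i \<omega>) [1..<Suc i])}"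
  let ?B2 = "{\<omega> \<in> space noise. \<exists>l<m. s < H l \<omega>}"
  let ?B3 = "{\<omega> \<in> space noise. T m \<omega> < t}"
  have \<epsilon>0: "\<epsilon> \<ge> 0" using \<epsilon>[OF d0R] by linarith
  have E_eq: "?E = {\<omega> \<in> space noise. (\<forall>i\<le>m. jump_value (Y \<omega>) i = walk_pos n (J i \<omega>)) \<and>
      (\<forall>i\<le>m. \<bar>jump_time (Y \<omega>) i - ereal (T i \<omega>)\<bar> \<le> ereal c) \<and> t \<le> T m \<omega>}"
    by (auto simp: jump_Z paths_close_def)
  define yv yt jv where "yv i \<omega> = jump_value (Y \<omega>) i" and "yt i \<omega> = jump_time (Y \<omega>) i" and "jv i \<omega> = walk_pos n (J i \<omega>)" for i \<omega>
  have [measurable]: "yv i \<in> borel_measurable noise" "yt i \<in> borel_measurable noise" for i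
    using measurable_jump_Y[OF N, of i] unfolding yv_def yt_def Y_def by simp_all
  have [measurable]: "jv i \<in> borel_measurable noise" for i
    unfolding jv_def by (rule measurable_compose[OF measurable_J]) simp
  have m1: "{\<omega> \<in> space noise. yv i \<omega> = jv i \<omega>} \<in> noise.events" for i by measurable
  have m2: "{\<omega> \<in> space noise. \<bar>yt i \<omega> - ereal (T i \<omega>)\<bar> \<le> ereal c} \<in> noise.events" for i
    by (rule borel_measurable_le) measurable
  have m3: "{\<omega> \<in> space noise. t \<le> T m \<omega>} \<in> noise.events" by measurable
  have "?E = {\<omega> \<in> space noise. (\<forall>i\<in>{..m}. yv i \<omega> = jv i \<omega>) \<and>
      (\<forall>i\<in>{..m}. \<bar>yt i \<omega> - ereal (T i \<omega>)\<bar> \<le> ereal c) \<and> t \<le> T m \<omega>}"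
    unfolding E_eq yv_def yt_def jv_def by (simp only: Ball_def atMost_iff)
  also have "\<dots> \<in> noise.events"
    by (intro sets.sets_Collect_conj sets.sets_Collect_finite_All m1 m2 m3) simp_all
  finally have E: "?E \<in> noise.events" .
  have B1: "?B1 \<in> noise.events"
  proof -
    have "{\<omega> \<in> space noise. breaks R m ((0, d0), int d0) (map (\<lambda>i. S i \<omega>) [1..<Suc i])} \<in> noise.events" for i
      by (rule measurable_sets_Collect[OF measurable_map_list[OF measurable_S]]) simp
    then show ?thesis by (rule sets.sets_Collect_countable_Ex)
  qed
  have B23: "?B2 \<in> noise.events" "?B3 \<in> noise.events" by (measurable, measurable)
  have "space noise - ?E \<subseteq> ?B1 \<union> ?B2 \<union> ?B3"
  proof (rule subsetI, rule ccontr)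
    fix \<omega> assume \<omega>: "\<omega> \<in> space noise - ?E" and nB: "\<omega> \<notin> ?B1 \<union> ?B2 \<union> ?B3"
    have \<omega>s: "\<omega> \<in> space noise" using \<omega> by simp
    have mt: "matched R (S i \<omega>)" if "i \<le> tick m \<omega>" for i
      using unbroken_matched[OF _ d0R that] nB \<omega>s by blast
    have JR: "J l \<omega> \<in> R" if "l \<le> m" for l
      using mt[OF tick_mono[OF that]] by (simp add: matched_def S_def A_def)
    have match: "int (snd (D i \<omega>)) = A i \<omega>" if "i \<le> tick m \<omega>" for i
      using mt[OF that] by (simp add: matched_def S_def)
    have Hs: "H l \<omega> \<le> s" if "l < m" for l
    proof -
      have "\<not> s < H l \<omega>" using nB \<omega>s that by blast
      then show ?thesis by simp
    qed
    have Tm: "t \<le> T m \<omega>"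
    proof -
      have "\<not> T m \<omega> < t" using nB \<omega>s by blast
      then show ?thesis by simp
    qed
    have tm: "\<bar>real (tick k \<omega>) / N - T k \<omega>\<bar> \<le> c" if "k \<le> m" for k
      using tick_time[OF \<omega>s N that \<epsilon>[OF JR] Hs \<epsilon>0 s] c by (meson less_imp_le order.trans)
    have "\<omega> \<in> ?E"
      unfolding E_eq using \<omega>s Tm tm by (simp add: Y_def jump_Y[OF N match])
    then show False using \<omega> by blast
  qed
  then have "noise.prob (space noise - ?E) \<le> noise.prob (?B1 \<union> ?B2 \<union> ?B3)"
    using B1 B23 by (intro noise.finite_measure_mono) auto
  also have "\<dots> \<le> noise.prob ?B1 + noise.prob ?B2 + noise.prob ?B3"
    by (intro order.trans[OF measure_Un_le] add_mono measure_Un_le order.refl sets.Un B1 B23)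
  also have "\<dots> \<le> real m * \<delta> + real m * exp (- \<rho>0 * s) + (5/6) ^ m * 4 powr (\<rho> * t / ln 2) * V (int d0)"
    by (intro add_mono prob_ever_breaks[OF \<delta> step d0R] prob_H_large[OF \<rho>0(2,1) s] prob_T_less[OF V \<rho> t])
  finally show ?thesis using noise.prob_compl[OF E] by simp
qed

end

section \<open>Two steps of the discrete chain\<close>

text \<open>States above \<open>n\<close> do not occur; their law is an arbitrary choice inside \<open>{..n}\<close>.\<close>
definition chain_pmf :: "real \<Rightarrow> nat \<Rightarrow> nat \<Rightarrow> nat pmf" where
  "chain_pmf q n d = (SOME p. \<forall>r. pmf p r = (if d \<le> n then trans_prob q n d r else of_bool (r = 0)))"

definition two_step :: "real \<Rightarrow> nat \<Rightarrow> nat \<Rightarrow> nat \<Rightarrow> real" where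
  "two_step q n d d' = (\<Sum>m\<le>n. trans_prob q n d m * trans_prob q n m d')"

text \<open>To leading order the probability that two steps of the chain leave \<open>d\<close>; the summands belong
  to upward and downward moves.\<close>
definition exit_scale :: "real \<Rightarrow> nat \<Rightarrow> nat \<Rightarrow> real" where
  "exit_scale q n d = step_scale q d + step_scale q (n - d)"

definition central :: "nat \<Rightarrow> real \<Rightarrow> int set" where
  "central n h = {e. \<bar>walk_pos n e\<bar> \<le> h}"

definition potential :: "nat \<Rightarrow> int \<Rightarrow> real" where
  "potential n e = 2 powr (\<bar>walk_pos n e\<bar> - 1/2)"

definition walk_rate :: "real \<Rightarrow> nat \<Rightarrow> int \<Rightarrow> real" where
  "walk_rate q n e = q powr walk_pos n e + q powr (- walk_pos n e)"

definition walk_up :: "real \<Rightarrow> nat \<Rightarrow> int \<Rightarrow> real" where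
  "walk_up q n e = 1 / (1 + q powr (2 * walk_pos n e))"

text \<open>The probability that two steps of the chain leave the site. The value \<open>1/2\<close> is a dummy for sites
  at which this probability is degenerate.\<close>
definition walk_leave :: "real \<Rightarrow> nat \<Rightarrow> int \<Rightarrow> real" where
  "walk_leave q n e = (let p = 1 - two_step q n (nat e) (nat e) in if 0 < p \<and> p < 1 then p else 1/2)"

lemma walk_leave_bounds: "0 < walk_leave q n e" "walk_leave q n e < 1"
  by (auto simp: walk_leave_def Let_def)

context
  fixes q :: real and n :: nat
  assumes q2: "2 \<le> q"
begin

lemma trans_prob_eq_0: "n < r \<Longrightarrow> trans_prob q n d r = 0" by (simp add: trans_prob_def)

lemma pmf_chain_pmf: "pmf (chain_pmf q n d) r = (if d \<le> n then trans_prob q n d r else of_bool (r = 0))"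
proof -
  have "\<exists>p. \<forall>r. pmf p r = (if d \<le> n then trans_prob q n d r else of_bool (r = 0))"
  proof (cases "d \<le> n")
    case True
    obtain p where p: "\<And>r. pmf p r = (if r \<in> {..n} then trans_prob q n d r else 0)"
      using ex_pmf_finite[of "{..n}" "trans_prob q n d"] trans_prob_nonneg[OF q2 True] sum_trans_prob[OF q2 True] by auto
    have "pmf p r = trans_prob q n d r" for r using p[of r] trans_prob_eq_0[of r d] by auto
    then show ?thesis using True by auto
  next
    case False
    then show ?thesis by (intro exI[of _ "return_pmf 0"]) (auto simp: pmf_return indicator_def)
  qed
  from someI_ex[OF this] show ?thesis unfolding chain_pmf_def by blast
qed

lemma set_chain_pmf: "set_pmf (chain_pmf q n d) \<subseteq> {..n}"
  using trans_prob_eq_0 by (auto simp: set_pmf_iff pmf_chain_pmf not_le split: if_splits intro: ccontr)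

lemma walk_rate_pos: "walk_rate q n e > 0"
  unfolding walk_rate_def using q2 by (intro add_pos_pos) auto

lemma walk_up_bounds: "0 < walk_up q n e" "walk_up q n e < 1"
proof -
  have "q powr (2 * walk_pos n e) > 0" using q2 by simp
  then show "0 < walk_up q n e" "walk_up q n e < 1" by (simp_all add: walk_up_def field_simps add_pos_pos)
qed

lemma walk_up_rate: "walk_up q n e * walk_rate q n e = q powr (- walk_pos n e)"
proof -
  let ?a = "walk_pos n e"
  have "q powr ?a = q powr (2 * ?a) * q powr (- ?a)" by (simp flip: powr_add)
  then have "walk_rate q n e = (1 + q powr (2 * ?a)) * q powr (- ?a)" by (simp add: walk_rate_def algebra_simps)
  moreover have "1 + q powr (2 * ?a) \<noteq> 0" using powr_ge_zero[of q "2 * ?a"] by linarith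
  ultimately show ?thesis by (simp add: walk_up_def)
qed

lemma one_minus_walk_up: "1 - walk_up q n e = 1 / (1 + q powr (- (2 * walk_pos n e)))"
proof -
  have "1 - 1 / (1 + x) = 1 / (1 + inverse x)" if "x > 0" for x :: real
  proof -
    have "1 + x \<noteq> 0" using that by simp
    then show ?thesis using that by (simp add: divide_simps)
  qed
  from this[of "q powr (2 * walk_pos n e)"] show ?thesis
    using q2 by (simp add: walk_up_def powr_minus)
qed

lemma inverse_succ_le: "1 / (1 + x) \<le> inverse x" if "x > 0" for x :: real
proof -
  have "1 / (1 + x) \<le> 1 / x" using that by (intro divide_left_mono) auto
  then show ?thesis by (simp add: inverse_eq_divide)
qed

lemma walk_up_le: "walk_up q n e \<le> q powr (- (2 * walk_pos n e))"
  using inverse_succ_le[of "q powr (2 * walk_pos n e)"] q2 by (simp add: walk_up_def powr_minus)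

lemma walk_down_le: "1 - walk_up q n e \<le> q powr (2 * walk_pos n e)"
  using inverse_succ_le[of "q powr (- (2 * walk_pos n e))"] q2 
  by (simp add: one_minus_walk_up powr_minus)

lemma walk_rate_ge_2: "2 \<le> walk_rate q n e"
proof -
  let ?x = "q powr walk_pos n e"
  have x: "?x > 0" using q2 by simp
  have "0 \<le> (?x - 1)\<^sup>2" by simp
  then have "2 * ?x \<le> ?x * ?x + 1" by (simp add: power2_eq_square algebra_simps)
  then show ?thesis using x by (simp add: walk_rate_def powr_minus field_simps)
qed

lemma two_step_nonneg: "d \<le> n \<Longrightarrow> two_step q n d d' \<ge> 0"
  unfolding two_step_def using trans_prob_nonneg[OF q2] by (intro sum_nonneg mult_nonneg_nonneg) auto

lemma two_step_ge: "d \<le> n \<Longrightarrow> m \<le> n \<Longrightarrow> trans_prob q n d m * trans_prob q n m d' \<le> two_step q n d d'"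
  unfolding two_step_def using trans_prob_nonneg[OF q2] by (intro member_le_sum) auto

lemma sum_two_step: "d \<le> n \<Longrightarrow> (\<Sum>d'\<le>n. two_step q n d d') = 1"
  unfolding two_step_def
  by (subst sum.swap) (simp add: sum_distrib_left[symmetric] sum_trans_prob[OF q2])

lemma step_scale_le: assumes "q powi (- int d) \<le> \<eta>" shows "step_scale q d \<le> \<eta>"
proof -
  have "q powi (- int d) / (q - 1) \<le> q powi (- int d) / 1"
    using q2 by (intro divide_left_mono) auto
  then show ?thesis using assms by (simp add: step_scale_def)
qed

lemma step_scale_Suc_le: "step_scale q (Suc d) \<le> step_scale q d"
  unfolding step_scale_def using q2 by (intro divide_right_mono power_int_increasing) auto

lemma step_scale_le_double: "0 < k \<Longrightarrow> step_scale q (k - 1) \<le> 2 * q powi (- int k)"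
proof -
  assume "0 < k"
  then have "q powi (- int (k - 1)) = q * q powi (- int k)"
    using q2 by (simp add: of_nat_diff power_int_diff power_int_minus field_simps)
  moreover have "q / (q - 1) \<le> 2" using q2 by (simp add: divide_simps)
  ultimately show ?thesis unfolding step_scale_def
    using mult_right_mono[of "q / (q - 1)" 2 "q powi (- int k)"] q2 by simp
qed

lemma mult3_lower:
  fixes x y z \<eta> :: real
  assumes "1 - \<eta> \<le> x" "1 - \<eta> \<le> y" "1 - 2 * \<eta> \<le> z" "0 \<le> \<eta>" "\<eta> \<le> 1/8"
  shows "1 - 4 * \<eta> \<le> x * y * z"
proof -
  have "(1 - \<eta>) * (1 - \<eta>) * (1 - 2 * \<eta>) \<le> x * y * z"
    using assms by (intro mult_mono mult_nonneg_nonneg) auto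
  moreover have "(1 - \<eta>) * (1 - \<eta>) * (1 - 2 * \<eta>) = 1 - 4 * \<eta> + \<eta>\<^sup>2 * (5 - 2 * \<eta>)"
    by (simp add: power2_eq_square algebra_simps)
  moreover have "\<eta>\<^sup>2 * (5 - 2 * \<eta>) \<ge> 0" using assms by simp
  ultimately show ?thesis by linarith
qed

text \<open>Staying put means reflecting twice, and a move by one means reflecting once and falling one
  short once: \<open>d\<close> to \<open>n - d - 1\<close> to \<open>d + 1\<close>, or \<open>d\<close> to \<open>n - d\<close> to \<open>d - 1\<close>. Lower bounds for these
  three suffice, because the probabilities sum to one.\<close>
lemma two_step_bounds:
  assumes d: "0 < d" "d < n" and \<eta>: "q powi (- int d) \<le> \<eta>" "q powi (- int (n - d)) \<le> \<eta>" "\<eta> \<le> 1/8"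
  shows "1 - exit_scale q n d \<le> two_step q n d d"
    and "step_scale q d * (1 - 4 * \<eta>) \<le> two_step q n d (d + 1)"
    and "step_scale q (n - d) * (1 - 4 * \<eta>) \<le> two_step q n d (d - 1)"
    and "exit_scale q n d * (1 - 4 * \<eta>) \<le> 1 - two_step q n d d"
    and "0 < exit_scale q n d" "exit_scale q n d \<le> 2 * \<eta>"
proof -
  note tl = trans_prob_reflect_lower[OF q2] and tm = trans_prob_reflect_minus_one_lower[OF q2]
  have \<eta>0: "0 \<le> \<eta>" using \<eta>(1) q2 by (meson order.trans zero_le_power_int order.strict_implies_order zero_less_numeral)
  have t0: "step_scale q k > 0" for k by (rule step_scale_pos[OF q2])
  have td: "step_scale q d \<le> \<eta>" "step_scale q (n - d) \<le> \<eta>" using step_scale_le \<eta> by auto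
  have tS: "step_scale q (Suc d) \<le> \<eta>" "step_scale q (Suc (n - d)) \<le> \<eta>"
    using step_scale_Suc_le[of d] step_scale_Suc_le[of "n - d"] td by linarith+
  have tD: "step_scale q (n - d - 1) \<le> 2 * \<eta>" using step_scale_le_double[of "n - d"] d \<eta>(2) by simp
  show "0 < exit_scale q n d" "exit_scale q n d \<le> 2 * \<eta>" unfolding exit_scale_def using t0[of d] t0[of "n - d"] td by auto
  have nd: "n - (n - d) = d" "n - d \<le> n" using d by auto
  show "1 - exit_scale q n d \<le> two_step q n d d"
  proof -
    have "(1 - step_scale q d) * (1 - step_scale q (n - d)) \<le> trans_prob q n d (n - d) * trans_prob q n (n - d) d"
      using tl[of d n] tl[of "n - d" n] nd d td \<eta>(3) by (intro mult_mono) auto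
    also have "\<dots> \<le> two_step q n d d" using d by (intro two_step_ge) auto
    finally have "(1 - step_scale q d) * (1 - step_scale q (n - d)) \<le> two_step q n d d" .
    moreover have "step_scale q d * step_scale q (n - d) \<ge> 0" using t0[of d] t0[of "n - d"] by simp
    ultimately show ?thesis by (simp add: exit_scale_def algebra_simps)
  qed
  have powd: "q powi (int d - int n) = q powi (- int (n - d))" using d by (simp add: of_nat_diff)
  show up: "step_scale q d * (1 - 4 * \<eta>) \<le> two_step q n d (d + 1)"
  proof -
    have "step_scale q d * (1 - 4 * \<eta>) \<le> step_scale q d * ((1 - q powi (int d - int n)) * (1 - step_scale q (Suc d)) * (1 - step_scale q (n - d - 1)))"
      using t0[of d] \<eta> \<eta>0 tS tD unfolding powd by (intro mult_left_mono mult3_lower) auto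
    also have "\<dots> = (step_scale q d * (1 - q powi (int d - int n)) * (1 - step_scale q (Suc d))) * (1 - step_scale q (n - d - 1))" by simp
    also have "\<dots> \<le> trans_prob q n d (n - d - 1) * trans_prob q n (n - d - 1) (d + 1)"
    proof (intro mult_mono)
      show "step_scale q d * (1 - q powi (int d - int n)) * (1 - step_scale q (Suc d)) \<le> trans_prob q n d (n - d - 1)" using tm[of d n] d by simp
      show "1 - step_scale q (n - d - 1) \<le> trans_prob q n (n - d - 1) (d + 1)" using tl[of "n - d - 1" n] d by (simp add: nd)
      show "0 \<le> trans_prob q n d (n - d - 1)" using trans_prob_nonneg[OF q2, of d n] d by simp
      show "0 \<le> 1 - step_scale q (n - d - 1)" using tD \<eta> by simp
    qed
    also have "\<dots> \<le> two_step q n d (d + 1)" using d by (intro two_step_ge) auto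
    finally show ?thesis .
  qed
  show down: "step_scale q (n - d) * (1 - 4 * \<eta>) \<le> two_step q n d (d - 1)"
  proof -
    have powd': "q powi (int (n - d) - int n) = q powi (- int d)" using d by (simp add: of_nat_diff)
    have "step_scale q (n - d) * (1 - 4 * \<eta>) \<le> step_scale q (n - d) * ((1 - q powi (- int d)) * (1 - step_scale q (Suc (n - d))) * (1 - step_scale q d))"
      using t0[of "n - d"] \<eta> \<eta>0 tS td by (intro mult_left_mono mult3_lower) auto
    also have "\<dots> = (1 - step_scale q d) * (step_scale q (n - d) * (1 - q powi (int (n - d) - int n)) * (1 - step_scale q (Suc (n - d))))"
      unfolding powd' by simp
    also have "\<dots> \<le> trans_prob q n d (n - d) * trans_prob q n (n - d) (d - 1)"
    proof (intro mult_mono)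
      show "step_scale q (n - d) * (1 - q powi (int (n - d) - int n)) * (1 - step_scale q (Suc (n - d))) \<le> trans_prob q n (n - d) (d - 1)"
        using tm[of "n - d" n] d by (simp add: nd)
      show "1 - step_scale q d \<le> trans_prob q n d (n - d)" using tl[of d n] d by simp
      show "0 \<le> trans_prob q n d (n - d)" using trans_prob_nonneg[OF q2, of d n] d by simp
      show "0 \<le> step_scale q (n - d) * (1 - q powi (int (n - d) - int n)) * (1 - step_scale q (Suc (n - d)))"
        using t0[of "n - d"] tS \<eta> unfolding powd' by (intro mult_nonneg_nonneg) auto
    qed
    also have "\<dots> \<le> two_step q n d (d - 1)" using d by (intro two_step_ge) auto
    finally show ?thesis .
  qed
  have "(\<Sum>d'\<in>{d, d + 1, d - 1}. two_step q n d d') \<le> (\<Sum>d'\<le>n. two_step q n d d')"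
    using d two_step_nonneg by (intro sum_mono2) auto
  then have "two_step q n d d + two_step q n d (d + 1) + two_step q n d (d - 1) \<le> 1"
    using d sum_two_step[of d] by (simp add: add_ac)
  moreover have "exit_scale q n d * (1 - 4 * \<eta>) = step_scale q d * (1 - 4 * \<eta>) + step_scale q (n - d) * (1 - 4 * \<eta>)"
    by (simp add: exit_scale_def algebra_simps)
  ultimately show "exit_scale q n d * (1 - 4 * \<eta>) \<le> 1 - two_step q n d d"
    using up down by linarith
qed

lemma step_scale_powr: "step_scale q d = q powr (- real d) / (q - 1)"
  using powr_real_of_int'[of q "- int d"] q2 by (simp add: step_scale_def)

text \<open>Where the time scale comes from: multiplied by \<open>q powr (n/2) * (q - 1)\<close>, the exit probabilities become
  the rates of the limiting process.\<close>
lemma scale_rate: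
  assumes "d \<le> n"
  shows "q powr (real n / 2) * (q - 1) * step_scale q d = q powr (- walk_pos n (int d))"
    "q powr (real n / 2) * (q - 1) * step_scale q (n - d) = q powr walk_pos n (int d)"
    "q powr (real n / 2) * (q - 1) * exit_scale q n d = walk_rate q n (int d)"
proof -
  have q1: "q - 1 \<noteq> 0" using q2 by simp
  show 1: "q powr (real n / 2) * (q - 1) * step_scale q d = q powr (- walk_pos n (int d))"
    using q1 by (simp add: step_scale_powr walk_pos_def powr_add[symmetric])
  show 2: "q powr (real n / 2) * (q - 1) * step_scale q (n - d) = q powr walk_pos n (int d)"
    using q1 assms by (simp add: step_scale_powr walk_pos_def powr_add[symmetric] of_nat_diff)
  show "q powr (real n / 2) * (q - 1) * exit_scale q n d = walk_rate q n (int d)"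
    using 1 2 by (simp add: exit_scale_def walk_rate_def distrib_left)
qed

lemma exit_split:
  assumes "d \<le> n"
  shows "exit_scale q n d * walk_up q n (int d) = step_scale q d"
    "exit_scale q n d * (1 - walk_up q n (int d)) = step_scale q (n - d)"
proof -
  let ?N = "q powr (real n / 2) * (q - 1)"
  have N: "?N > 0" using q2 by simp
  have "?N * (exit_scale q n d * walk_up q n (int d)) = ?N * step_scale q d"
  proof -
    have "?N * (exit_scale q n d * walk_up q n (int d)) = (?N * exit_scale q n d) * walk_up q n (int d)" by simp
    then show ?thesis using scale_rate[OF assms] walk_up_rate[of "int d"] by (simp only: mult.commute)
  qed
  then show 1: "exit_scale q n d * walk_up q n (int d) = step_scale q d" using N by auto
  show "exit_scale q n d * (1 - walk_up q n (int d)) = step_scale q (n - d)"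
    using 1 by (simp add: exit_scale_def algebra_simps)
qed

section \<open>Estimates in the central range\<close>

lemma central_bounds:
  assumes e: "e \<in> central n h" and \<eta>: "q powr (h - real n / 2) < 1"
  shows "0 < nat e" "nat e < n" "int (nat e) = e"
    "q powi (- int (nat e)) \<le> q powr (h - real n / 2)" "q powi (- int (n - nat e)) \<le> q powr (h - real n / 2)"
proof -
  have "h - real n / 2 < 0"
  proof (rule ccontr)
    assume "\<not> h - real n / 2 < 0"
    then have "1 \<le> q powr (h - real n / 2)" using q2 by (intro ge_one_powr_ge_zero) auto
    then show False using \<eta> by simp
  qed
  then have "0 < real_of_int e" "real_of_int e < real n"
    using e by (auto simp: central_def walk_pos_def)
  then have e': "0 < e" "e < int n" by linarith+
  then show d: "0 < nat e" "nat e < n" "int (nat e) = e" by auto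
  have "q powi (- int (nat e)) = q powr (- real_of_int e)"
    using powr_real_of_int'[of q "- e"] q2 d by simp
  also have "\<dots> \<le> q powr (h - real n / 2)"
    using e q2 by (intro powr_mono) (auto simp: central_def walk_pos_def)
  finally show "q powi (- int (nat e)) \<le> q powr (h - real n / 2)" .
  have "q powi (- int (n - nat e)) = q powr (real_of_int e - real n)"
    using powr_real_of_int'[of q "e - int n"] q2 d by (simp add: of_nat_diff)
  also have "\<dots> \<le> q powr (h - real n / 2)"
    using e q2 by (intro powr_mono) (auto simp: central_def walk_pos_def)
  finally show "q powi (- int (n - nat e)) \<le> q powr (h - real n / 2)" .
qed

lemma central_leave:
  assumes e: "e \<in> central n h" and \<eta>: "q powr (h - real n / 2) \<le> 1/8" (is "?\<eta> \<le> _")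
  shows "walk_leave q n e = 1 - two_step q n (nat e) (nat e)"
    "exit_scale q n (nat e) * (1 - 4 * ?\<eta>) \<le> walk_leave q n e"
    "walk_leave q n e \<le> exit_scale q n (nat e)"
proof -
  have "?\<eta> < 1" using \<eta> by simp
  note cb = central_bounds[OF e this]
  note tb = two_step_bounds[OF cb(1,2,4,5) \<eta>]
  have E: "0 < exit_scale q n (nat e)" "exit_scale q n (nat e) \<le> 2 * ?\<eta>" by (rule tb)+
  have "0 < exit_scale q n (nat e) * (1 - 4 * ?\<eta>)" using E \<eta> by (intro mult_pos_pos) auto
  then have p: "0 < 1 - two_step q n (nat e) (nat e)" "1 - two_step q n (nat e) (nat e) < 1"
    using tb(1,4) E \<eta> by linarith+
  then show l: "walk_leave q n e = 1 - two_step q n (nat e) (nat e)" by (simp add: walk_leave_def)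
  show "exit_scale q n (nat e) * (1 - 4 * ?\<eta>) \<le> walk_leave q n e" "walk_leave q n e \<le> exit_scale q n (nat e)"
    unfolding l using tb(1,4) by linarith+
qed

text \<open>The grid on which holding times are rounded has mesh \<open>- ln (1 - leave e) / rate e\<close>; this is \<open>1/N\<close> up to a relative error of the order of the exit probability.\<close>
lemma central_rate_ratio:
  assumes e: "e \<in> central n h" and \<eta>: "q powr (h - real n / 2) \<le> 1/8" (is "?\<eta> \<le> _")
  shows "\<bar>walk_rate q n e / (q powr (real n / 2) * (q - 1) * - ln (1 - walk_leave q n e)) - 1\<bar> \<le> 8 * ?\<eta>"
proof -
  have "?\<eta> < 1" using \<eta> by simp
  note cb = central_bounds[OF e this]
  note tb = two_step_bounds[OF cb(1,2,4,5) \<eta>] and cl = central_leave[OF e \<eta>]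
  let ?N = "q powr (real n / 2) * (q - 1)"
  define E p L where "E = exit_scale q n (nat e)" and "p = walk_leave q n e" and "L = - ln (1 - p)"
  have N: "?N > 0" using q2 by simp
  have \<eta>0: "?\<eta> > 0" using q2 by simp
  have E: "0 < E" "E \<le> 2 * ?\<eta>" unfolding E_def by (rule tb)+
  have p: "0 < p" "E * (1 - 4 * ?\<eta>) \<le> p" "p \<le> E" 
    using walk_leave_bounds(1)[of q n e] cl(2,3) by (simp_all only: E_def p_def)
  have "p \<le> 1/2" using p E \<eta> by linarith
  then have L: "p \<le> L" "L \<le> p + 2 * p\<^sup>2"
    unfolding L_def using ln_one_minus_pos_lower_bound[of p] ln_one_minus_pos_upper_bound[of p] p by auto
  have "p\<^sup>2 \<le> E * (2 * ?\<eta>)" unfolding power2_eq_square using p E by (intro mult_mono) auto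
  then have LE: "L \<le> E * (1 + 4 * ?\<eta>)" using L p by (simp add: algebra_simps)
  have L0: "L > 0" using L p by simp
  have "walk_rate q n e = ?N * E" using scale_rate(3)[of "nat e"] cb by (simp add: E_def)
  then have "walk_rate q n e / (?N * L) = E / L" using N q2 by auto
  moreover have "E / L \<le> 1 + 8 * ?\<eta>"
  proof -
    have "1 \<le> (1 - 4 * ?\<eta>) * (1 + 8 * ?\<eta>)" using mult_nonneg_nonneg[of ?\<eta> "1 - 8 * ?\<eta>"] \<eta> \<eta>0 by (simp add: algebra_simps)
    then have "E \<le> E * ((1 - 4 * ?\<eta>) * (1 + 8 * ?\<eta>))" using E by simp
    also have "\<dots> = (E * (1 - 4 * ?\<eta>)) * (1 + 8 * ?\<eta>)" by simp
    also have "\<dots> \<le> L * (1 + 8 * ?\<eta>)" using p L \<eta>0 by (intro mult_right_mono) auto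
    finally show ?thesis using L0 by (simp add: divide_le_eq mult.commute)
  qed
  moreover have "1 - 8 * ?\<eta> \<le> E / L"
  proof -
    have "(1 - 8 * ?\<eta>) * L \<le> (1 - 8 * ?\<eta>) * (E * (1 + 4 * ?\<eta>))" using LE \<eta> by (intro mult_left_mono) auto
    also have "\<dots> = E * ((1 - 8 * ?\<eta>) * (1 + 4 * ?\<eta>))" by simp
    also have "\<dots> \<le> E * 1"
    proof (rule mult_left_mono)
      have "0 \<le> ?\<eta> * (4 + 32 * ?\<eta>)" using \<eta>0 by simp
      then show "(1 - 8 * ?\<eta>) * (1 + 4 * ?\<eta>) \<le> 1" by (simp add: algebra_simps)
    qed (use E in simp)
    finally show ?thesis using L0 by (simp add: le_divide_eq)
  qed
  ultimately show ?thesis unfolding L_def p_def by linarith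
qed

section \<open>The potential of the walk\<close>

lemma walk_pos_half: "odd n \<Longrightarrow> walk_pos n e \<ge> 1/2 \<or> walk_pos n e \<le> - 1/2"
proof -
  assume "odd n"
  then obtain k where k: "n = 2 * k + 1" by (auto elim: oddE)
  have "walk_pos n e = real_of_int (e - int k) - 1/2" by (simp add: walk_pos_def k field_simps)
  then show ?thesis by (cases "e - int k \<ge> 1") linarith+
qed

lemma walk_pos_Suc: "walk_pos n (e + 1) = walk_pos n e + 1" "walk_pos n (e - 1) = walk_pos n e - 1"
  by (simp_all add: walk_pos_def)

lemma walk_pos_half_eq: "odd n \<Longrightarrow> \<bar>walk_pos n e\<bar> \<noteq> 1/2 \<Longrightarrow> walk_pos n e \<ge> 3/2 \<or> walk_pos n e \<le> - 3/2"
proof -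
  assume "odd n" and ne: "\<bar>walk_pos n e\<bar> \<noteq> 1/2"
  then obtain k where k: "n = 2 * k + 1" by (auto elim: oddE)
  have w: "walk_pos n e = real_of_int (e - int k) - 1/2" by (simp add: walk_pos_def k field_simps)
  have "e - int k \<noteq> 0" "e - int k \<noteq> 1" using ne unfolding w by auto
  then have "e - int k \<ge> 2 \<or> e - int k \<le> -1" by linarith
  then show ?thesis unfolding w by linarith
qed

lemma potential_ge_1: "odd n \<Longrightarrow> 1 \<le> potential n e"
  unfolding potential_def using walk_pos_half[of e] by (intro ge_one_powr_ge_zero) auto

text \<open>Away from the two central sites the outward jump has probability at most \<open>1/8\<close>, which
  outweighs the doubling of the potential in that direction.\<close>
lemma potential_outer:
  assumes n: "odd n" and e: "\<bar>walk_pos n e\<bar> \<noteq> 1/2"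
  shows "walk_up q n e * potential n (e + 1) + (1 - walk_up q n e) * potential n (e - 1) \<le> 5/6 * potential n e"
proof -
  let ?a = "walk_pos n e"
  have drift: "u * (2 * v) + (1 - u) * (v / 2) \<le> 5/6 * v" if "u \<le> 1/8" "v > 0" for u v :: real
  proof -
    have "u * (2 * v) + (1 - u) * (v / 2) = v * (1/2 + 3/2 * u)" by (simp add: field_simps)
    also have "\<dots> \<le> v * (5/6)" using that by (intro mult_left_mono) auto
    finally show ?thesis by simp
  qed
  have v: "potential n e > 0" by (simp add: potential_def)
  have small: "q powr x \<le> 1/8" if "x \<le> -3" for x
  proof -
    have "q powr x \<le> q powr (-3)" using that q2 by (intro powr_mono) auto
    also have "\<dots> \<le> 2 powr (-3)" using q2 by (intro powr_mono2') auto
    also have "\<dots> = 1/8" by (simp add: powr_minus powr_numeral)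
    finally show ?thesis .
  qed
  have d2: "2 powr (x - 1) = 2 powr x / (2::real)" "2 powr (x + 1) = 2 powr x * (2::real)" for x
    by (simp_all add: powr_diff powr_add)
  from walk_pos_half_eq[OF n e] show ?thesis
  proof
    assume a: "3/2 \<le> ?a"
    then have pot: "potential n (e + 1) = 2 * potential n e" "potential n (e - 1) = potential n e / 2"
      unfolding potential_def walk_pos_Suc using d2[of "?a - 1/2"] a by (simp_all add: algebra_simps)
    have "walk_up q n e \<le> 1/8" using walk_up_le[of e] small[of "- (2 * ?a)"] a by simp
    then show ?thesis unfolding pot by (rule drift[OF _ v])
  next
    assume a: "?a \<le> - 3/2"
    then have pot: "potential n (e + 1) = potential n e / 2" "potential n (e - 1) = 2 * potential n e"
      unfolding potential_def walk_pos_Suc using d2[of "- ?a - 1/2"] a by (simp_all add: algebra_simps)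
    have "1 - walk_up q n e \<le> 1/8" using walk_down_le[of e] small[of "2 * ?a"] a by simp
    from drift[OF this v] show ?thesis unfolding pot by simp
  qed
qed

lemma potential_inner:
  assumes e: "\<bar>walk_pos n e\<bar> = 1/2"
  shows "walk_up q n e * potential n (e + 1) + (1 - walk_up q n e) * potential n (e - 1) \<le> 4/3 * potential n e"
proof -
  let ?a = "walk_pos n e"
  have third: "1 / (1 + q powr 1) \<le> 1/3" using q2 by (simp add: field_simps)
  from e consider "?a = 1/2" | "?a = - 1/2" by linarith
  then show ?thesis
  proof cases
    case 1
    have "potential n (e + 1) = 2" "potential n (e - 1) = 1" "potential n e = 1"
      unfolding potential_def walk_pos_Suc 1 by simp_all
    moreover have "walk_up q n e \<le> 1/3" using third unfolding walk_up_def 1 by simp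
    ultimately show ?thesis by simp
  next
    case 2
    have "potential n (e + 1) = 1" "potential n (e - 1) = 2" "potential n e = 1"
      unfolding potential_def walk_pos_Suc 2 by simp_all
    moreover have "1 - walk_up q n e \<le> 1/3" using third unfolding one_minus_walk_up 2 by simp
    ultimately show ?thesis by simp
  qed
qed

lemma walk_rate_inner: "\<bar>walk_pos n e\<bar> = 1/2 \<Longrightarrow> walk_rate q n e \<le> q + 1"
proof -
  assume e: "\<bar>walk_pos n e\<bar> = 1/2"
  have "q powr (1/2) \<le> q powr 1" "q powr (- (1/2)) \<le> q powr 0" using q2 by (intro powr_mono; simp)+
  then have bound: "q powr (1/2) + q powr (- (1/2)) \<le> q + 1" using q2 by simp
  from e have "walk_pos n e = 1/2 \<or> walk_pos n e = - (1/2)" by linarith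
  then show ?thesis
  proof
    assume a: "walk_pos n e = 1/2"
    show ?thesis unfolding walk_rate_def a by (rule bound)
  next
    assume a: "walk_pos n e = - (1/2)"
    show ?thesis unfolding walk_rate_def a using bound by simp
  qed
qed

section \<open>One tick of the coupled walks\<close>

lemma tick_coupling_walk:
  "d0 \<le> n \<Longrightarrow> tick_coupling (walk_rate q n) (walk_up q n) (walk_leave q n) (chain_pmf q n) d0 n"
  by unfold_locales (auto simp: walk_rate_pos walk_up_bounds walk_leave_bounds intro!: set_chain_pmf)

context
  fixes d0 :: nat
  assumes d0: "d0 \<le> n"
begin

interpretation tick_coupling "walk_rate q n" "walk_up q n" "walk_leave q n" "chain_pmf q n" d0 n
  by (rule tick_coupling_walk[OF d0])

lemma drift_potential_walk:
  assumes n: "odd n"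
  shows "drift_potential (potential n) {e. \<bar>walk_pos n e\<bar> = 1/2}"
  unfolding drift_potential_def
proof (intro conjI allI ballI)
  show "1 \<le> potential n e" for e by (rule potential_ge_1[OF n])
  show "walk_up q n e * potential n (e + 1) + (1 - walk_up q n e) * potential n (e - 1) \<le> 4/3 * potential n e"
    if "e \<in> {e. \<bar>walk_pos n e\<bar> = 1/2}" for e using potential_inner[of e] that by simp
  show "walk_up q n e * potential n (e + 1) + (1 - walk_up q n e) * potential n (e - 1) \<le> 5/6 * potential n e"
    if "e \<in> - {e. \<bar>walk_pos n e\<bar> = 1/2}" for e using potential_outer[OF n, of e] that by simp
qed

lemma two_step_pmf:
  assumes "d \<le> n" shows "pmf (map_pmf (\<lambda>w. int (snd w)) (W d)) (int d') = two_step q n d d'"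
proof -
  have "map_pmf (\<lambda>w. int (snd w)) (W d) = map_pmf int (bind_pmf (chain_pmf q n d) (chain_pmf q n))"
    unfolding W_def map_bind_pmf by (intro bind_pmf_cong refl) (simp add: map_pmf_comp)
  then have "pmf (map_pmf (\<lambda>w. int (snd w)) (W d)) (int d') = pmf (bind_pmf (chain_pmf q n d) (chain_pmf q n)) d'"
    by (simp add: pmf_map_inj')
  also have "\<dots> = (\<Sum>m\<le>n. pmf (chain_pmf q n m) d' * pmf (chain_pmf q n d) m)"
    unfolding pmf_bind using set_chain_pmf by (intro integral_measure_pmf_real) auto
  also have "\<dots> = two_step q n d d'"
    unfolding two_step_def using assms by (intro sum.cong) (auto simp: pmf_chain_pmf)
  finally show ?thesis .
qed

text \<open>The walk stays put with the same probability as two steps of the chain, so only the jumps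
  contribute to the excess of one law over the other; an outward jump from the rim of the range
  has a probability of at most the ratio of the two rates there.\<close>
lemma prob_mismatch:
  assumes e: "e \<in> central n h" and \<eta>: "q powr (h - real n / 2) \<le> 1/8" (is "?\<eta> \<le> _")
  shows "measure_pmf.prob (joint_law (nat e) e) {z. \<not> matched (central n h) z}
    \<le> walk_leave q n e * (8 * ?\<eta> + 2 * q powr (- (2 * (h - 1))))"
proof -
  have "?\<eta> < 1" using \<eta> by simp
  note cb = central_bounds[OF e this]
  note tb = two_step_bounds[OF cb(1,2,4,5) \<eta>] and cl = central_leave[OF e \<eta>]
  define d where "d = nat e"
  have d: "d \<le> n" "0 < d" "int d = e" using cb by (auto simp: d_def)
  define E where "E = exit_scale q n d"
  have \<eta>0: "?\<eta> > 0" using q2 by simp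
  have E: "0 < E" "E \<le> 2 * ?\<eta>" unfolding E_def d_def by (rule tb)+
  have lE: "walk_leave q n e \<le> E" "E * (1 - 4 * ?\<eta>) \<le> walk_leave q n e" unfolding E_def d_def by (rule cl)+
  let ?l = "walk_leave q n e" and ?u = "walk_up q n e"
  have l0: "?l \<ge> 0" using walk_leave_bounds[of q n e] by simp
  let ?gap = "\<lambda>y. max 0 (pmf (tick_law e) y - pmf (map_pmf (\<lambda>w. int (snd w)) (W d)) y)"
  have A: "pmf (tick_law e) e = 1 - ?l" "pmf (tick_law e) (e + 1) = ?l * ?u" "pmf (tick_law e) (e - 1) = ?l * (1 - ?u)"
    by (simp_all add: pmf_tick_law dir_prob_def)
  have I: "e + 1 = int (d + 1)" "e - 1 = int (d - 1)" using d by auto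
  have gap0: "?gap e = 0"
    using two_step_pmf[OF d(1), of d] cl(1) by (simp add: A d d_def[symmetric])
  have t0: "step_scale q k > 0" for k by (rule step_scale_pos[OF q2])
  have gap1: "?gap (e + 1) \<le> 4 * ?\<eta> * step_scale q d"
  proof -
    have "?l * ?u \<le> E * ?u" using lE walk_up_bounds[of e] by (intro mult_right_mono) auto
    also have "\<dots> = step_scale q d" using exit_split(1)[OF d(1)] by (simp add: E_def d)
    finally have "?l * ?u - two_step q n d (d + 1) \<le> 4 * ?\<eta> * step_scale q d"
      using tb(2) by (simp add: d_def[symmetric] algebra_simps)
    then show ?thesis using two_step_pmf[OF d(1), of "d + 1"] t0[of d] \<eta>0 unfolding A(2) unfolding I(1) by simp
  qed
  have gap2: "?gap (e - 1) \<le> 4 * ?\<eta> * step_scale q (n - d)"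
  proof -
    have "?l * (1 - ?u) \<le> E * (1 - ?u)" using lE walk_up_bounds[of e] by (intro mult_right_mono) auto
    also have "\<dots> = step_scale q (n - d)" using exit_split(2)[OF d(1)] by (simp add: E_def d)
    finally have "?l * (1 - ?u) - two_step q n d (d - 1) \<le> 4 * ?\<eta> * step_scale q (n - d)"
      using tb(3) by (simp add: d_def[symmetric] algebra_simps)
    then show ?thesis using two_step_pmf[OF d(1), of "d - 1"] t0[of "n - d"] \<eta>0 unfolding A(3) unfolding I(2) by simp
  qed
  have "measure_pmf.prob (joint_law d e) {z. int (snd (fst z)) \<noteq> snd z} \<le> (\<Sum>y\<in>{e - 1, e, e + 1}. ?gap y)"
    using joint_law(3)[of d e] unfolding set_tick_law .
  also have "\<dots> = ?gap (e - 1) + ?gap e + ?gap (e + 1)" by simp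
  also have "\<dots> \<le> 4 * ?\<eta> * E"
  proof -
    have "4 * ?\<eta> * E = 4 * ?\<eta> * step_scale q d + 4 * ?\<eta> * step_scale q (n - d)" by (simp only: E_def exit_scale_def distrib_left)
    then show ?thesis using gap0 gap1 gap2 by linarith
  qed
  also have "\<dots> \<le> 8 * ?\<eta> * ?l"
  proof -
    have "E * (1/2) \<le> E * (1 - 4 * ?\<eta>)" using E \<eta> by (intro mult_left_mono) auto
    then have "E \<le> 2 * ?l" using lE by linarith
    then have "4 * ?\<eta> * E \<le> 4 * ?\<eta> * (2 * ?l)" using \<eta>0 by (intro mult_left_mono) auto
    then show ?thesis by simp
  qed
  finally have 1: "measure_pmf.prob (joint_law d e) {z. int (snd (fst z)) \<noteq> snd z} \<le> 8 * ?\<eta> * ?l" .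
  let ?b = "q powr (- (2 * (h - 1)))"
  \<comment> \<open>Mass that leaves the range upwards and downwards.\<close>
  have out1: "(if e + 1 \<in> central n h then 0 else ?l * ?u) \<le> ?l * ?b"
  proof (cases "e + 1 \<in> central n h")
    case False
    then have "h - 1 < walk_pos n e" using e by (auto simp: central_def walk_pos_Suc)
    then have "q powr (- (2 * walk_pos n e)) \<le> ?b" using q2 by (intro powr_mono) auto
    then have "?u \<le> ?b" using walk_up_le[of e] by linarith
    then show ?thesis using False l0 by (simp add: mult_left_mono)
  qed (use l0 in simp)
  have out2: "(if e - 1 \<in> central n h then 0 else ?l * (1 - ?u)) \<le> ?l * ?b"
  proof (cases "e - 1 \<in> central n h")
    case False
    then have "walk_pos n e < - (h - 1)" using e by (auto simp: central_def walk_pos_Suc)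
    then have "q powr (2 * walk_pos n e) \<le> ?b" using q2 by (intro powr_mono) auto
    then have "1 - ?u \<le> ?b" using walk_down_le[of e] by linarith
    then show ?thesis using False l0 by (simp add: mult_left_mono)
  qed (use l0 in simp)
  have "measure_pmf.prob (joint_law d e) {z. snd z \<notin> central n h} = measure_pmf.prob (tick_law e) (- central n h)"
    unfolding joint_law(2)[of d e, symmetric] by (simp add: vimage_def)
  also have "\<dots> = measure_pmf.prob (tick_law e) (- central n h \<inter> {e - 1, e, e + 1})"
    by (metis measure_Int_set_pmf set_tick_law)
  also have "\<dots> = (\<Sum>y\<in>- central n h \<inter> {e - 1, e, e + 1}. pmf (tick_law e) y)"
    by (rule measure_measure_pmf_finite) simp
  also have "\<dots> = (\<Sum>y\<in>{e - 1, e, e + 1}. if y \<in> central n h then 0 else pmf (tick_law e) y)"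
    by (intro sum.mono_neutral_cong_left) auto
  also have "\<dots> = (if e - 1 \<in> central n h then 0 else ?l * (1 - ?u)) + (if e + 1 \<in> central n h then 0 else ?l * ?u)"
    using e A by simp
  finally have 2: "measure_pmf.prob (joint_law d e) {z. snd z \<notin> central n h} \<le> ?l * ?b + ?l * ?b"
    using out1 out2 by linarith
  have "{z. \<not> matched (central n h) z} \<subseteq> {z. int (snd (fst z)) \<noteq> snd z} \<union> {z. snd z \<notin> central n h}"
    by (auto simp: matched_def)
  then have "measure_pmf.prob (joint_law d e) {z. \<not> matched (central n h) z}
     \<le> measure_pmf.prob (joint_law d e) ({z. int (snd (fst z)) \<noteq> snd z} \<union> {z. snd z \<notin> central n h})"
    by (intro measure_pmf.finite_measure_mono) auto
  also have "\<dots> \<le> measure_pmf.prob (joint_law d e) {z. int (snd (fst z)) \<noteq> snd z} + measure_pmf.prob (joint_law d e) {z. snd z \<notin> central n h}"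
    by (rule measure_Un_le) auto
  finally show ?thesis using 1 2 by (simp add: d_def algebra_simps)
qed

end
end

section \<open>Choice of the constants\<close>

text \<open>In the variable \<open>z = q powr (n/50)\<close> all quantities are powers: there are \<open>z ^ 8\<close> jumps, the error in time
  is \<open>1 / z ^ 4\<close>, the relative errors are of order \<open>1 / z ^ 17\<close>, and \<open>N\<close> is \<open>z ^ 25\<close> up to a constant.\<close>
lemma eventually_small:
  fixes q :: real assumes "q > 0"
  shows "eventually (\<lambda>z::real. z ^ 8 * exp (- (z ^ 5 / (8 * q))) \<le> 1 / z ^ 8 \<and>
     (5/6) powr (z ^ 8 - 1) * 4 powr ((q + 1) * z ^ 4 / ln 2) * z ^ 8 \<le> 1 / z ^ 8 \<and>
     8 * q \<le> z ^ 17 \<and> 2 \<le> z ^ 13) at_top"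
proof (intro eventually_conj)
  show "eventually (\<lambda>z::real. z ^ 8 * exp (- (z ^ 5 / (8 * q))) \<le> 1 / z ^ 8) at_top"
    using assms by real_asymp
  show "eventually (\<lambda>z::real. (5/6) powr (z ^ 8 - 1) * 4 powr ((q + 1) * z ^ 4 / ln 2) * z ^ 8 \<le> 1 / z ^ 8) at_top"
    using assms by real_asymp
  show "eventually (\<lambda>z::real. 8 * q \<le> z ^ 17) at_top" using assms by real_asymp
  show "eventually (\<lambda>z::real. 2 \<le> z ^ 13) at_top" by real_asymp
qed

text \<open>The holding times are cut off at \<open>z ^ 5 / (16 * q)\<close>: this is large enough for the exponential tail
  to be negligible, and small enough for \<open>z ^ 8\<close> holding times with a relative error of \<open>8 * q / z ^ 17\<close> to contribute
  at most half of the permitted \<open>1 / z ^ 4\<close>.\<close>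
lemma coupling_large_n:
  fixes q z :: real and n d0 :: nat
  defines "z \<equiv> q powr (real n / 50)"
  assumes q2: "2 \<le> q" and n: "odd n" and d0: "d0 \<le> n" and a: "\<bar>walk_pos n (int d0)\<bar> \<le> 4/25 * real n"
    and z1: "z ^ 8 * exp (- (z ^ 5 / (8 * q))) \<le> 1 / z ^ 8"
    and z2: "(5/6) powr (z ^ 8 - 1) * 4 powr ((q + 1) * z ^ 4 / ln 2) * z ^ 8 \<le> 1 / z ^ 8"
    and z3: "8 * q \<le> z ^ 17" and z4: "2 \<le> z ^ 13"
  defines "X' \<equiv> tick_coupling.X (walk_up q n) (walk_leave q n) (chain_pmf q n) d0"
    and "Z' \<equiv> tick_coupling.Z (walk_rate q n) (walk_up q n) d0 n"
    and "m \<equiv> nat \<lfloor>z ^ 8\<rfloor>"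
  shows "\<P>(\<omega> in noise. paths_close m (1 / z ^ 4) (z ^ 4) (\<lambda>t. Y_process q n X' t \<omega>) (\<lambda>t. Z' t \<omega>))
    \<ge> 1 - (8 * q + 4) / z ^ 8"
proof -
  interpret tick_coupling "walk_rate q n" "walk_up q n" "walk_leave q n" "chain_pmf q n" d0 n
    by (rule tick_coupling_walk[OF q2 d0])
  define h where "h = 4/25 * real n + 1"
  define s where "s = z ^ 5 / (16 * q)"
  let ?N = "q powr (real n / 2) * (q - 1)"
  let ?\<eta> = "q powr (h - real n / 2)"
  have q0: "q > 0" using q2 by simp
  have zpow: "z ^ k = q powr (real n / 50 * real k)" for k
    unfolding z_def using q0 by (simp add: powr_power mult.commute)
  have zz: "z \<ge> 1" unfolding z_def using q2 by (intro ge_one_powr_ge_zero) auto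
  have zk: "z ^ k \<ge> 1" for k using zz by simp
  have N: "?N > 0" using q2 by simp
  have \<eta>: "?\<eta> = q / z ^ 17"
  proof -
    have "?\<eta> = q powr (1 - 17/50 * real n)" by (simp add: h_def)
    also have "\<dots> = q / q powr (17/50 * real n)" using q0 by (simp add: powr_diff)
    finally show ?thesis unfolding zpow by (simp add: mult.commute)
  qed
  have \<eta>8: "?\<eta> \<le> 1/8" 
  proof -
    have "q / z ^ 17 \<le> (z ^ 17 / 8) / z ^ 17" using z3 zz by (intro divide_right_mono) auto
    also have "\<dots> = 1/8" using zz by simp
    finally show ?thesis unfolding \<eta> .
  qed
  have exit: "q powr (- (2 * (h - 1))) = 1 / z ^ 16"
    unfolding zpow h_def using q0 by (simp add: powr_minus field_simps)
  have m: "real m \<le> z ^ 8" "z ^ 8 - 1 \<le> real m" unfolding m_def using zk[of 8] by linarith+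
  have d0c: "int d0 \<in> central n h" using a by (simp add: central_def h_def)
  have "\<P>(\<omega> in noise. paths_close m (1 / z ^ 4) (z ^ 4)
      (\<lambda>t. real (X' (2 * nat \<lfloor>?N * t\<rfloor>) \<omega>) - real n / 2) (\<lambda>t. Z' t \<omega>))
    \<ge> 1 - (real m * (8 * ?\<eta> + 2 * q powr (- (2 * (h - 1)))) + real m * exp (- 2 * s)
          + (5/6) ^ m * 4 powr ((q + 1) * z ^ 4 / ln 2) * potential n (int d0))"
    unfolding X'_def Z'_def
  proof (rule prob_coupling[where R="central n h" and \<epsilon>="8 * ?\<eta>" and C="{e. \<bar>walk_pos n e\<bar> = 1/2}"])
    show "q powr (real n / 2) * (q - 1) > 0" by (rule N)
    show "0 \<le> 8 * ?\<eta> + 2 * q powr (- (2 * (h - 1)))" by simp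
    show "measure_pmf.prob (joint_law (nat e) e) {z. \<not> matched (central n h) z}
        \<le> walk_leave q n e * (8 * ?\<eta> + 2 * q powr (- (2 * (h - 1))))" if "e \<in> central n h" for e
      by (rule prob_mismatch[OF q2 d0 that \<eta>8])
    show "\<bar>walk_rate q n e / (?N * - ln (1 - walk_leave q n e)) - 1\<bar> \<le> 8 * ?\<eta>" if "e \<in> central n h" for e
      by (rule central_rate_ratio[OF q2 that \<eta>8])
    show "2 \<le> walk_rate q n e" for e by (rule walk_rate_ge_2[OF q2])
    show "drift_potential (potential n) {e. \<bar>walk_pos n e\<bar> = 1/2}" by (rule drift_potential_walk[OF q2 d0 n])
    show "walk_rate q n e \<le> q + 1" if "e \<in> {e. \<bar>walk_pos n e\<bar> = 1/2}" for e
      using walk_rate_inner[OF q2] that by simp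
    show "real m * (1 / ?N + s * (8 * ?\<eta>)) \<le> 1 / z ^ 4"
    proof -
      have "?N = z ^ 25 * (q - 1)" unfolding zpow by simp
      moreover have "z ^ 25 * 1 \<le> z ^ 25 * (q - 1)" using q2 zz by (intro mult_left_mono) auto
      ultimately have "1 / ?N \<le> 1 / z ^ 25" using zz by (simp add: frac_le)
      moreover have "s * (8 * ?\<eta>) = 1 / (2 * z ^ 12)"
      proof -
        have "z ^ 17 = z ^ 5 * z ^ 12" by (simp flip: power_add)
        then show ?thesis unfolding s_def \<eta> using q0 zz by (simp add: field_simps)
      qed
      ultimately have "real m * (1 / ?N + s * (8 * ?\<eta>)) \<le> z ^ 8 * (1 / z ^ 25 + 1 / (2 * z ^ 12))"
        using m(1) zz N by (intro mult_mono add_mono) (auto intro: add_nonneg_nonneg)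
      also have "\<dots> = 1 / z ^ 4 * (1 / z ^ 13 + 1/2)"
      proof -
        have "z ^ 25 = z ^ 8 * (z ^ 4 * z ^ 13)" "z ^ 12 = z ^ 8 * z ^ 4" by (simp_all flip: power_add)
        then show ?thesis using zz by (simp add: field_simps)
      qed
      also have "\<dots> \<le> 1 / z ^ 4 * 1"
      proof (rule mult_left_mono)
        have "1 / z ^ 13 \<le> 1 / 2" using z4 zz by (intro divide_left_mono) auto
        then show "1 / z ^ 13 + 1/2 \<le> 1" by simp
      qed (use zz in simp)
      finally show ?thesis by simp
    qed
  qed (use d0c q0 zz in \<open>simp_all add: s_def\<close>)
  moreover have "real m * (8 * ?\<eta> + 2 * q powr (- (2 * (h - 1)))) \<le> (8 * q + 2) / z ^ 8"
  proof -
    have "8 * ?\<eta> + 2 * q powr (- (2 * (h - 1))) \<le> (8 * q + 2) / z ^ 16"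
    proof -
      have "z ^ 16 \<le> z ^ 17" using zz by (intro power_increasing) auto
      then have "q / z ^ 17 \<le> q / z ^ 16" using q0 zz by (intro divide_left_mono) auto
      then show ?thesis unfolding \<eta> exit by (simp add: add_divide_distrib)
    qed
    then have "real m * (8 * ?\<eta> + 2 * q powr (- (2 * (h - 1)))) \<le> z ^ 8 * ((8 * q + 2) / z ^ 16)"
      using m(1) zz by (intro mult_mono) auto
    also have "\<dots> = (8 * q + 2) / z ^ 8"
    proof -
      have "z ^ 16 = z ^ 8 * z ^ 8" by (simp flip: power_add)
      then show ?thesis using zz by (simp add: field_simps)
    qed
    finally show ?thesis .
  qed
  moreover have "real m * exp (- 2 * s) \<le> 1 / z ^ 8"
  proof -
    have "real m * exp (- 2 * s) \<le> z ^ 8 * exp (- (z ^ 5 / (8 * q)))"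
      using m(1) by (intro mult_mono) (auto simp: s_def)
    then show ?thesis using z1 by linarith
  qed
  moreover have "(5/6) ^ m * 4 powr ((q + 1) * z ^ 4 / ln 2) * potential n (int d0) \<le> 1 / z ^ 8"
  proof -
    have "(5/6 :: real) ^ m = (5/6) powr real m" by (simp add: powr_realpow)
    also have "\<dots> \<le> (5/6) powr (z ^ 8 - 1)" using m(2) by (intro powr_mono') auto
    finally have 1: "(5/6 :: real) ^ m \<le> (5/6) powr (z ^ 8 - 1)" .
    have "potential n (int d0) \<le> 2 powr (4/25 * real n)"
      unfolding potential_def using a by (intro powr_mono) auto
    also have "\<dots> \<le> q powr (4/25 * real n)" using q2 by (intro powr_mono2) auto
    also have "\<dots> = z ^ 8" unfolding zpow by simp
    finally have "potential n (int d0) \<le> z ^ 8" .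
    then have "(5/6) ^ m * 4 powr ((q + 1) * z ^ 4 / ln 2) * potential n (int d0) \<le>
       (5/6) powr (z ^ 8 - 1) * 4 powr ((q + 1) * z ^ 4 / ln 2) * z ^ 8"
      using 1 by (intro mult_mono mult_nonneg_nonneg) (auto simp: potential_def)
    then show ?thesis using z2 by linarith
  qed
  moreover have "(8 * q + 4) / z ^ 8 = (8 * q + 2) / z ^ 8 + 1 / z ^ 8 + 1 / z ^ 8"
    by (simp add: add_divide_distrib[symmetric])
  ultimately show ?thesis unfolding Y_process_def by linarith
qed

theorem theorem11:
  fixes q :: nat and \<alpha> :: real
  assumes q: "primepow q" and alpha: "\<alpha> = 0.08"
  shows "\<exists>C::real. \<forall>(n::nat) (a::real).
    odd n \<and> a \<in> half_ints \<and> \<bar>a\<bar> \<le> 2 * \<alpha> * real n \<longrightarrow>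
    (\<exists>(M :: (nat \<Rightarrow> real) measure) (X :: nat \<Rightarrow> (nat \<Rightarrow> real) \<Rightarrow> nat)
      (Z :: real \<Rightarrow> (nat \<Rightarrow> real) \<Rightarrow> real) (d0 :: nat).
      real d0 - real n / 2 = a \<and>
      markov_chain M {0..n} (trans_prob (real q) n) d0 X \<and>
      cont_markov_chain M half_ints (odd_rate (real q)) a Z \<and>
      \<P>(\<omega> in M.
        (\<forall>i::nat. real i \<le> real q powr (2 * \<alpha> * real n) \<longrightarrow>
           jump_value (\<lambda>t. Y_process (real q) n X t \<omega>) i = jump_value (\<lambda>t. Z t \<omega>) i) \<and>
        (\<forall>i::nat. real i \<le> real q powr (2 * \<alpha> * real n) \<longrightarrow>
           \<bar>jump_time (\<lambda>t. Y_process (real q) n X t \<omega>) i - jump_time (\<lambda>t. Z t \<omega>) i\<bar>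
             \<le> ereal (real q powr (- \<alpha> * real n))) \<and>
        jump_time (\<lambda>t. Z t \<omega>) (nat \<lfloor>real q powr (2 * \<alpha> * real n)\<rfloor>)
          \<ge> ereal (real q powr (\<alpha> * real n)))
      \<ge> 1 - C * real q powr (- 2 * \<alpha> * real n))"
proof -
  define r where "r = real q"
  have q2: "2 \<le> r" using primepow_gt_Suc_0[OF q] by (simp add: r_def)
  obtain z0 where z0: "\<And>z. z \<ge> z0 \<Longrightarrow> z ^ 8 * exp (- (z ^ 5 / (8 * r))) \<le> 1 / z ^ 8 \<and>
     (5/6) powr (z ^ 8 - 1) * 4 powr ((r + 1) * z ^ 4 / ln 2) * z ^ 8 \<le> 1 / z ^ 8 \<and>
     8 * r \<le> z ^ 17 \<and> 2 \<le> z ^ 13"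
    using eventually_small[of r] q2 by (auto simp: eventually_at_top_linorder)
  define C where "C = max (8 * r + 4) (\<bar>z0\<bar> ^ 8)"
  show ?thesis unfolding r_def[symmetric]
  proof (intro exI[of _ C] allI impI, elim conjE)
    fix n :: nat and a :: real
    assume n: "odd n" and ah: "a \<in> half_ints" and an: "\<bar>a\<bar> \<le> 2 * \<alpha> * real n"
    obtain j where j: "n = 2 * j + 1" using n by (auto elim: oddE)
    obtain k where k: "a = of_int k + 1/2" using ah by (auto simp: half_ints_def)
    have e: "real_of_int (k + int j + 1) - real n / 2 = a" by (simp add: j k field_simps)
    have an': "\<bar>a\<bar> \<le> 4/25 * real n" using an by (simp add: alpha)
    then have "0 \<le> real_of_int (k + int j + 1)" "real_of_int (k + int j + 1) \<le> real n" using e by linarith+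
    then have "0 \<le> k + int j + 1" "k + int j + 1 \<le> int n" by linarith+
    then obtain d0 where d0: "k + int j + 1 = int d0" "d0 \<le> n" by (metis of_nat_le_iff zero_le_imp_eq_int)
    have ad0: "real d0 - real n / 2 = a" "walk_pos n (int d0) = a" using e d0 by (simp_all add: walk_pos_def)
    interpret tick_coupling "walk_rate r n" "walk_up r n" "walk_leave r n" "chain_pmf r n" d0 n
      by (rule tick_coupling_walk[OF q2 d0(2)])
    define z where "z = r powr (real n / 50)"
    have zpow: "z ^ k = r powr (real n / 50 * real k)" for k
      unfolding z_def using q2 by (simp add: powr_power mult.commute)
    have zz: "z \<ge> 1" unfolding z_def using q2 by (intro ge_one_powr_ge_zero) auto
    have powrs: "r powr (2 * \<alpha> * real n) = z ^ 8" "r powr (\<alpha> * real n) = z ^ 4"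
      "r powr (- \<alpha> * real n) = 1 / z ^ 4" "r powr (- 2 * \<alpha> * real n) = 1 / z ^ 8"
      unfolding zpow alpha using q2 by (simp_all add: powr_minus field_simps)
    have lim: "real i \<le> z ^ 8 \<longleftrightarrow> i \<le> nat \<lfloor>z ^ 8\<rfloor>" for i using zz by (simp add: le_nat_iff le_floor_iff)
    have X: "markov_chain noise {0..n} (trans_prob r n) d0 X"
      by (rule X_markov) (simp add: pmf_chain_pmf[OF q2])
    have top: "AE \<omega> in noise. filterlim (\<lambda>k. T k \<omega>) at_top sequentially"
      using walk_rate_inner[OF q2] q2
      by (intro AE_T_at_top[OF drift_potential_walk[OF q2 d0 n], where \<rho>="r + 1"]) auto
    have "cont_markov_chain noise half_ints (odd_rate r) (walk_pos n (int d0)) Z"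
    proof (rule Z_markov[OF n _ _ top])
      show "walk_rate r n e = r powr walk_pos n e + r powr - walk_pos n e" for e by (simp add: walk_rate_def)
      show "walk_up r n e * walk_rate r n e = r powr - walk_pos n e" for e by (simp add: walk_up_rate[OF q2])
    qed
    then have Z: "cont_markov_chain noise half_ints (odd_rate r) a Z" by (simp add: ad0)
    have "1 - C / z ^ 8 \<le> \<P>(\<omega> in noise. paths_close (nat \<lfloor>z ^ 8\<rfloor>) (1 / z ^ 4) (z ^ 4)
        (\<lambda>t. Y_process r n X t \<omega>) (\<lambda>t. Z t \<omega>))" (is "_ \<le> ?p")
    \<comment> \<open>For small \<open>z\<close> the constant makes the claimed lower bound nonpositive.\<close>
    proof (cases "z \<ge> z0")
      case True
      have "1 - C / z ^ 8 \<le> 1 - (8 * r + 4) / z ^ 8" using zz by (simp add: C_def divide_right_mono)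
      also have "\<dots> \<le> ?p"
        using z0[OF True] an' ad0 unfolding z_def by (intro coupling_large_n q2 n d0) simp_all
      finally show ?thesis .
    next
      case False
      then have "z ^ 8 \<le> \<bar>z0\<bar> ^ 8" using zz by (intro power_mono) auto
      then have "z ^ 8 \<le> C" by (simp add: C_def)
      then have "1 - C / z ^ 8 \<le> 0" using zz by (simp add: field_simps)
      then show ?thesis by (rule order.trans) simp
    qed
    then show "\<exists>(M :: (nat \<Rightarrow> real) measure) X Z d0. real d0 - real n / 2 = a \<and> markov_chain M {0..n} (trans_prob r n) d0 X \<and>
      cont_markov_chain M half_ints (odd_rate r) a Z \<and>
      \<P>(\<omega> in M.
        (\<forall>i::nat. real i \<le> r powr (2 * \<alpha> * real n) \<longrightarrow>
           jump_value (\<lambda>t. Y_process r n X t \<omega>) i = jump_value (\<lambda>t. Z t \<omega>) i) \<and>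
        (\<forall>i::nat. real i \<le> r powr (2 * \<alpha> * real n) \<longrightarrow>
           \<bar>jump_time (\<lambda>t. Y_process r n X t \<omega>) i - jump_time (\<lambda>t. Z t \<omega>) i\<bar>
             \<le> ereal (r powr (- \<alpha> * real n))) \<and>
        jump_time (\<lambda>t. Z t \<omega>) (nat \<lfloor>r powr (2 * \<alpha> * real n)\<rfloor>)
          \<ge> ereal (r powr (\<alpha> * real n)))
      \<ge> 1 - C * r powr (- 2 * \<alpha> * real n)"
      unfolding powrs lim paths_close_def using ad0(1) X Z by (intro exI[of _ noise] exI[of _ X] exI[of _ Z] exI[of _ d0] conjI) simp_all
  qed
qed

end
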